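(* Let $p$ be a prime. There exists a finitely generated, inaccessible, residually $p$-finite discrete group.
   Context: A discrete group $G$ is residually $p$-finite if for every $g\in G\smallsetminus\{1\}$ there is a homomorphism from $G$ to a finite $p$-group which does not kill $g$. A graph of discrete groups $(X,G_\bullet)$ consists of a connected graph $X$ (vertex set $VX$, edge set $EX$, endpoint maps $d_0,d_1\colon EX\to VX$), a group $G_x$ for each vertex or edge $x$, and monomorphisms $\partial_{e,k}\colon G_e\to G_{d_k(e)}$ for each $e\in EX$ and $k=0,1$; it is finite if $X$ is finite, and reduced if $\partial_{e,k}$ is never an isomorphism when $e$ is not a loop. Its fundamental group is the usual Bass–Serre fundamental group. A discrete group $G$ is accessible if there is a number $n=n(G)$ such that any finite, reduced graph of discrete groups with finite edge groups having fundamental group isomorphic to $G$ has at most $n$ edges; otherwise $G$ is inaccessible. *)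

theory Defs
  imports
    "HOL-Algebra.Generated_Groups"
    "HOL-Computational_Algebra.Primes"
    "Graph_Theory.Digraph_Component"
begin

section \<open>Residual \<open>p\<close>-finiteness and finite generation\<close>

definition finite_p_group :: "nat \<Rightarrow> ('a, 'b) monoid_scheme \<Rightarrow> bool" where
  "finite_p_group p P \<longleftrightarrow> group P \<and> finite (carrier P) \<and> (\<exists>k. order P = p ^ k)"

text \<open>Every finite group has an isomorphic copy on a set of natural numbers, so it is no
  restriction that the target groups below live on \<open>nat\<close>.\<close>

definition residually_p_finite :: "nat \<Rightarrow> ('a, 'b) monoid_scheme \<Rightarrow> bool" where
  "residually_p_finite p G \<longleftrightarrow>
     (\<forall>g \<in> carrier G - {\<one>\<^bsub>G\<^esub>}. \<exists>(P :: nat monoid) h.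
        finite_p_group p P \<and> h \<in> hom G P \<and> h g \<noteq> \<one>\<^bsub>P\<^esub>)"

definition finitely_generated :: "('a, 'b) monoid_scheme \<Rightarrow> bool" where
  "finitely_generated G \<longleftrightarrow> (\<exists>S. finite S \<and> S \<subseteq> carrier G \<and> generate G S = carrier G)"


section \<open>Groups given by generators and relations\<close>

text \<open>The letter \<open>(x, False)\<close> stands for the generator \<open>x\<close> and \<open>(x, True)\<close> for its formal
  inverse. Relations are pairs \<open>(u, w)\<close>, read as \<open>u = w\<close>.\<close>

type_synonym 'x word = "('x \<times> bool) list"

definition words :: "'x set \<Rightarrow> 'x word set" where
  "words S = lists (S \<times> UNIV)"

inductive pres_eq :: "'x set \<Rightarrow> ('x word \<times> 'x word) set \<Rightarrow> 'x word \<Rightarrow> 'x word \<Rightarrow> bool"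
  for S R where
  refl: "pres_eq S R u u"
| sym: "pres_eq S R u w \<Longrightarrow> pres_eq S R w u"
| trans: "pres_eq S R u v \<Longrightarrow> pres_eq S R v w \<Longrightarrow> pres_eq S R u w"
| append: "pres_eq S R u u' \<Longrightarrow> pres_eq S R w w' \<Longrightarrow> pres_eq S R (u @ w) (u' @ w')"
| cancel: "x \<in> S \<Longrightarrow> pres_eq S R [(x, b), (x, \<not> b)] []"
| relation: "(u, w) \<in> R \<Longrightarrow> pres_eq S R u w"

definition pres_rel :: "'x set \<Rightarrow> ('x word \<times> 'x word) set \<Rightarrow> ('x word \<times> 'x word) set" where
  "pres_rel S R = {(u, w). u \<in> words S \<and> w \<in> words S \<and> pres_eq S R u w}"

definition presented_group ::
    "'x set \<Rightarrow> ('x word \<times> 'x word) set \<Rightarrow> 'x word set monoid" where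
  "presented_group S R =
     \<lparr> carrier = words S // pres_rel S R,
       monoid.mult = (\<lambda>A B. \<Union>u \<in> A. \<Union>w \<in> B. pres_rel S R `` {u @ w}),
       monoid.one = pres_rel S R `` {[]} \<rparr>"

lemma words_Nil [simp]: "[] \<in> words S"
  and words_Cons [simp]: "a # u \<in> words S \<longleftrightarrow> fst a \<in> S \<and> u \<in> words S"
  and words_append [simp]: "u @ w \<in> words S \<longleftrightarrow> u \<in> words S \<and> w \<in> words S"
  by (cases a; auto simp: words_def)+

lemma equiv_pres_rel: "equiv (words S) (pres_rel S R)"
  by (rule equivI)
     (auto simp: pres_rel_def refl_on_def intro: pres_eq.refl
       intro!: symI transI dest: pres_eq.sym pres_eq.trans)

lemma pres_rel_mult:
  assumes "u \<in> words S" "w \<in> words S"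
  shows "pres_rel S R `` {u} \<otimes>\<^bsub>presented_group S R\<^esub> pres_rel S R `` {w} = pres_rel S R `` {u @ w}"
proof -
  have "congruent2 (pres_rel S R) (pres_rel S R) (\<lambda>u w. pres_rel S R `` {u @ w})"
    by (rule congruent2I')
       (rule equiv_class_eq [OF equiv_pres_rel],
         auto simp: pres_rel_def intro: pres_eq.append)
  from UN_equiv_class2 [OF equiv_pres_rel equiv_pres_rel this assms] show ?thesis
    by (simp add: presented_group_def)
qed

lemma pres_eq_inverse:
  "u \<in> words S \<Longrightarrow> \<exists>w \<in> words S. pres_eq S R (w @ u) []"
proof (induction u)
  case Nil
  then show ?case by (auto intro: pres_eq.refl)
next
  case (Cons a u)
  obtain x b where a: "a = (x, b)" by force
  from Cons obtain w where w: "w \<in> words S" "pres_eq S R (w @ u) []" by auto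
  have "pres_eq S R [(x, \<not> b), (x, b)] []"
    using Cons.prems a pres_eq.cancel [of x S R "\<not> b"] by simp
  then have "pres_eq S R (w @ [(x, \<not> b), (x, b)] @ u) (w @ [] @ u)"
    by (intro pres_eq.append pres_eq.refl)
  with w have "pres_eq S R ((w @ [(x, \<not> b)]) @ a # u) []"
    using a by (auto intro: pres_eq.trans)
  with w Cons.prems a show ?case
    by (intro bexI [of _ "w @ [(x, \<not> b)]"]) auto
qed

lemma group_presented_group: "group (presented_group S R)"
proof (rule groupI)
  let ?c = "\<lambda>u. pres_rel S R `` {u}" and ?P = "presented_group S R"
  have car: "A \<in> carrier ?P \<longleftrightarrow> (\<exists>u \<in> words S. A = ?c u)" for A
    by (auto simp: presented_group_def quotient_def)
  have one: "\<one>\<^bsub>?P\<^esub> = ?c []" by (simp add: presented_group_def)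
  show "A \<otimes>\<^bsub>?P\<^esub> B \<in> carrier ?P" if "A \<in> carrier ?P" "B \<in> carrier ?P" for A B
    using that unfolding car by (metis pres_rel_mult words_append)
  show "\<one>\<^bsub>?P\<^esub> \<in> carrier ?P" unfolding car one by auto
  show "A \<otimes>\<^bsub>?P\<^esub> B \<otimes>\<^bsub>?P\<^esub> C = A \<otimes>\<^bsub>?P\<^esub> (B \<otimes>\<^bsub>?P\<^esub> C)"
    if "A \<in> carrier ?P" "B \<in> carrier ?P" "C \<in> carrier ?P" for A B C
    using that unfolding car by (auto simp: pres_rel_mult)
  show "\<one>\<^bsub>?P\<^esub> \<otimes>\<^bsub>?P\<^esub> A = A" if "A \<in> carrier ?P" for A
    using that unfolding car one by (auto simp: pres_rel_mult)
  show "\<exists>B \<in> carrier ?P. B \<otimes>\<^bsub>?P\<^esub> A = \<one>\<^bsub>?P\<^esub>" if A: "A \<in> carrier ?P" for A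
  proof -
    from A obtain u where u: "u \<in> words S" "A = ?c u" unfolding car by auto
    from pres_eq_inverse [OF u(1)] obtain w where w: "w \<in> words S" "pres_eq S R (w @ u) []"
      by blast
    with u have "?c (w @ u) = ?c []"
      by (intro equiv_class_eq [OF equiv_pres_rel]) (simp add: pres_rel_def)
    with u w have "?c w \<otimes>\<^bsub>?P\<^esub> A = \<one>\<^bsub>?P\<^esub>"
      by (simp add: pres_rel_mult one)
    moreover have "?c w \<in> carrier ?P" using w unfolding car by blast
    ultimately show ?thesis by blast
  qed
qed


section \<open>Graphs of groups\<close>

text \<open>The endpoint maps \<open>d\<^sub>0\<close> and \<open>d\<^sub>1\<close> are \<^const>\<open>tail\<close> and \<^const>\<open>head\<close>; each (unoriented)
  edge is a single arc, and loops and multiple edges are allowed.\<close>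

record ('v, 'e, 'g) graph_of_groups =
  graph :: "('v, 'e) pre_digraph"
  vertex_group :: "'v \<Rightarrow> 'g monoid"
  edge_group :: "'e \<Rightarrow> 'g monoid"
  bd0 :: "'e \<Rightarrow> 'g \<Rightarrow> 'g"
  bd1 :: "'e \<Rightarrow> 'g \<Rightarrow> 'g"

text \<open>\<^const>\<open>Digraph_Component.connected\<close> ignores the orientation of arcs and excludes the
  empty graph.\<close>

definition is_graph_of_groups :: "('v, 'e, 'g) graph_of_groups \<Rightarrow> bool" where
  "is_graph_of_groups X \<longleftrightarrow>
     wf_digraph (graph X) \<and> Digraph_Component.connected (graph X) \<and>
     (\<forall>v \<in> verts (graph X). group (vertex_group X v)) \<and>
     (\<forall>e \<in> arcs (graph X).
        group (edge_group X e) \<and>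
        bd0 X e \<in> mon (edge_group X e) (vertex_group X (tail (graph X) e)) \<and>
        bd1 X e \<in> mon (edge_group X e) (vertex_group X (head (graph X) e)))"

definition finite_graph_of_groups :: "('v, 'e, 'g) graph_of_groups \<Rightarrow> bool" where
  "finite_graph_of_groups X \<longleftrightarrow> is_graph_of_groups X \<and> fin_digraph (graph X)"

definition reduced :: "('v, 'e, 'g) graph_of_groups \<Rightarrow> bool" where
  "reduced X \<longleftrightarrow>
     (\<forall>e \<in> arcs (graph X). tail (graph X) e \<noteq> head (graph X) e \<longrightarrow>
        bd0 X e \<notin> iso (edge_group X e) (vertex_group X (tail (graph X) e)) \<and>
        bd1 X e \<notin> iso (edge_group X e) (vertex_group X (head (graph X) e)))"

definition finite_edge_groups :: "('v, 'e, 'g) graph_of_groups \<Rightarrow> bool" where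
  "finite_edge_groups X \<longleftrightarrow> (\<forall>e \<in> arcs (graph X). finite (carrier (edge_group X e)))"


section \<open>The fundamental group\<close>

text \<open>\<^const>\<open>spanning_tree\<close> of the graph library only forbids \<^emph>\<open>directed\<close> cycles, which is too weak
  for undirected graphs. We therefore first add to every arc its reverse. A circuit is a
  cycle of the resulting graph that uses no arc twice, in particular not an arc together with its
  reverse; loops and pairs of parallel arcs do give circuits.\<close>

definition doubled :: "('v, 'e) pre_digraph \<Rightarrow> ('v, 'e \<times> bool) pre_digraph" where
  "doubled H =
     \<lparr> verts = verts H, arcs = arcs H \<times> UNIV,
       tail = (\<lambda>(e, b). if b then head H e else tail H e),
       head = (\<lambda>(e, b). if b then tail H e else head H e) \<rparr>"

definition maximal_subtree :: "('v, 'e) pre_digraph \<Rightarrow> ('v, 'e) pre_digraph \<Rightarrow> bool" where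
  "maximal_subtree T H \<longleftrightarrow>
     spanning T H \<and> Digraph_Component.connected T \<and>
     \<not> (\<exists>p. pre_digraph.cycle (doubled T) p \<and> distinct (map fst p))"

text \<open>\<open>\<pi>\<^sub>1(X, T)\<close> is generated by the vertex groups and a stable letter \<open>t\<^sub>e\<close> for every edge \<open>e\<close>,
  subject to \<open>t\<^sub>e\<inverse> \<partial>\<^sub>e\<^sub>,\<^sub>0(g) t\<^sub>e = \<partial>\<^sub>e\<^sub>,\<^sub>1(g)\<close> for \<open>g\<close> in the edge group of \<open>e\<close>, and \<open>t\<^sub>e = 1\<close> for \<open>e\<close> in
  the maximal subtree \<open>T\<close>. Up to isomorphism it does not depend on \<open>T\<close>.\<close>

datatype ('v, 'e, 'g) gen = Vertex_Elem 'v 'g | Stable 'e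

definition fundamental_gens :: "('v, 'e, 'g) graph_of_groups \<Rightarrow> ('v, 'e, 'g) gen set" where
  "fundamental_gens X =
     {Vertex_Elem v g | v g. v \<in> verts (graph X) \<and> g \<in> carrier (vertex_group X v)} \<union>
     Stable ` arcs (graph X)"

definition fundamental_rels ::
    "('v, 'e, 'g) graph_of_groups \<Rightarrow> ('v, 'e) pre_digraph \<Rightarrow>
       (('v, 'e, 'g) gen word \<times> ('v, 'e, 'g) gen word) set" where
  "fundamental_rels X T =
     {([(Vertex_Elem v g, False), (Vertex_Elem v h, False)],
       [(Vertex_Elem v (g \<otimes>\<^bsub>vertex_group X v\<^esub> h), False)]) | v g h.
        v \<in> verts (graph X) \<and> g \<in> carrier (vertex_group X v) \<and> h \<in> carrier (vertex_group X v)} \<union>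
     {([(Stable e, True), (Vertex_Elem (tail (graph X) e) (bd0 X e g), False), (Stable e, False)],
       [(Vertex_Elem (head (graph X) e) (bd1 X e g), False)]) | e g.
        e \<in> arcs (graph X) \<and> g \<in> carrier (edge_group X e)} \<union>
     {([(Stable e, False)], []) | e. e \<in> arcs T}"

definition fundamental_group ::
    "('v, 'e, 'g) graph_of_groups \<Rightarrow> ('v, 'e) pre_digraph \<Rightarrow>
       ('v, 'e, 'g) gen word set monoid" where
  "fundamental_group X T = presented_group (fundamental_gens X) (fundamental_rels X T)"


section \<open>Accessibility\<close>

text \<open>The graphs of groups range over those with vertices and edges in \<open>nat\<close> and vertex and edge
  groups carried by subsets of the type of \<open>G\<close>. This loses nothing: the graphs are finite, and the
  vertex and edge groups embed in the fundamental group, hence in \<open>G\<close>.\<close>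

definition accessible :: "'a monoid \<Rightarrow> bool" where
  "accessible G \<longleftrightarrow>
     (\<exists>n. \<forall>(X :: (nat, nat, 'a) graph_of_groups) T.
        finite_graph_of_groups X \<and> reduced X \<and> finite_edge_groups X \<and>
        maximal_subtree T (graph X) \<and> fundamental_group X T \<cong> G \<longrightarrow>
        card (arcs (graph X)) \<le> n)"

abbreviation inaccessible :: "'a monoid \<Rightarrow> bool" where
  "inaccessible G \<equiv> \<not> accessible G"

end

theory Submission
  imports Defs "HOL-Algebra.Weak_Morphisms" "HOL-Algebra.Sylow" "HOL-Algebra.Product_Groups"
    "HOL-Algebra.Multiplicative_Group" "HOL-Library.Countable_Set"
begin

text \<open>The group is a variant of Dunwoody's example. In a residually \<open>p\<close>-finite group \<open>E\<close> we find a
  finitely generated subgroup \<open>H\<close> containing commuting elements \<open>q\<^sub>0, q\<^sub>1, \<dots>\<close> of order \<open>p\<close>, and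
  elements \<open>z\<^sub>i\<close> of order \<open>p\<close> that commute with \<open>q\<^sub>j\<close> for \<open>j < i\<close> and satisfy
  \<open>[z\<^sub>i, q\<^sub>i] = z\<^sub>i\<^sub>+\<^sub>1\<close>. The finite groups \<open>P\<^sub>i = \<langle>q\<^sub>0, \<dots>, q\<^sub>i, z\<^sub>i\<rangle>\<close> and \<open>P\<^sub>i\<^sub>+\<^sub>1\<close> share
  \<open>L\<^sub>i = \<langle>q\<^sub>0, \<dots>, q\<^sub>i, z\<^sub>i\<^sub>+\<^sub>1\<rangle>\<close>, which is proper in both. Amalgamate the infinite chain of the \<open>P\<^sub>i\<close>
  along the \<open>L\<^sub>i\<close> and glue the result to \<open>H\<close> along \<open>\<langle>q\<^sub>0, q\<^sub>1, \<dots>\<rangle>\<close>. Since \<open>P\<^sub>i\<^sub>+\<^sub>1\<close> is generated by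
  \<open>L\<^sub>i\<close> and \<open>q\<^sub>i\<^sub>+\<^sub>1\<close>, this group is generated by \<open>H\<close> and \<open>P\<^sub>0\<close>, but it splits along
  \<open>L\<^sub>0, \<dots>, L\<^sub>n\<^sub>-\<^sub>1\<close> for every \<open>n\<close>.

  To detect a nontrivial element, reduce \<open>E\<close> to a finite \<open>p\<close>-group and adjoin stable letters \<open>u\<^sub>i\<close>
  commuting with the image of \<open>L\<^sub>i\<close>; conjugating \<open>P\<^sub>i\<close> by \<open>u\<^sub>N\<^sub>-\<^sub>1 \<cdots> u\<^sub>i\<close> defines a homomorphism on the
  amalgam which sends reduced words to reduced words. The letter \<open>u\<^sub>i\<close> acts as \<open>1 + t\<^sub>i\<close> on the tensor
  algebra of sequences \<open>x\<^sub>0 t x\<^sub>1 t \<cdots>\<close>; truncated and taken modulo \<open>p\<close>, these unipotent maps generate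
  finite \<open>p\<close>-groups, and a reduced word has a coefficient \<open>\<plusminus>1\<close>.\<close>

section \<open>Presented groups\<close>

text \<open>The obstacle is that \<open>H\<close> must contain every \<open>q i\<close> to make the
  infinite chain finitely generated, so the last gluing runs along an infinite subgroup, and
  amalgams of this kind can fail to be residually finite. Here all pieces are subgroups of the one
  group \<open>E\<close>, glued by inclusions. The inclusions induce a homomorphism from the amalgam
  to \<open>E\<close> that is injective on every piece, and a single finite quotient of
  \<open>E\<close> reduces all pieces at once. What the homomorphism to \<open>E\<close> kills is
  recovered by the stable letters. A given element involves a finite part of the chain, so letters
  below some \<open>N\<close> suffice; from \<open>N\<close> on the pieces are reduced without
  conjugation. Alternating products stay reduced because
  \<open>H \<inter> L i \<subseteq> D i\<close> and
  \<open>L i \<inter> L (Suc i) \<subseteq> D (Suc i)\<close>, where \<open>D i\<close> is generated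
  by \<open>q 0\<close>, ..., \<open>q i\<close>: a factor outside the part glued to
  \<open>H\<close> cannot fall into the next edge group. The elements \<open>z i\<close> come from
  finite differences of monomials, where raising the first variable by one adds the monomial in the
  remaining variables.\<close>

fun word_val :: "('a, 'b) monoid_scheme \<Rightarrow> ('x \<Rightarrow> 'a) \<Rightarrow> 'x word \<Rightarrow> 'a" where
  "word_val K f [] = \<one>\<^bsub>K\<^esub>"
| "word_val K f (a # w) =
     (if snd a then inv\<^bsub>K\<^esub> (f (fst a)) else f (fst a)) \<otimes>\<^bsub>K\<^esub> word_val K f w"

lemma (in group) word_val_closed: "(\<And>x. f x \<in> carrier G) \<Longrightarrow> word_val G f w \<in> carrier G"
  by (induction w) auto

lemma (in group) word_val_append:
  "(\<And>x. f x \<in> carrier G) \<Longrightarrow> word_val G f (u @ w) = word_val G f u \<otimes> word_val G f w"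
  by (induction u) (auto simp: word_val_closed m_assoc)

lemma word_val_cong:
  "u \<in> words S \<Longrightarrow> (\<And>x. x \<in> S \<Longrightarrow> f x = g x) \<Longrightarrow> word_val K f u = word_val K g u"
  by (induction u) auto

text \<open>\<open>pres_eq\<close> also relates words with letters outside \<open>S\<close>, so
  \<open>f\<close> takes values in the group on the whole type; \<open>presented_group_hom\<close>
  arranges this.\<close>

lemma (in group) word_val_pres_eq:
  assumes "pres_eq S R u w" and f: "\<And>x. f x \<in> carrier G"
    and rel: "\<And>u w. (u, w) \<in> R \<Longrightarrow> word_val G f u = word_val G f w"
  shows "word_val G f u = word_val G f w"
  using assms(1) by induction (auto simp: word_val_append f rel)

definition gen_class :: "'x set \<Rightarrow> ('x word \<times> 'x word) set \<Rightarrow> 'x \<Rightarrow> 'x word set" where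
  "gen_class S R x = pres_rel S R `` {[(x, False)]}"

lemma carrier_presented_group:
  "A \<in> carrier (presented_group S R) \<longleftrightarrow> (\<exists>u \<in> words S. A = pres_rel S R `` {u})"
  by (auto simp: presented_group_def quotient_def)

lemma one_presented_group: "\<one>\<^bsub>presented_group S R\<^esub> = pres_rel S R `` {[]}"
  by (simp add: presented_group_def)

lemma gen_class_closed: "x \<in> S \<Longrightarrow> gen_class S R x \<in> carrier (presented_group S R)"
  by (force simp: gen_class_def carrier_presented_group)

lemma pres_rel_class_eq:
  "u \<in> words S \<Longrightarrow> w \<in> words S \<Longrightarrow> pres_eq S R u w \<Longrightarrow> pres_rel S R `` {u} = pres_rel S R `` {w}"
  by (rule equiv_class_eq [OF equiv_pres_rel]) (simp add: pres_rel_def)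

text \<open>The inverse letter must be seen to represent the group inverse. Then every relation
  becomes an equation between products of generators, see
  \<open>presented_group_rel\<close>.\<close>

lemma word_val_gen_class:
  "u \<in> words S \<Longrightarrow> word_val (presented_group S R) (gen_class S R) u = pres_rel S R `` {u}"
proof (induction u)
  case Nil
  then show ?case by (simp add: one_presented_group)
next
  case (Cons a u)
  let ?P = "presented_group S R"
  interpret P: group ?P by (rule group_presented_group)
  obtain x b where a: "a = (x, b)" by force
  have x: "x \<in> S" using Cons.prems a by simp
  have "pres_rel S R `` {[(x, True)]} \<otimes>\<^bsub>?P\<^esub> gen_class S R x = \<one>\<^bsub>?P\<^esub>"
    using x pres_eq.cancel [of x S R True]
    by (simp add: gen_class_def one_presented_group pres_rel_mult pres_rel_class_eq)
  moreover have "pres_rel S R `` {[(x, True)]} \<in> carrier (?P)"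
    using x by (force simp: carrier_presented_group)
  ultimately have "inv\<^bsub>?P\<^esub> gen_class S R x = pres_rel S R `` {[(x, True)]}"
    using x by (intro P.inv_equality gen_class_closed)
  then have "pres_rel S R `` {[a]} = (if snd a then inv\<^bsub>?P\<^esub> gen_class S R (fst a)
      else gen_class S R (fst a))"
    using a by (simp add: gen_class_def)
  then have "word_val (?P) (gen_class S R) (a # u) =
      pres_rel S R `` {[a]} \<otimes>\<^bsub>?P\<^esub> pres_rel S R `` {u}"
    using Cons by simp
  also have "\<dots> = pres_rel S R `` {a # u}"
    using Cons.prems by (subst pres_rel_mult) auto
  finally show ?case .
qed

lemma presented_group_rel:
  "(u, w) \<in> R \<Longrightarrow> u \<in> words S \<Longrightarrow> w \<in> words S \<Longrightarrow>
    word_val (presented_group S R) (gen_class S R) u = word_val (presented_group S R) (gen_class S R) w"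
  by (simp add: word_val_gen_class pres_rel_class_eq pres_eq.relation)

text \<open>Von Dyck's theorem, the source of every homomorphism out of a presentation
  below.\<close>

lemma presented_group_hom:
  fixes K :: "('a, 'b) monoid_scheme"
  assumes K: "group K" and f: "\<And>x. x \<in> S \<Longrightarrow> f x \<in> carrier K"
    and R: "R \<subseteq> words S \<times> words S"
    and rel: "\<And>u w. (u, w) \<in> R \<Longrightarrow> word_val K f u = word_val K f w"
  shows "\<exists>h \<in> hom (presented_group S R) K. \<forall>x \<in> S. h (gen_class S R x) = f x"
proof -
  interpret K: group K by fact
  \<comment> \<open>Letters outside \<open>S\<close> also get a value in \<open>K\<close>, because
    \<open>pres_eq\<close> is not confined to words over \<open>S\<close>.\<close>
  define g where "g x = (if x \<in> S then f x else \<one>\<^bsub>K\<^esub>)" for x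
  have g: "g x \<in> carrier K" for x by (simp add: g_def f)
  have gf: "word_val K g u = word_val K f u" if "u \<in> words S" for u
    using that by (rule word_val_cong) (simp add: g_def)
  have relg: "word_val K g u = word_val K g w" if "(u, w) \<in> R" for u w
    using that R rel by (auto simp: gf)
  define h where "h A = word_val K g (SOME u. u \<in> A)" for A :: "'c word set"
  have h: "h (pres_rel S R `` {u}) = word_val K g u" if u: "u \<in> words S" for u
  proof -
    have "u \<in> pres_rel S R `` {u}" using u by (auto simp: pres_rel_def intro: pres_eq.refl)
    then have "(SOME u'. u' \<in> pres_rel S R `` {u}) \<in> pres_rel S R `` {u}" by (rule someI)
    then have "pres_eq S R u (SOME u'. u' \<in> pres_rel S R `` {u})" unfolding pres_rel_def by blast
    from K.word_val_pres_eq [OF this g relg] show ?thesis by (simp add: h_def)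
  qed
  have "h \<in> hom (presented_group S R) K"
    by (rule homI) (auto simp: carrier_presented_group h pres_rel_mult K.word_val_append
        K.word_val_closed g)
  moreover have "h (gen_class S R x) = f x" if "x \<in> S" for x
    using that f by (simp add: gen_class_def h) (simp add: g_def)
  ultimately show ?thesis by blast
qed

lemma (in group) word_val_generate:
  assumes "A \<subseteq> carrier G" and "\<And>x. x \<in> S \<Longrightarrow> f x \<in> generate G A" and "w \<in> words S"
  shows "word_val G f w \<in> generate G A"
  using assms(3)
proof (induction w)
  case (Cons a w)
  then show ?case using assms(2) [of "fst a"]
    by (auto intro: generate.eng generate_m_inv_closed [OF assms(1)])
qed (auto intro: generate.one)

lemma generate_presented_group:
  "generate (presented_group S R) (gen_class S R ` S) = carrier (presented_group S R)"
proof
  let ?P = "presented_group S R" and ?A = "gen_class S R ` S"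
  interpret P: group ?P by (rule group_presented_group)
  have sub: "?A \<subseteq> carrier (?P)" by (auto intro: gen_class_closed)
  show "generate (?P) (?A) \<subseteq> carrier (?P)"
    by (rule P.generate_incl [OF sub])
  show "carrier (?P) \<subseteq> generate (?P) (?A)"
    using P.word_val_generate [OF sub, of S "gen_class S R"]
    by (force simp: carrier_presented_group word_val_gen_class intro: generate.incl)
qed

lemma (in group) hom_eq_on_generate:
  assumes "group K" "f \<in> hom G K" "g \<in> hom G K" "A \<subseteq> carrier G"
    and "\<And>x. x \<in> A \<Longrightarrow> f x = g x" "x \<in> generate G A"
  shows "f x = g x"
proof -
  interpret f: group_hom G K f using assms by (simp add: group_hom_def group_hom_axioms_def group_axioms)
  interpret g: group_hom G K g using assms by (simp add: group_hom_def group_hom_axioms_def group_axioms)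
  from assms(6) show ?thesis
  proof induction
    case (eng h1 h2)
    then show ?case using generate_in_carrier [OF assms(4)] by simp
  qed (use assms(4,5) in auto)
qed

text \<open>Every element is the value of a word over a countable alphabet. This allows the tree
  product to be carried by the natural numbers.\<close>

lemma (in group) countable_generate:
  assumes "countable A" "A \<subseteq> carrier G"
  shows "countable (generate G A)"
proof -
  define f where "f x = (if x \<in> A then x else \<one>)" for x
  have f: "f x \<in> carrier G" for x using assms by (auto simp: f_def)
  have "generate G A \<subseteq> word_val G f ` words A"
  proof
    fix x assume "x \<in> generate G A"
    then show "x \<in> word_val G f ` words A"
    proof induction
      case one
      then show ?case by (auto intro!: image_eqI [of _ _ "[]"])
    next
      case (incl h)
      then show ?case using assms by (auto simp: f_def intro!: image_eqI [of _ _ "[(h, False)]"])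
    next
      case (inv h)
      then show ?case using assms by (auto simp: f_def intro!: image_eqI [of _ _ "[(h, True)]"])
    next
      case (eng h1 h2)
      then obtain u w where "u \<in> words A" "w \<in> words A" "h1 = word_val G f u" "h2 = word_val G f w" by auto
      then show ?case by (intro image_eqI [of _ _ "u @ w"]) (simp_all add: word_val_append f)
    qed
  qed
  moreover have "countable (words A)" unfolding words_def using assms by auto
  ultimately show ?thesis by (meson countable_image countable_subset)
qed

section \<open>Residual finiteness\<close>

lemma (in group) iso_image_group:
  assumes "inj_on f (carrier G)"
  shows "group (image_group f G)" "f \<in> iso G (image_group f G)"
  using assms inj_imp_image_group_is_group inj_imp_image_group_iso by auto

lemma finite_p_group_nat:
  assumes "finite_p_group p P"
  shows "\<exists>(P' :: nat monoid) f. finite_p_group p P' \<and> f \<in> iso P P'"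
proof -
  interpret group P using assms by (simp add: finite_p_group_def)
  obtain f :: "'a \<Rightarrow> nat" where f: "inj_on f (carrier P)"
    using assms finite_imp_inj_to_nat_seg unfolding finite_p_group_def by metis
  have "order (image_group f P) = order P"
    by (simp add: order_def image_group_carrier card_image f)
  then have "finite_p_group p (image_group f P)"
    using iso_image_group [OF f] assms by (auto simp: finite_p_group_def image_group_carrier)
  then show ?thesis using iso_image_group [OF f] by blast
qed

lemma residually_p_finiteI:
  assumes "\<And>g. g \<in> carrier G \<Longrightarrow> g \<noteq> \<one>\<^bsub>G\<^esub> \<Longrightarrow>
    \<exists>(P :: 'c monoid) h. finite_p_group p P \<and> h \<in> hom G P \<and> h g \<noteq> \<one>\<^bsub>P\<^esub>"
    and G: "group G"
  shows "residually_p_finite p G"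
  unfolding residually_p_finite_def
proof
  fix g assume g: "g \<in> carrier G - {\<one>\<^bsub>G\<^esub>}"
  then obtain P :: "'c monoid" and h where P: "finite_p_group p P" and h: "h \<in> hom G P" "h g \<noteq> \<one>\<^bsub>P\<^esub>"
    using assms(1) by blast
  obtain P' :: "nat monoid" and f where P': "finite_p_group p P'" and f: "f \<in> iso P P'"
    using finite_p_group_nat [OF P] by blast
  have gp: "group P" "group P'" using P P' by (auto simp: finite_p_group_def)
  then interpret f: group_hom P P' f
    using f by (simp add: group_hom_def group_hom_axioms_def iso_def)
  have "f (h g) \<noteq> \<one>\<^bsub>P'\<^esub>"
    using f h g gp f.hom_one unfolding iso_def bij_betw_def inj_on_def hom_def
    by (smt (verit) DiffD1 Pi_iff f.G.one_closed mem_Collect_eq)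
  moreover have "f \<circ> h \<in> hom G P'"
    using h f by (intro hom_compose) (auto simp: iso_def)
  ultimately show "\<exists>(P :: nat monoid) h. finite_p_group p P \<and> h \<in> hom G P \<and> h g \<noteq> \<one>\<^bsub>P\<^esub>"
    using P' by force
qed

lemma finite_p_group_DirProd:
  assumes "finite_p_group p P" "finite_p_group p Q"
  shows "finite_p_group p (P \<times>\<times> Q)"
proof -
  obtain j k where "order P = p ^ j" "order Q = p ^ k"
    using assms by (auto simp: finite_p_group_def)
  then have "order (P \<times>\<times> Q) = p ^ (j + k)"
    by (simp add: order_def DirProd_def card_cartesian_product power_add)
  then show ?thesis using assms
    by (auto simp: finite_p_group_def DirProd_group)
qed

text \<open>Adjoin one direct factor for each element of \<open>X\<close>. The product is moved back
  to \<open>nat\<close> each time, so that the type of the target stays fixed through the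
  induction.\<close>

lemma residually_p_finite_set:
  assumes G: "group G" and res: "residually_p_finite p G"
    and "finite X" "X \<subseteq> carrier G - {\<one>\<^bsub>G\<^esub>}"
  shows "\<exists>(P :: nat monoid) h. finite_p_group p P \<and> h \<in> hom G P \<and> (\<forall>x \<in> X. h x \<noteq> \<one>\<^bsub>P\<^esub>)"
  using assms(3,4)
proof induction
  case empty
  have "finite_p_group p \<lparr>carrier = {0::nat}, monoid.mult = (\<lambda>x y. 0), one = 0\<rparr>"
    unfolding finite_p_group_def
    by (auto simp: order_def intro!: groupI exI [of _ 0])
  moreover have "(\<lambda>_. 0) \<in> hom G \<lparr>carrier = {0::nat}, monoid.mult = (\<lambda>x y. 0), one = 0\<rparr>"
    by (auto simp: hom_def)
  ultimately show ?case by blast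
next
  case (insert x X)
  then obtain P :: "nat monoid" and h where P: "finite_p_group p P" "h \<in> hom G P" "\<forall>x \<in> X. h x \<noteq> \<one>\<^bsub>P\<^esub>"
    by auto
  from insert.prems res obtain Q :: "nat monoid" and k where Q: "finite_p_group p Q" "k \<in> hom G Q" "k x \<noteq> \<one>\<^bsub>Q\<^esub>"
    unfolding residually_p_finite_def by (metis insert_subset)
  obtain P' :: "nat monoid" and f where P': "finite_p_group p P'" and f: "f \<in> iso (P \<times>\<times> Q) P'"
    using finite_p_group_nat [OF finite_p_group_DirProd [OF P(1) Q(1)]] by blast
  have gp: "group (P \<times>\<times> Q)" "group P'"
    using finite_p_group_DirProd [OF P(1) Q(1)] P' by (auto simp: finite_p_group_def)
  then interpret f: group_hom "P \<times>\<times> Q" P' f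
    using f by (simp add: group_hom_def group_hom_axioms_def iso_def)
  have hk: "(\<lambda>x. (h x, k x)) \<in> hom G (P \<times>\<times> Q)"
    using P Q by (auto simp: hom_def Pi_iff)
  have inj: "inj_on f (carrier (P \<times>\<times> Q))" using f by (auto simp: iso_def bij_betw_def)
  have "f (h y, k y) \<noteq> \<one>\<^bsub>P'\<^esub>" if "y \<in> insert x X" for y
  proof
    assume "f (h y, k y) = \<one>\<^bsub>P'\<^esub>"
    then have "f (h y, k y) = f \<one>\<^bsub>P \<times>\<times> Q\<^esub>" by (simp add: f.hom_one del: one_DirProd)
    moreover have "(h y, k y) \<in> carrier (P \<times>\<times> Q)"
      using hk that insert.prems by (auto simp: hom_def)
    ultimately have "(h y, k y) = \<one>\<^bsub>P \<times>\<times> Q\<^esub>"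
      using inj f.G.one_closed by (auto dest: inj_onD)
    then show False using that P Q by auto
  qed
  moreover have "f \<circ> (\<lambda>x. (h x, k x)) \<in> hom G P'"
    using hk f by (intro hom_compose) (auto simp: iso_def)
  ultimately show ?case using P' by force
qed

text \<open>A nontrivial family is nontrivial in some coordinate. Both the ambient group
  \<open>E\<close> and the group with stable letters are obtained as such products.\<close>

lemma residually_p_finite_product_group:
  fixes U :: "'i \<Rightarrow> 'a monoid"
  assumes "\<And>i. finite_p_group p (U i)"
  shows "residually_p_finite p (product_group UNIV U)"
proof (rule residually_p_finiteI [where 'c = 'a])
  show "group (product_group UNIV U)" using assms by (simp add: finite_p_group_def)
  fix g assume g: "g \<in> carrier (product_group UNIV U)" "g \<noteq> \<one>\<^bsub>product_group UNIV U\<^esub>"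
  then obtain i where i: "g i \<noteq> \<one>\<^bsub>U i\<^esub>" by (auto simp: fun_eq_iff)
  have "(\<lambda>g. g i) \<in> hom (product_group UNIV U) (U i)" by (auto simp: hom_def PiE_def)
  then show "\<exists>(P :: 'a monoid) h. finite_p_group p P \<and> h \<in> hom (product_group UNIV U) P \<and> h g \<noteq> \<one>\<^bsub>P\<^esub>"
    using assms [of i] i by (intro exI [of _ "U i"] exI [of _ "\<lambda>g. g i"]) simp
qed

section \<open>A tree product with an infinite chain of finite amalgamations\<close>

lemma iso_of_inverse_homs:
  assumes "f \<in> hom G H" "g \<in> hom H G"
    and "\<And>x. x \<in> carrier G \<Longrightarrow> g (f x) = x" "\<And>y. y \<in> carrier H \<Longrightarrow> f (g y) = y"
  shows "f \<in> iso G H"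
  using assms bij_betw_byWitness [of "carrier G" g f "carrier H"] unfolding iso_def hom_def by blast



lemma (in group) generate_subset_subgroup:
  assumes "subgroup H G" "A \<subseteq> H"
  shows "generate G A \<subseteq> H"
  using generate_subgroup_incl [OF assms(2,1)] .

text \<open>All pieces are subgroups of one group \<open>E\<close> and are glued by inclusions.
  \<open>D i\<close> is the part of \<open>P i\<close> that is glued to \<open>H\<close>. Since
  \<open>D\<close> increases and \<open>D i\<close> lies in \<open>L i\<close>, these gluings are
  consistent along the chain and amount to one amalgamation with \<open>H\<close> along the union of
  the \<open>D i\<close>.\<close>

locale tree_datum =
  fixes E :: "'e monoid" and H :: "'e set" and P L D :: "nat \<Rightarrow> 'e set" and SH SP :: "'e set"
  assumes E: "group E"
    and subgroups: "subgroup H E" "\<And>i. subgroup (P i) E" "\<And>i. subgroup (L i) E" "\<And>i. subgroup (D i) E"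
    and L_P: "\<And>i. L i \<subseteq> P i" "\<And>i. L i \<subseteq> P (Suc i)"
    and D_L: "\<And>i. D i \<subseteq> L i" and D_H: "\<And>i. D i \<subseteq> H" and D_Suc: "\<And>i. D i \<subseteq> D (Suc i)"
    and P_Suc: "\<And>i. P (Suc i) = generate E (L i \<union> D (Suc i))"
    and gens: "finite SH" "SH \<subseteq> H" "finite SP" "SP \<subseteq> P 0"
    and generate_gens: "generate E SH = H" "generate E SP = P 0"
    and finite_L: "\<And>i. finite (L i)"
    and proper: "\<And>i. L i \<noteq> P i" "\<And>i. L i \<noteq> P (Suc i)"
begin

sublocale E: group E by (rule E)

definition vg :: "nat \<Rightarrow> 'e set" where
  "vg v = (case v of 0 \<Rightarrow> H | Suc i \<Rightarrow> P i)"

lemma vg_simps [simp]: "vg 0 = H" "vg (Suc i) = P i"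
  by (simp_all add: vg_def)

lemma subgroup_vg: "subgroup (vg v) E"
  using subgroups by (simp add: vg_def split: nat.split)

lemma vg_subset: "vg v \<subseteq> carrier E"
  by (rule subgroup.subset [OF subgroup_vg])

text \<open>A cocone over the diagram formed by \<open>H\<close>, the \<open>P i\<close> and the
  inclusions of the \<open>L i\<close> and \<open>D i\<close>; \<open>pre_group\<close> is the
  colimit.\<close>

definition compatible :: "('k, 'z) monoid_scheme \<Rightarrow> (nat \<Rightarrow> 'e \<Rightarrow> 'k) \<Rightarrow> bool" where
  "compatible G \<phi> \<longleftrightarrow> (\<forall>v. \<phi> v \<in> hom (E\<lparr>carrier := vg v\<rparr>) G) \<and>
     (\<forall>i. \<forall>x \<in> L i. \<phi> (Suc i) x = \<phi> (Suc (Suc i)) x) \<and>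
     (\<forall>i. \<forall>x \<in> D i. \<phi> (Suc i) x = \<phi> 0 x)"

section \<open>The colimit of the pieces and its universal property\<close>

definition gen_set :: "(nat \<times> 'e) set" where
  "gen_set = Sigma UNIV vg"

definition rel_set :: "((nat \<times> 'e) word \<times> (nat \<times> 'e) word) set" where
  "rel_set =
     {([((v, x), False), ((v, y), False)], [((v, x \<otimes>\<^bsub>E\<^esub> y), False)]) | v x y. x \<in> vg v \<and> y \<in> vg v} \<union>
     {([((Suc i, x), False)], [((Suc (Suc i), x), False)]) | i x. x \<in> L i} \<union>
     {([((Suc i, x), False)], [((0, x), False)]) | i x. x \<in> D i}"

lemma rel_set_words: "rel_set \<subseteq> words gen_set \<times> words gen_set"
  using L_P D_L D_H subgroup.m_closed [OF subgroup_vg]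
  by (auto simp: rel_set_def gen_set_def) blast+

definition pre_group :: "(nat \<times> 'e) word set monoid" where
  "pre_group = presented_group gen_set rel_set"

definition pre_inc :: "nat \<Rightarrow> 'e \<Rightarrow> (nat \<times> 'e) word set" where
  "pre_inc v x = gen_class gen_set rel_set (v, x)"

lemma group_pre_group: "group pre_group"
  unfolding pre_group_def by (rule group_presented_group)

lemma pre_inc_closed: "x \<in> vg v \<Longrightarrow> pre_inc v x \<in> carrier pre_group"
  unfolding pre_inc_def pre_group_def by (rule gen_class_closed) (simp add: gen_set_def)

lemma compatible_pre_inc: "compatible pre_group pre_inc"
proof -
  interpret G: group pre_group by (rule group_pre_group)
  have rel: "word_val pre_group (\<lambda>(v, x). pre_inc v x) u = word_val pre_group (\<lambda>(v, x). pre_inc v x) w"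
    if "(u, w) \<in> rel_set" for u w
    using presented_group_rel [OF that, of gen_set] that rel_set_words
    by (auto simp: pre_group_def pre_inc_def case_prod_beta)
  have "pre_inc v x \<otimes>\<^bsub>pre_group\<^esub> pre_inc v y = pre_inc v (x \<otimes>\<^bsub>E\<^esub> y)" if "x \<in> vg v" "y \<in> vg v" for v x y
    using rel [of "[((v, x), False), ((v, y), False)]" "[((v, x \<otimes>\<^bsub>E\<^esub> y), False)]"] that
      pre_inc_closed subgroup.m_closed [OF subgroup_vg]
    by (force simp: rel_set_def)
  then have "pre_inc v \<in> hom (E\<lparr>carrier := vg v\<rparr>) pre_group" for v
    by (auto simp: hom_def pre_inc_closed)
  moreover have "pre_inc (Suc i) x = pre_inc (Suc (Suc i)) x" if "x \<in> L i" for i x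
  proof -
    have "([((Suc i, x), False)], [((Suc (Suc i), x), False)]) \<in> rel_set"
      using that by (simp add: rel_set_def)
    moreover have "pre_inc (Suc i) x \<in> carrier pre_group" "pre_inc (Suc (Suc i)) x \<in> carrier pre_group"
      using that L_P [of i] pre_inc_closed [of x "Suc i"] pre_inc_closed [of x "Suc (Suc i)"] by auto
    ultimately show ?thesis using rel by fastforce
  qed
  moreover have "pre_inc (Suc i) x = pre_inc 0 x" if "x \<in> D i" for i x
  proof -
    have "([((Suc i, x), False)], [((0, x), False)]) \<in> rel_set"
      using that by (simp add: rel_set_def)
    moreover have "pre_inc (Suc i) x \<in> carrier pre_group" "pre_inc 0 x \<in> carrier pre_group"
      using that L_P [of i] D_L [of i] D_H [of i] pre_inc_closed [of x "Suc i"] pre_inc_closed [of x 0] by auto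
    ultimately show ?thesis using rel by fastforce
  qed
  ultimately show ?thesis by (simp add: compatible_def)
qed

lemma generate_pre_group: "generate pre_group (\<Union>v. pre_inc v ` vg v) = carrier pre_group"
proof -
  have "(\<Union>v. pre_inc v ` vg v) = gen_class gen_set rel_set ` gen_set"
    by (force simp: pre_inc_def gen_set_def)
  then show ?thesis by (simp add: pre_group_def generate_presented_group)
qed

lemma pre_group_universal:
  fixes K :: "('k, 'z) monoid_scheme"
  assumes K: "group K" and comp: "compatible K \<phi>"
  shows "\<exists>h \<in> hom pre_group K. \<forall>v. \<forall>x \<in> vg v. h (pre_inc v x) = \<phi> v x"
proof -
  interpret K: group K by fact
  have hom: "\<phi> v \<in> hom (E\<lparr>carrier := vg v\<rparr>) K" for v using comp by (simp add: compatible_def)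
  have cl: "\<phi> v x \<in> carrier K" if "x \<in> vg v" for v x
    using hom [of v] that by (auto simp: hom_def)
  have mult: "\<phi> v (x \<otimes>\<^bsub>E\<^esub> y) = \<phi> v x \<otimes>\<^bsub>K\<^esub> \<phi> v y" if "x \<in> vg v" "y \<in> vg v" for v x y
    using hom [of v] that by (auto simp: hom_def)
  have "word_val K (\<lambda>(v, x). \<phi> v x) u = word_val K (\<lambda>(v, x). \<phi> v x) w" if uw: "(u, w) \<in> rel_set" for u w
  proof -
    consider (m) v x y where "x \<in> vg v" "y \<in> vg v" "u = [((v, x), False), ((v, y), False)]" "w = [((v, x \<otimes>\<^bsub>E\<^esub> y), False)]"
      | (l) i x where "x \<in> L i" "u = [((Suc i, x), False)]" "w = [((Suc (Suc i), x), False)]"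
      | (d) i x where "x \<in> D i" "u = [((Suc i, x), False)]" "w = [((0, x), False)]"
      using uw unfolding rel_set_def by blast
    then show ?thesis
    proof cases
      case m
      then show ?thesis using cl subgroup.m_closed [OF subgroup_vg m(1,2)] by (simp add: mult K.m_assoc)
    qed (use comp in \<open>simp_all add: compatible_def\<close>)
  qed
  then have "\<exists>h \<in> hom pre_group K. \<forall>s \<in> gen_set. h (gen_class gen_set rel_set s) = (\<lambda>(v, x). \<phi> v x) s"
    unfolding pre_group_def by (intro presented_group_hom K rel_set_words) (auto simp: gen_set_def cl)
  then show ?thesis by (auto simp: gen_set_def pre_inc_def)
qed

lemma hom_generate_image:
  assumes "group G" "\<phi> \<in> hom (E\<lparr>carrier := S\<rparr>) G" "subgroup S E" "S = generate E A" "A \<subseteq> S"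
    and "x \<in> S"
  shows "\<phi> x \<in> generate G (\<phi> ` A)"
proof -
  interpret S: group "E\<lparr>carrier := S\<rparr>" by (rule E.subgroup_imp_group [OF assms(3)])
  interpret \<phi>: group_hom "E\<lparr>carrier := S\<rparr>" G \<phi>
    using assms(1,2) by (simp add: group_hom_def group_hom_axioms_def S.group_axioms)
  have "x \<in> generate (E\<lparr>carrier := S\<rparr>) A"
    using E.generate_consistent [OF assms(5,3)] assms(4,6) by simp
  then show ?thesis using \<phi>.generate_img [of A] assms(5) by auto
qed

text \<open>Induction along the chain: in a cocone \<open>L i\<close> has the same image from
  \<open>P i\<close> as from \<open>P (Suc i)\<close>, and \<open>D (Suc i)\<close> has the image it
  gets from \<open>H\<close>; together they generate \<open>P (Suc i)\<close>.\<close>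

lemma compatible_generate:
  assumes G: "group G" and comp: "compatible G \<phi>"
    and gen: "\<And>x. x \<in> SH \<Longrightarrow> \<phi> 0 x \<in> T" "\<And>x. x \<in> SP \<Longrightarrow> \<phi> 1 x \<in> T" and T: "subgroup T G"
    and x: "x \<in> vg v"
  shows "\<phi> v x \<in> T"
proof -
  interpret G: group G by fact
  have hom: "\<phi> v \<in> hom (E\<lparr>carrier := vg v\<rparr>) G" for v using comp by (simp add: compatible_def)
  have sub: "generate G A \<subseteq> T" if "A \<subseteq> T" for A by (rule G.generate_subset_subgroup [OF T that])
  have H: "\<phi> 0 x \<in> T" if "x \<in> H" for x
  proof -
    have "\<phi> 0 x \<in> generate G (\<phi> 0 ` SH)"
      using hom_generate_image [OF G hom [of 0] subgroup_vg, of SH x] gens generate_gens that by simp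
    moreover have "\<phi> 0 ` SH \<subseteq> T" using gen by blast
    ultimately show ?thesis using sub by blast
  qed
  have P: "\<phi> (Suc i) x \<in> T" if "x \<in> P i" for i x
    using that
  proof (induction i arbitrary: x)
    case 0
    have "\<phi> 1 x \<in> generate G (\<phi> 1 ` SP)"
      using hom_generate_image [OF G hom [of 1] subgroup_vg, of SP x] gens generate_gens 0 by simp
    moreover have "\<phi> 1 ` SP \<subseteq> T" using gen by blast
    ultimately have "\<phi> 1 x \<in> T" using sub by blast
    then show ?case by simp
  next
    case (Suc i)
    have "\<phi> (Suc (Suc i)) y \<in> T" if "y \<in> L i \<union> D (Suc i)" for y
      using that
    proof
      assume y: "y \<in> L i"
      then have "\<phi> (Suc i) y \<in> T" using Suc.IH L_P by blast
      then show ?thesis using comp y by (simp add: compatible_def)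
    next
      assume "y \<in> D (Suc i)"
      then show ?thesis using comp H D_H by (simp add: compatible_def subset_iff)
    qed
    then have "\<phi> (Suc (Suc i)) ` (L i \<union> D (Suc i)) \<subseteq> T" by blast
    moreover have "\<phi> (Suc (Suc i)) x \<in> generate G (\<phi> (Suc (Suc i)) ` (L i \<union> D (Suc i)))"
      using Suc.prems L_P [of i] L_P [of "Suc i"] D_L [of "Suc i"]
      by (intro hom_generate_image [OF G hom subgroup_vg]) (auto simp: P_Suc)
    ultimately show ?case using sub by blast
  qed
  show ?thesis using H P x by (cases v) auto
qed

lemma pre_gens_closed: "pre_inc 0 ` SH \<union> pre_inc 1 ` SP \<subseteq> carrier pre_group"
  using gens(2,4) pre_inc_closed [of _ 0] pre_inc_closed [of _ 1] by auto

lemma generate_pre_group_finite: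
  "generate pre_group (pre_inc 0 ` SH \<union> pre_inc 1 ` SP) = carrier pre_group"
proof
  interpret G: group pre_group by (rule group_pre_group)
  let ?A = "pre_inc 0 ` SH \<union> pre_inc 1 ` SP"
  have A: "?A \<subseteq> carrier pre_group" by (rule pre_gens_closed)
  show "generate pre_group ?A \<subseteq> carrier pre_group" by (rule G.generate_incl [OF A])
  have "pre_inc v x \<in> generate pre_group ?A" if "x \<in> vg v" for v x
    by (rule compatible_generate [OF group_pre_group compatible_pre_inc _ _ G.generate_is_subgroup [OF A] that])
      (auto intro: generate.incl)
  then have "(\<Union>v. pre_inc v ` vg v) \<subseteq> generate pre_group ?A" by blast
  from G.generate_subset_subgroup [OF G.generate_is_subgroup [OF A] this]
  show "carrier pre_group \<subseteq> generate pre_group ?A" by (simp add: generate_pre_group)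
qed

text \<open>The colimit consists of sets of words, but the theorem asks for a group on
  \<open>nat\<close>. The carrier is countable because it is finitely generated, so an injection
  exists, see \<open>inj_code\<close>.\<close>

definition code :: "(nat \<times> 'e) word set \<Rightarrow> nat" where
  "code = (SOME e. inj_on e (carrier pre_group))"

definition tree_group :: "nat monoid" where
  "tree_group = image_group code pre_group"

definition inc :: "nat \<Rightarrow> 'e \<Rightarrow> nat" where
  "inc v x = code (pre_inc v x)"

lemma inj_code: "inj_on code (carrier pre_group)"
proof -
  interpret G: group pre_group by (rule group_pre_group)
  have "countable (carrier pre_group)"
    using G.countable_generate [OF _ pre_gens_closed] gens(1,3) generate_pre_group_finite
    by (simp add: countable_finite)
  then have "\<exists>e :: (nat \<times> 'e) word set \<Rightarrow> nat. inj_on e (carrier pre_group)"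
    by (rule countableE) blast
  then show ?thesis unfolding code_def by (rule someI_ex)
qed

lemma group_tree_group: "group tree_group"
  and code_iso: "code \<in> iso pre_group tree_group"
  using group.iso_image_group [OF group_pre_group inj_code] by (simp_all add: tree_group_def)

sublocale G: group tree_group by (rule group_tree_group)

lemma code_hom: "group_hom pre_group tree_group code"
  using code_iso by (simp add: group_hom_def group_hom_axioms_def iso_def group_pre_group group_tree_group)

lemma compatible_inc: "compatible tree_group inc"
proof -
  have "inc v = code \<circ> pre_inc v" for v by (simp add: inc_def fun_eq_iff)
  moreover have "code \<in> hom pre_group tree_group" using code_iso by (simp add: iso_def)
  ultimately show ?thesis using compatible_pre_inc
    unfolding compatible_def by (auto simp: inc_def intro: hom_compose)
qed

lemma inc_hom: "inc v \<in> hom (E\<lparr>carrier := vg v\<rparr>) tree_group"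
  using compatible_inc by (simp add: compatible_def)

lemma inc_closed: "x \<in> vg v \<Longrightarrow> inc v x \<in> carrier tree_group"
  using inc_hom [of v] by (auto simp: hom_def)

lemma inc_L: "x \<in> L i \<Longrightarrow> inc (Suc (Suc i)) x = inc (Suc i) x"
  and inc_D: "x \<in> D i \<Longrightarrow> inc (Suc i) x = inc 0 x"
  using compatible_inc by (simp_all add: compatible_def)

lemma inc_mult: "x \<in> vg v \<Longrightarrow> y \<in> vg v \<Longrightarrow> inc v (x \<otimes>\<^bsub>E\<^esub> y) = inc v x \<otimes>\<^bsub>tree_group\<^esub> inc v y"
  using inc_hom [of v] by (auto simp: hom_def)

lemma generate_tree_group: "generate tree_group (\<Union>v. inc v ` vg v) = carrier tree_group"
proof -
  interpret c: group_hom pre_group tree_group code by (rule code_hom)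
  have "(\<Union>v. pre_inc v ` vg v) \<subseteq> carrier pre_group" using pre_inc_closed by blast
  then have "generate tree_group (code ` (\<Union>v. pre_inc v ` vg v)) = code ` carrier pre_group"
    using c.generate_img generate_pre_group by metis
  moreover have "code ` (\<Union>v. pre_inc v ` vg v) = (\<Union>v. inc v ` vg v)" by (auto simp: inc_def)
  ultimately show ?thesis by (simp add: tree_group_def image_group_carrier)
qed

lemma finitely_generated_tree_group: "finitely_generated tree_group"
proof -
  interpret c: group_hom pre_group tree_group code by (rule code_hom)
  let ?A = "pre_inc 0 ` SH \<union> pre_inc 1 ` SP"
  have A: "?A \<subseteq> carrier pre_group" by (rule pre_gens_closed)
  then have "generate tree_group (code ` ?A) = carrier tree_group"
    using c.generate_img generate_pre_group_finite by (metis tree_group_def image_group_carrier)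
  then show ?thesis unfolding finitely_generated_def
    using A gens(1,3) by (intro exI [of _ "code ` ?A"]) (auto simp: tree_group_def image_group_carrier)
qed

lemma tree_group_universal:
  fixes K :: "('k, 'z) monoid_scheme"
  assumes K: "group K" and comp: "compatible K \<phi>"
  shows "\<exists>h \<in> hom tree_group K. \<forall>v. \<forall>x \<in> vg v. h (inc v x) = \<phi> v x"
proof -
  obtain h where h: "h \<in> hom pre_group K" "\<forall>v. \<forall>x \<in> vg v. h (pre_inc v x) = \<phi> v x"
    using pre_group_universal [OF assms] by blast
  have "inv_into (carrier pre_group) code \<in> iso tree_group pre_group"
    using group.iso_set_sym [OF group_pre_group code_iso] .
  then have "h \<circ> inv_into (carrier pre_group) code \<in> hom tree_group K"
    using h(1) by (intro hom_compose) (auto simp: iso_def)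
  moreover have "inv_into (carrier pre_group) code (inc v x) = pre_inc v x" if "x \<in> vg v" for v x
    using inj_code pre_inc_closed [OF that] by (simp add: inc_def)
  ultimately show ?thesis using h(2) by (intro bexI [of _ "h \<circ> inv_into (carrier pre_group) code"]) auto
qed

lemma compatible_E: "compatible E (\<lambda>v x. x)"
  using vg_subset by (auto simp: compatible_def hom_def)

text \<open>The inclusions into \<open>E\<close> form a cocone. The induced map is a left inverse of
  every \<open>inc v\<close>, so the pieces embed.\<close>

lemma projection_exists: "\<exists>\<epsilon> \<in> hom tree_group E. \<forall>v. \<forall>x \<in> vg v. \<epsilon> (inc v x) = x"
  by (rule tree_group_universal [OF E compatible_E])

lemma inj_inc: "inj_on (inc v) (vg v)"
  using projection_exists by (metis inj_onI)

lemma inc_subgroup: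
  assumes "subgroup S E" "S \<subseteq> vg v"
  shows "subgroup (inc v ` S) tree_group"
proof -
  interpret V: group "E\<lparr>carrier := vg v\<rparr>" by (rule E.subgroup_imp_group [OF subgroup_vg])
  interpret i: group_hom "E\<lparr>carrier := vg v\<rparr>" tree_group "inc v"
    using inc_hom by (simp add: group_hom_def group_hom_axioms_def V.group_axioms G.group_axioms)
  have "subgroup S (E\<lparr>carrier := vg v\<rparr>)" by (rule E.subgroup_incl [OF assms(1) subgroup_vg assms(2)])
  then show ?thesis by (rule i.subgroup_img_is_subgroup)
qed

end

section \<open>Path-shaped splittings\<close>

definition path_graph :: "nat \<Rightarrow> (nat, nat) pre_digraph" where
  "path_graph n = \<lparr>verts = {..n}, arcs = {..<n}, tail = (\<lambda>i. i), head = Suc\<rparr>"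

lemma path_graph_simps [simp]:
  "verts (path_graph n) = {..n}" "arcs (path_graph n) = {..<n}"
  "tail (path_graph n) i = i" "head (path_graph n) i = Suc i"
  by (simp_all add: path_graph_def)

lemma fin_digraph_path_graph: "fin_digraph (path_graph n)"
  by unfold_locales (auto simp: path_graph_def)

lemma connected_path_graph: "Digraph_Component.connected (path_graph n)"
proof -
  let ?S = "with_proj (mk_symmetric (path_graph n))"
  interpret S: wf_digraph ?S
    by unfold_locales (auto simp: mk_symmetric_def path_graph_def)
  have arc: "(i, Suc i) \<in> arcs_ends ?S" "(Suc i, i) \<in> arcs_ends ?S" if "i < n" for i
    using that by (auto simp: arcs_ends_conv mk_symmetric_def path_graph_def image_iff intro!: bexI [of _ i])
  have verts: "verts ?S = {..n}" by (simp add: mk_symmetric_def)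
  have "0 \<rightarrow>\<^sup>*\<^bsub>?S\<^esub> v \<and> v \<rightarrow>\<^sup>*\<^bsub>?S\<^esub> 0" if "v \<le> n" for v
    using that
  proof (induction v)
    case 0
    then show ?case using verts by (auto intro: S.reachable_refl)
  next
    case (Suc v)
    then show ?case using arc [of v]
      by (meson S.adj_reachable_trans S.reachable_adj_trans Suc_le_lessD le_SucI Suc_leD)
  qed
  then show ?thesis
    unfolding connected_def strongly_connected_def verts by (auto intro: S.reachable_trans)
qed

text \<open>Without the edge \<open>i\<close> the path falls apart between \<open>i\<close> and
  \<open>Suc i\<close>, so such a walk stays on one side.\<close>

lemma path_graph_side:
  assumes "pre_digraph.cas (doubled (path_graph n)) u q v" "i \<notin> fst ` set q"
  shows "u \<le> i \<longleftrightarrow> v \<le> i"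
  using assms
proof (induction q arbitrary: u)
  case Nil
  then show ?case by (simp add: pre_digraph.cas.simps)
next
  case (Cons a q)
  obtain e b where a: "a = (e, b)" by force
  have "pre_digraph.cas (doubled (path_graph n)) (head (doubled (path_graph n)) a) q v"
    and u: "tail (doubled (path_graph n)) a = u"
    using Cons.prems by (simp_all add: pre_digraph.cas.simps)
  then have "head (doubled (path_graph n)) a \<le> i \<longleftrightarrow> v \<le> i" using Cons by simp
  then show ?case using Cons.prems u a by (auto simp: doubled_def split: if_splits)
qed

text \<open>The first edge of a circuit crosses to its other side, and the rest of the circuit would
  have to come back without that edge.\<close>

lemma maximal_subtree_path_graph: "maximal_subtree (path_graph n) (path_graph n)"
proof -
  interpret fin_digraph "path_graph n" by (rule fin_digraph_path_graph)
  let ?Y = "doubled (path_graph n)"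
  have "False" if q: "pre_digraph.cycle ?Y q" "distinct (map fst q)" for q
  proof -
    obtain u where u: "pre_digraph.cas ?Y u q u" "q \<noteq> []"
      using q(1) by (auto simp: pre_digraph.cycle_def pre_digraph.awalk_def)
    then obtain e b q' where q': "q = (e, b) # q'" by (cases q) auto
    have c: "pre_digraph.cas ?Y (head ?Y (e, b)) q' u" "tail ?Y (e, b) = u"
      using u(1) by (simp_all add: q' pre_digraph.cas.simps)
    have "e \<notin> fst ` set q'" using q(2) by (simp add: q')
    from path_graph_side [OF c(1) this] c(2) show False
      by (auto simp: doubled_def split: if_splits)
  qed
  then show ?thesis
    unfolding maximal_subtree_def spanning_def subgraph_def compatible_def
    using connected_path_graph wf_digraph_axioms by blast
qed

section \<open>Cutting the tree product along the first \<open>n\<close> edges of the chain\<close>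

context tree_datum
begin

text \<open>The last vertex swallows \<open>H\<close> and the rest of the chain: all later
  \<open>P i\<close> lie in it by \<open>inc_P_top_group\<close>. So a path with \<open>n\<close>
  edges carries the whole group.\<close>

definition top_group :: "nat \<Rightarrow> nat set" where
  "top_group n = generate tree_group (inc 0 ` H \<union> inc (Suc n) ` P n)"

definition path_vertex :: "nat \<Rightarrow> nat \<Rightarrow> nat set" where
  "path_vertex n v = (if v < n then inc (Suc v) ` P v else top_group n)"

definition splitting :: "nat \<Rightarrow> (nat, nat, nat) graph_of_groups" where
  "splitting n =
     \<lparr> graph = path_graph n,
       vertex_group = (\<lambda>v. tree_group\<lparr>carrier := path_vertex n v\<rparr>),
       edge_group = (\<lambda>e. tree_group\<lparr>carrier := inc (Suc e) ` L e\<rparr>),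
       bd0 = (\<lambda>e g. g), bd1 = (\<lambda>e g. g) \<rparr>"

lemma splitting_simps [simp]:
  "graph (splitting n) = path_graph n"
  "vertex_group (splitting n) v = tree_group\<lparr>carrier := path_vertex n v\<rparr>"
  "edge_group (splitting n) e = tree_group\<lparr>carrier := inc (Suc e) ` L e\<rparr>"
  "bd0 (splitting n) e g = g" "bd1 (splitting n) e g = g"
  by (simp_all add: splitting_def)

lemma top_gens: "inc 0 ` H \<union> inc (Suc n) ` P n \<subseteq> carrier tree_group"
  using inc_closed [of _ 0] inc_closed [of _ "Suc n"] by auto

lemma subgroup_top_group: "subgroup (top_group n) tree_group"
  unfolding top_group_def by (rule G.generate_is_subgroup [OF top_gens])

lemma inc_top_group:
  "x \<in> H \<Longrightarrow> inc 0 x \<in> top_group n"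
  "x \<in> P n \<Longrightarrow> inc (Suc n) x \<in> top_group n"
  unfolding top_group_def by (auto intro: generate.incl)

lemma subgroup_path_vertex: "subgroup (path_vertex n v) tree_group"
  using inc_subgroup [OF subgroups(2), of _ "Suc _"] subgroup_top_group by (simp add: path_vertex_def)

lemma inc_L_image: "inc (Suc i) ` L i = inc (Suc (Suc i)) ` L i"
  by (simp add: inc_L cong: image_cong)

lemma edge_subset:
  assumes "e < n"
  shows "inc (Suc e) ` L e \<subseteq> path_vertex n e" "inc (Suc e) ` L e \<subseteq> path_vertex n (Suc e)"
proof -
  show "inc (Suc e) ` L e \<subseteq> path_vertex n e" using assms L_P by (auto simp: path_vertex_def)
  have "inc (Suc (Suc e)) ` L e \<subseteq> path_vertex n (Suc e)"
    using assms L_P(2) [of e] inc_top_group(2) [of _ n] by (cases "Suc e = n") (auto simp: path_vertex_def)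
  then show "inc (Suc e) ` L e \<subseteq> path_vertex n (Suc e)" by (simp add: inc_L_image)
qed

lemma is_graph_of_groups_splitting: "is_graph_of_groups (splitting n)"
proof -
  have "group (tree_group\<lparr>carrier := path_vertex n v\<rparr>)" for v
    by (rule G.subgroup_imp_group [OF subgroup_path_vertex])
  moreover have "group (tree_group\<lparr>carrier := inc (Suc e) ` L e\<rparr>)" for e
    by (rule G.subgroup_imp_group [OF inc_subgroup]) (use subgroups L_P in auto)
  moreover have "(\<lambda>g. g) \<in> mon (tree_group\<lparr>carrier := inc (Suc e) ` L e\<rparr>) (tree_group\<lparr>carrier := path_vertex n v\<rparr>)"
    if "inc (Suc e) ` L e \<subseteq> path_vertex n v" for e v
    using that by (auto simp: mon_def hom_def)
  moreover have "wf_digraph (path_graph n)"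
    using fin_digraph_path_graph by (simp add: fin_digraph_def)
  ultimately show ?thesis
    using connected_path_graph edge_subset
    by (auto simp: is_graph_of_groups_def splitting_def)
qed

text \<open>\<open>inc\<close> is injective, so the properness of \<open>L e\<close> in
  \<open>P e\<close> and in \<open>P (Suc e)\<close> survives in \<open>tree_group\<close>. The last
  vertex group contains the image of \<open>P n\<close>, which settles the last edge.\<close>

lemma reduced_splitting: "reduced (splitting n)"
proof -
  have ne: "(\<lambda>g. g) \<notin> iso (tree_group\<lparr>carrier := A\<rparr>) (tree_group\<lparr>carrier := B\<rparr>)" if "A \<noteq> B" for A B
    using that by (auto simp: iso_def bij_betw_def)
  have "inc (Suc e) ` L e \<noteq> path_vertex n e \<and> inc (Suc e) ` L e \<noteq> path_vertex n (Suc e)" if e: "e < n" for e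
  proof
    have L: "L e \<subset> P e" "L e \<subset> P (Suc e)" using proper [of e] L_P [of e] by auto
    have 1: "inc (Suc v) ` L e \<subset> inc (Suc v) ` P v" if "L e \<subset> P v" for v
    proof -
      have "inc (Suc v) ` L e \<noteq> inc (Suc v) ` P v"
        using inj_on_image_eq_iff [OF inj_inc [of "Suc v"]] that by auto
      then show ?thesis using that by blast
    qed
    show "inc (Suc e) ` L e \<noteq> path_vertex n e" using 1 [OF L(1)] e by (auto simp: path_vertex_def)
    have "inc (Suc (Suc e)) ` P (Suc e) \<subseteq> path_vertex n (Suc e)"
      using e inc_top_group(2) [of _ n] by (cases "Suc e = n") (auto simp: path_vertex_def)
    then show "inc (Suc e) ` L e \<noteq> path_vertex n (Suc e)"
      using 1 [OF L(2)] inc_L_image [of e] by blast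
  qed
  then show ?thesis using ne by (simp add: reduced_def splitting_def)
qed

text \<open>The induction of \<open>compatible_generate\<close>, started at \<open>n\<close> instead
  of 0.\<close>

lemma inc_P_top_group:
  assumes "n \<le> i" "x \<in> P i"
  shows "inc (Suc i) x \<in> top_group n"
  using assms
proof (induction i arbitrary: x rule: dec_induct)
  case base
  then show ?case by (rule inc_top_group)
next
  case (step i)
  let ?T = "top_group n"
  have "inc (Suc (Suc i)) y \<in> ?T" if "y \<in> L i \<union> D (Suc i)" for y
    using that
  proof
    assume y: "y \<in> L i"
    then have "inc (Suc i) y \<in> ?T" using step.IH L_P by blast
    then show ?thesis using inc_L [OF y] by simp
  next
    assume "y \<in> D (Suc i)"
    then show ?thesis using inc_D inc_top_group(1) D_H by fastforce
  qed
  then have "inc (Suc (Suc i)) ` (L i \<union> D (Suc i)) \<subseteq> ?T" by blast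
  then have "generate tree_group (inc (Suc (Suc i)) ` (L i \<union> D (Suc i))) \<subseteq> ?T"
    by (rule G.generate_subset_subgroup [OF subgroup_top_group])
  moreover have "inc (Suc (Suc i)) x \<in> generate tree_group (inc (Suc (Suc i)) ` (L i \<union> D (Suc i)))"
  proof (rule hom_generate_image [OF group_tree_group])
    show "inc (Suc (Suc i)) \<in> hom (E\<lparr>carrier := P (Suc i)\<rparr>) tree_group"
      using inc_hom [of "Suc (Suc i)"] by simp
    show "L i \<union> D (Suc i) \<subseteq> P (Suc i)" using L_P [of i] L_P [of "Suc i"] D_L [of "Suc i"] by blast
  qed (rule subgroups P_Suc step.prems)+
  ultimately show ?case by blast
qed

lemma inc_D_le:
  assumes "i \<le> j" "x \<in> D i"
  shows "x \<in> D j" "inc (Suc j) x = inc 0 x"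
proof -
  show "x \<in> D j" using lift_Suc_mono_le [of D i j] D_Suc assms by blast
  then show "inc (Suc j) x = inc 0 x" by (rule inc_D)
qed

end

section \<open>The fundamental group of the splitting\<close>

context tree_datum
begin

lemma splitting_gens:
  "fundamental_gens (splitting n) =
     {Vertex_Elem v g | v g. v \<le> n \<and> g \<in> path_vertex n v} \<union> Stable ` {..<n}"
  by (simp add: fundamental_gens_def)

lemma splitting_rels:
  "fundamental_rels (splitting n) (path_graph n) =
     {([(Vertex_Elem v g, False), (Vertex_Elem v h, False)],
       [(Vertex_Elem v (g \<otimes>\<^bsub>tree_group\<^esub> h), False)]) | v g h.
        v \<le> n \<and> g \<in> path_vertex n v \<and> h \<in> path_vertex n v} \<union>
     {([(Stable e, True), (Vertex_Elem e g, False), (Stable e, False)],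
       [(Vertex_Elem (Suc e) g, False)]) | e g. e < n \<and> g \<in> inc (Suc e) ` L e} \<union>
     {([(Stable e, False)], []) | e. e < n}"
  by (simp add: fundamental_rels_def)

text \<open>The map to \<open>tree_group\<close> keeps vertex elements and kills stable letters; its
  inverse comes from the universal property. Both composites are checked on generators.\<close>

lemma fundamental_group_splitting:
  "fundamental_group (splitting n) (path_graph n) \<cong> tree_group"
proof -
  define S where "S = fundamental_gens (splitting n)"
  define R where "R = fundamental_rels (splitting n) (path_graph n)"
  note S_eq = splitting_gens [of n, folded S_def]
  note R_eq = splitting_rels [of n, folded R_def]
  let ?F = "presented_group S R"
  let ?c = "gen_class S R"
  interpret F: group ?F by (rule group_presented_group)
  have V: "Vertex_Elem v g \<in> S" if "v \<le> n" "g \<in> path_vertex n v" for v g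
    using that by (simp add: S_eq)
  have St: "Stable e \<in> S" if "e < n" for e
    using that by (simp add: S_eq)
  have rel_cases: thesis if uw: "(u, w) \<in> R"
    and m: "\<And>v g h. v \<le> n \<Longrightarrow> g \<in> path_vertex n v \<Longrightarrow> h \<in> path_vertex n v \<Longrightarrow>
      u = [(Vertex_Elem v g, False), (Vertex_Elem v h, False)] \<Longrightarrow>
      w = [(Vertex_Elem v (g \<otimes>\<^bsub>tree_group\<^esub> h), False)] \<Longrightarrow> thesis"
    and e: "\<And>e g. e < n \<Longrightarrow> g \<in> inc (Suc e) ` L e \<Longrightarrow>
      u = [(Stable e, True), (Vertex_Elem e g, False), (Stable e, False)] \<Longrightarrow>
      w = [(Vertex_Elem (Suc e) g, False)] \<Longrightarrow> thesis"
    and t: "\<And>e. e < n \<Longrightarrow> u = [(Stable e, False)] \<Longrightarrow> w = [] \<Longrightarrow> thesis"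
    for u w thesis
    using uw unfolding R_eq by (auto intro: m e t)
  have words: "R \<subseteq> words S \<times> words S"
  proof
    fix r assume r: "r \<in> R"
    obtain u w where uw: "r = (u, w)" by force
    show "r \<in> words S \<times> words S"
      using r unfolding uw
    proof (rule rel_cases)
      fix v g h assume *: "v \<le> n" "g \<in> path_vertex n v" "h \<in> path_vertex n v"
        "u = [(Vertex_Elem v g, False), (Vertex_Elem v h, False)]"
        "w = [(Vertex_Elem v (g \<otimes>\<^bsub>tree_group\<^esub> h), False)]"
      then have "g \<otimes>\<^bsub>tree_group\<^esub> h \<in> path_vertex n v"
        by (intro subgroup.m_closed [OF subgroup_path_vertex])
      then show "(u, w) \<in> words S \<times> words S" using * V by simp
    next
      fix e g assume *: "e < n" "g \<in> inc (Suc e) ` L e"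
        "u = [(Stable e, True), (Vertex_Elem e g, False), (Stable e, False)]"
        "w = [(Vertex_Elem (Suc e) g, False)]"
      then have "g \<in> path_vertex n e" "g \<in> path_vertex n (Suc e)" using edge_subset by blast+
      then show "(u, w) \<in> words S \<times> words S" using * V St by simp
    qed (use St in simp)
  qed
  have rel: "word_val ?F ?c u = word_val ?F ?c w" if "(u, w) \<in> R" for u w
    using presented_group_rel [OF that] that words by blast
  have cV: "?c (Vertex_Elem v g) \<in> carrier ?F" if "v \<le> n" "g \<in> path_vertex n v" for v g
    using V [OF that] by (rule gen_class_closed)
  have cmult: "?c (Vertex_Elem v (g \<otimes>\<^bsub>tree_group\<^esub> h)) = ?c (Vertex_Elem v g) \<otimes>\<^bsub>?F\<^esub> ?c (Vertex_Elem v h)"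
    if *: "v \<le> n" "g \<in> path_vertex n v" "h \<in> path_vertex n v" for v g h
  proof -
    have "([(Vertex_Elem v g, False), (Vertex_Elem v h, False)],
       [(Vertex_Elem v (g \<otimes>\<^bsub>tree_group\<^esub> h), False)]) \<in> R"
      using * by (simp add: R_eq)
    from rel [OF this] show ?thesis
      using cV * subgroup.m_closed [OF subgroup_path_vertex *(2,3)] by simp
  qed
  have cSt: "?c (Stable e) = \<one>\<^bsub>?F\<^esub>" if "e < n" for e
  proof -
    have "([(Stable e, False)], []) \<in> R" using that by (simp add: R_eq)
    from rel [OF this] show ?thesis using gen_class_closed [OF St [OF that]] by simp
  qed
  have cL: "?c (Vertex_Elem (Suc e) g) = ?c (Vertex_Elem e g)" if "e < n" "g \<in> inc (Suc e) ` L e" for e g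
  proof -
    have "([(Stable e, True), (Vertex_Elem e g, False), (Stable e, False)], [(Vertex_Elem (Suc e) g, False)]) \<in> R"
      using that by (auto simp: R_eq)
    from rel [OF this] show ?thesis
      using that cV [of e g] cV [of "Suc e" g] edge_subset [OF that(1)] by (simp add: cSt subset_iff)
  qed
  obtain \<phi> where \<phi>: "\<phi> \<in> hom ?F tree_group"
    and \<phi>_gen: "\<And>s. s \<in> S \<Longrightarrow> \<phi> (?c s) = (case s of Vertex_Elem v g \<Rightarrow> g | Stable e \<Rightarrow> \<one>\<^bsub>tree_group\<^esub>)"
  proof -
    have sub: "path_vertex n v \<subseteq> carrier tree_group" for v
      by (rule subgroup.subset [OF subgroup_path_vertex])
    have "\<exists>h \<in> hom ?F tree_group. \<forall>s \<in> S. h (?c s) =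
      (case s of Vertex_Elem v g \<Rightarrow> g | Stable e \<Rightarrow> \<one>\<^bsub>tree_group\<^esub>)"
    proof (rule presented_group_hom [OF group_tree_group _ words])
      show "(case s of Vertex_Elem v g \<Rightarrow> g | Stable e \<Rightarrow> \<one>\<^bsub>tree_group\<^esub>) \<in> carrier tree_group"
        if "s \<in> S" for s
        using that sub by (auto simp: S_eq split: gen.split)
      let ?f = "\<lambda>s. case s of Vertex_Elem v g \<Rightarrow> g | Stable e \<Rightarrow> \<one>\<^bsub>tree_group\<^esub>"
      show "word_val tree_group ?f u = word_val tree_group ?f w" if "(u, w) \<in> R" for u w
        using that
      proof (rule rel_cases)
        fix v g h assume *: "g \<in> path_vertex n v" "h \<in> path_vertex n v"
          "u = [(Vertex_Elem v g, False), (Vertex_Elem v h, False)]"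
          "w = [(Vertex_Elem v (g \<otimes>\<^bsub>tree_group\<^esub> h), False)]"
        then have "g \<in> carrier tree_group" "h \<in> carrier tree_group" using sub by blast+
        then show "word_val tree_group ?f u = word_val tree_group ?f w" using * by simp
      next
        fix e g assume *: "g \<in> inc (Suc e) ` L e"
          "u = [(Stable e, True), (Vertex_Elem e g, False), (Stable e, False)]"
          "w = [(Vertex_Elem (Suc e) g, False)]"
        then have "g \<in> carrier tree_group" using inc_closed [of _ "Suc e"] L_P by auto
        then show "word_val tree_group ?f u = word_val tree_group ?f w" using * by simp
      qed simp
    qed
    then show thesis using that by blast
  qed
  \<comment> \<open>The pieces \<open>P i\<close> with \<open>i \<ge> n\<close> were absorbed into
    the last vertex, hence the index \<open>min i n\<close>; \<open>H\<close> also sits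
    there.\<close>
  define fam where "fam v x = (case v of 0 \<Rightarrow> ?c (Vertex_Elem n (inc 0 x))
    | Suc i \<Rightarrow> ?c (Vertex_Elem (min i n) (inc (Suc i) x)))" for v x
  have mem: "inc (Suc i) x \<in> path_vertex n (min i n)" if "x \<in> P i" for i x
    using that inc_P_top_group [of n i x] by (auto simp: path_vertex_def min_def)
  have mem0: "inc 0 x \<in> path_vertex n n" if "x \<in> H" for x
    using that inc_top_group by (simp add: path_vertex_def)
  have "compatible ?F fam"
    unfolding compatible_def
  proof (intro conjI allI ballI)
    fix v
    show "fam v \<in> hom (E\<lparr>carrier := vg v\<rparr>) ?F"
    proof (cases v)
      case 0
      then show ?thesis using mem0
        by (auto simp: fam_def hom_def cV inc_mult [of _ 0, simplified] cmult)
    next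
      case (Suc i)
      then show ?thesis using mem [of _ i] inc_mult [of _ "Suc i"]
        by (auto simp: fam_def hom_def cV cmult)
    qed
  next
    fix i x assume x: "x \<in> L i"
    show "fam (Suc i) x = fam (Suc (Suc i)) x"
    proof (cases "i < n")
      case True
      then show ?thesis using x cL [OF True] by (simp add: fam_def inc_L min_def)
    qed (use x in \<open>simp add: fam_def inc_L min_def\<close>)
  next
    fix i x assume x: "x \<in> D i"
    \<comment> \<open>An element of \<open>D i\<close> lies in every later edge group, so the
      identifications along the path carry it from vertex \<open>i\<close> to the last vertex, where
      \<open>H\<close> is.\<close>
    have "?c (Vertex_Elem j (inc 0 x)) = ?c (Vertex_Elem i (inc 0 x))" if "i \<le> j" "j \<le> n" for j
      using that
    proof (induction j rule: dec_induct)
      case (step j)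
      then have "inc 0 x \<in> inc (Suc j) ` L j"
        using inc_D_le [OF _ x, of j] D_L by (metis imageI subsetD)
      then show ?case using step cL [of j "inc 0 x"] by simp
    qed simp
    from this [of n] show "fam (Suc i) x = fam 0 x"
      using inc_D [OF x] by (simp add: fam_def min_def)
  qed
  from tree_group_universal [OF F.group_axioms this]
  obtain \<psi> where \<psi>: "\<psi> \<in> hom tree_group ?F" and "\<forall>v. \<forall>x \<in> vg v. \<psi> (inc v x) = fam v x"
    by (rule bexE)
  then have \<psi>_inc: "\<And>v x. x \<in> vg v \<Longrightarrow> \<psi> (inc v x) = fam v x" by simp
  have \<phi>\<psi>: "\<phi> (\<psi> g) = g" if "g \<in> carrier tree_group" for g
  proof -
    have "(\<phi> \<circ> \<psi>) g = id g"
    proof (rule G.hom_eq_on_generate [OF group_tree_group, of "\<phi> \<circ> \<psi>" id "\<Union>v. inc v ` vg v"])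
      show "\<phi> \<circ> \<psi> \<in> hom tree_group tree_group" using \<psi> \<phi> by (rule hom_compose)
      show "id \<in> hom tree_group tree_group" by (simp add: hom_def)
      show "(\<Union>v. inc v ` vg v) \<subseteq> carrier tree_group" using inc_closed by blast
      show "g \<in> generate tree_group (\<Union>v. inc v ` vg v)" using that generate_tree_group by simp
      fix y assume "y \<in> (\<Union>v. inc v ` vg v)"
      then obtain v x where x: "x \<in> vg v" "y = inc v x" by blast
      have "\<phi> (fam v x) = inc v x"
        using x(1) mem0 mem [of x "v - 1"] by (cases v) (simp_all add: fam_def \<phi>_gen V)
      then show "(\<phi> \<circ> \<psi>) y = id y" using x \<psi>_inc by simp
    qed
    then show ?thesis by simp
  qed
  have \<psi>_vertex: "\<psi> g = ?c (Vertex_Elem v g)" if v: "v \<le> n" and g: "g \<in> path_vertex n v" for v g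
  proof (cases "v < n")
    case True
    then obtain x where x: "x \<in> P v" "g = inc (Suc v) x" using g by (auto simp: path_vertex_def)
    then show ?thesis using \<psi>_inc [of x "Suc v"] True by (simp add: fam_def min_def)
  next
    case False
    then have vn: "v = n" using v by simp
    let ?T = "tree_group\<lparr>carrier := top_group n\<rparr>" and ?A = "inc 0 ` H \<union> inc (Suc n) ` P n"
    interpret T: group ?T by (rule G.subgroup_imp_group [OF subgroup_top_group])
    have tv: "path_vertex n n = top_group n" by (simp add: path_vertex_def)
    have A: "?A \<subseteq> top_group n" using inc_top_group by blast
    \<comment> \<open>An element of the last vertex group need not come from a single piece, so two
      homomorphisms on this group are compared on its generators.\<close>
    show ?thesis unfolding vn
    proof (rule T.hom_eq_on_generate [OF F.group_axioms, of \<psi> "\<lambda>g. ?c (Vertex_Elem n g)" ?A])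
      show "\<psi> \<in> hom ?T ?F" using \<psi> subgroup.subset [OF subgroup_top_group [of n]]
        by (simp add: hom_def Pi_iff subset_iff)
      show "(\<lambda>g. ?c (Vertex_Elem n g)) \<in> hom ?T ?F" using cV [of n] cmult [of n] by (auto simp: hom_def tv)
      show "?A \<subseteq> carrier ?T" using A by simp
      show "g \<in> generate ?T ?A"
        using G.generate_consistent [OF A subgroup_top_group] g by (simp add: vn tv top_group_def)
      fix y assume "y \<in> ?A"
      then show "\<psi> y = ?c (Vertex_Elem n y)"
        using \<psi>_inc [of _ 0] \<psi>_inc [of _ "Suc n"] by (auto simp: fam_def)
    qed
  qed
  have \<psi>\<phi>: "\<psi> (\<phi> A) = A" if "A \<in> carrier ?F" for A
  proof -
    have "(\<psi> \<circ> \<phi>) A = id A"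
    proof (rule F.hom_eq_on_generate [OF F.group_axioms, of "\<psi> \<circ> \<phi>" id "?c ` S"])
      show "\<psi> \<circ> \<phi> \<in> hom ?F ?F" using \<phi> \<psi> by (rule hom_compose)
      show "id \<in> hom ?F ?F" by (simp add: hom_def)
      show "?c ` S \<subseteq> carrier ?F" by (rule image_subsetI) (rule gen_class_closed)
      show "A \<in> generate ?F (?c ` S)" using that by (simp add: generate_presented_group)
      fix y assume "y \<in> ?c ` S"
      then obtain s where s: "s \<in> S" "y = ?c s" by blast
      interpret \<psi>: group_hom tree_group ?F \<psi>
        using \<psi> by (simp add: group_hom_def group_hom_axioms_def G.group_axioms F.group_axioms)
      show "(\<psi> \<circ> \<phi>) y = id y"
      proof (cases s)
        case (Vertex_Elem v g)
        then have "v \<le> n" "g \<in> path_vertex n v" using s(1) by (auto simp: S_eq)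
        then show ?thesis using \<phi>_gen [OF s(1)] by (simp add: s(2) Vertex_Elem \<psi>_vertex)
      next
        case (Stable e)
        then have "e < n" using s(1) by (auto simp: S_eq)
        then show ?thesis using \<phi>_gen [OF s(1)] by (simp add: s(2) Stable cSt)
      qed
    qed
    then show ?thesis by simp
  qed
  have "\<phi> \<in> iso ?F tree_group"
    by (rule iso_of_inverse_homs [OF \<phi> \<psi> \<psi>\<phi> \<phi>\<psi>])
  then show ?thesis by (auto simp: is_iso_def fundamental_group_def S_def R_def)
qed

lemma inaccessible_tree_group: "inaccessible tree_group"
proof
  assume "accessible tree_group"
  then obtain n where n: "\<And>(X :: (nat, nat, nat) graph_of_groups) T.
      finite_graph_of_groups X \<Longrightarrow> reduced X \<Longrightarrow> finite_edge_groups X \<Longrightarrow>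
      maximal_subtree T (graph X) \<Longrightarrow> fundamental_group X T \<cong> tree_group \<Longrightarrow>
      card (arcs (graph X)) \<le> n"
    unfolding accessible_def by blast
  have "card (arcs (graph (splitting (Suc n)))) \<le> n"
  proof (rule n)
    show "finite_graph_of_groups (splitting (Suc n))"
      using fin_digraph_path_graph is_graph_of_groups_splitting
      by (simp add: finite_graph_of_groups_def)
    show "finite_edge_groups (splitting (Suc n))"
      by (simp add: finite_edge_groups_def finite_L)
    show "fundamental_group (splitting (Suc n)) (path_graph (Suc n)) \<cong> tree_group"
      by (rule fundamental_group_splitting)
  qed (simp_all add: reduced_splitting maximal_subtree_path_graph)
  then show False by simp
qed

end

section \<open>Triangular maps\<close>

text \<open>Vectors modulo \<open>p\<close>, given by least residues, so that congruent entries are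
  equal and a finite \<open>D\<close> has only finitely many vectors.\<close>

definition vectors :: "nat \<Rightarrow> 'd set \<Rightarrow> ('d \<Rightarrow> int) set" where
  "vectors p D = D \<rightarrow>\<^sub>E {0..<int p}"

text \<open>Modulo \<open>p\<close>, the entry \<open>g F d\<close> is \<open>F (\<pi> d)\<close>
  plus an increment that depends only on the entries of rank below \<open>rk d\<close>. The
  increment may be nonlinear, as it is for the elements \<open>z\<close> of the concrete
  seed.\<close>

definition triangular ::
    "nat \<Rightarrow> 'd set \<Rightarrow> ('d \<Rightarrow> nat) \<Rightarrow> ('d \<Rightarrow> 'd) \<Rightarrow> (('d \<Rightarrow> int) \<Rightarrow> ('d \<Rightarrow> int)) \<Rightarrow> bool" where
  "triangular p D rk \<pi> g \<longleftrightarrow>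
     (\<forall>d \<in> D. \<forall>F \<in> vectors p D. \<forall>F' \<in> vectors p D.
        (\<forall>d' \<in> D. rk d' < rk d \<longrightarrow> F d' = F' d') \<longrightarrow>
        int p dvd (g F d - F (\<pi> d)) - (g F' d - F' (\<pi> d)))"

definition triangular_group ::
    "nat \<Rightarrow> 'd set \<Rightarrow> ('d \<Rightarrow> nat) \<Rightarrow> ('d \<Rightarrow> 'd) set \<Rightarrow> (('d \<Rightarrow> int) \<Rightarrow> ('d \<Rightarrow> int)) monoid" where
  "triangular_group p D rk \<Theta> =
     \<lparr> carrier = {g \<in> vectors p D \<rightarrow>\<^sub>E vectors p D. \<exists>\<pi> \<in> \<Theta>. triangular p D rk \<pi> g},
       monoid.mult = compose (vectors p D),
       monoid.one = (\<lambda>F \<in> vectors p D. F) \<rparr>"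

lemma mod_eq_vectors:
  assumes "F \<in> vectors p D" "F' \<in> vectors p D" "d \<in> D" "int p dvd F d - F' d"
  shows "F d = F' d"
proof -
  have "F d mod int p = F' d mod int p" using assms(4) by (simp add: mod_eq_dvd_iff)
  moreover have "F d \<in> {0..<int p}" "F' d \<in> {0..<int p}" using assms by (auto simp: vectors_def)
  ultimately show ?thesis by simp
qed

lemma vectors_eqI:
  "F \<in> vectors p D \<Longrightarrow> F' \<in> vectors p D \<Longrightarrow> (\<And>d. d \<in> D \<Longrightarrow> int p dvd F d - F' d) \<Longrightarrow> F = F'"
  by (rule ext) (metis mod_eq_vectors vectors_def PiE_arb)

text \<open>The power \<open>p ^ m\<close> kills the permutations and \<open>B\<close> bounds the
  number of ranks, which together give the exponent \<open>p ^ (m + B)\<close>. Permutations matter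
  only through their action on \<open>D\<close>, so the closure conditions hold up to agreement on
  \<open>D\<close>.\<close>

locale triangular_setup =
  fixes p :: nat and D :: "'d set" and rk :: "'d \<Rightarrow> nat" and \<Theta> :: "('d \<Rightarrow> 'd) set" and B m :: nat
  assumes p: "prime p"
    and D: "finite D" "\<And>d. d \<in> D \<Longrightarrow> rk d < B"
    and perm: "\<And>\<pi> d. \<pi> \<in> \<Theta> \<Longrightarrow> d \<in> D \<Longrightarrow> \<pi> d \<in> D \<and> rk (\<pi> d) = rk d"
    and perm_one: "\<exists>\<pi> \<in> \<Theta>. \<forall>d \<in> D. \<pi> d = d"
    and perm_comp: "\<And>\<pi> \<pi>'. \<pi> \<in> \<Theta> \<Longrightarrow> \<pi>' \<in> \<Theta> \<Longrightarrow> \<exists>\<pi>'' \<in> \<Theta>. \<forall>d \<in> D. \<pi>'' d = \<pi>' (\<pi> d)"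
    and perm_pow: "\<And>\<pi> d. \<pi> \<in> \<Theta> \<Longrightarrow> d \<in> D \<Longrightarrow> (\<pi> ^^ (p ^ m)) d = d"
begin

abbreviation "V \<equiv> vectors p D"
abbreviation "U \<equiv> triangular_group p D rk \<Theta>"

definition pres :: "('d \<Rightarrow> 'd) \<Rightarrow> bool" where
  "pres \<pi> \<longleftrightarrow> (\<forall>d \<in> D. \<pi> d \<in> D \<and> rk (\<pi> d) = rk d)"

lemma triangular_cong:
  "(\<And>d. d \<in> D \<Longrightarrow> \<pi> d = \<pi>' d) \<Longrightarrow> triangular p D rk \<pi> g = triangular p D rk \<pi>' g"
  by (simp add: triangular_def)

lemma triangular_agree:
  assumes g: "g \<in> V \<rightarrow> V" "triangular p D rk \<pi> g" and \<pi>: "pres \<pi>"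
    and F: "F \<in> V" "F' \<in> V" "\<And>d. d \<in> D \<Longrightarrow> rk d < k \<Longrightarrow> F d = F' d"
    and d: "d \<in> D" "rk d < k"
  shows "g F d = g F' d"
proof (rule mod_eq_vectors [of _ p D])
  have "\<pi> d \<in> D" "rk (\<pi> d) < k" using \<pi> d by (auto simp: pres_def)
  then have "F (\<pi> d) = F' (\<pi> d)" by (rule F(3))
  moreover have "\<forall>d' \<in> D. rk d' < rk d \<longrightarrow> F d' = F' d'"
    using F(3) d(2) by (meson less_trans)
  then have "int p dvd (g F d - F (\<pi> d)) - (g F' d - F' (\<pi> d))"
    using g(2) d(1) F(1,2) unfolding triangular_def by blast
  ultimately show "int p dvd g F d - g F' d" by (simp add: algebra_simps)
qed (use g F d in auto)

text \<open>Coordinate \<open>d\<close> of \<open>g (h F)\<close> reads \<open>h F\<close> at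
  \<open>\<pi> d\<close>, which reads \<open>F\<close> at \<open>\<pi>' (\<pi> d)\<close>; the
  permutations thus compose in reverse order.\<close>

lemma triangular_compose:
  assumes g: "g \<in> V \<rightarrow> V" "triangular p D rk \<pi> g" "pres \<pi>"
    and h: "h \<in> V \<rightarrow> V" "triangular p D rk \<pi>' h" "pres \<pi>'"
  shows "triangular p D rk (\<pi>' \<circ> \<pi>) (\<lambda>F. g (h F))"
  unfolding triangular_def
proof (intro ballI impI)
  fix d F F' assume d: "d \<in> D" and F: "F \<in> V" "F' \<in> V"
    and eq: "\<forall>d' \<in> D. rk d' < rk d \<longrightarrow> F d' = F' d'"
  have "h F d' = h F' d'" if "d' \<in> D" "rk d' < rk d" for d'
    using triangular_agree [OF h F, of "rk d" d'] eq that by blast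
  then have 1: "int p dvd (g (h F) d - h F (\<pi> d)) - (g (h F') d - h F' (\<pi> d))"
    using g(2) h(1) F d unfolding triangular_def by blast
  have "\<pi> d \<in> D" "rk (\<pi> d) = rk d" using g(3) d by (auto simp: pres_def)
  then have 2: "int p dvd (h F (\<pi> d) - F (\<pi>' (\<pi> d))) - (h F' (\<pi> d) - F' (\<pi>' (\<pi> d)))"
    using h(2) F eq unfolding triangular_def by simp
  from dvd_add [OF 1 2]
  show "int p dvd (g (h F) d - F ((\<pi>' \<circ> \<pi>) d)) - (g (h F') d - F' ((\<pi>' \<circ> \<pi>) d))"
    by (simp add: algebra_simps)
qed

lemma pres_funpow: "pres \<pi> \<Longrightarrow> pres (\<pi> ^^ k)"
  by (induction k) (auto simp: pres_def)

lemma funpow_vectors: "g \<in> V \<rightarrow> V \<Longrightarrow> (g ^^ k) \<in> V \<rightarrow> V"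
  by (induction k) auto

lemma triangular_funpow:
  assumes "g \<in> V \<rightarrow> V" "triangular p D rk \<pi> g" "pres \<pi>"
  shows "triangular p D rk (\<pi> ^^ k) (g ^^ k)"
proof (induction k)
  case 0
  then show ?case by (simp add: triangular_def)
next
  case (Suc k)
  have "triangular p D rk ((\<pi> ^^ k) \<circ> \<pi>) (\<lambda>F. g ((g ^^ k) F))"
    by (intro triangular_compose funpow_vectors pres_funpow assms Suc)
  then show ?case by (simp add: o_def funpow_swap1)
qed

text \<open>If \<open>g\<close> fixes the coordinates of rank less than \<open>k\<close>, then it adds to a coordinate of rank
  \<open>k\<close> a quantity that is the same for \<open>F\<close> and \<open>g F\<close>, so \<open>g\<^sup>p\<close> fixes the coordinates of rank \<open>k\<close> as
  well.\<close>

lemma triangular_pow_fixes: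
  assumes g: "g \<in> V \<rightarrow> V" "triangular p D rk id g"
    and F: "F \<in> V" and d: "d \<in> D" "rk d < k"
  shows "(g ^^ (p ^ k)) F d = F d"
  using F d
proof (induction k arbitrary: F d)
  case (Suc k)
  note IH = Suc.IH and prems = Suc.prems
  define h where "h = g ^^ (p ^ k)"
  have h: "h \<in> V \<rightarrow> V" unfolding h_def by (rule funpow_vectors [OF g(1)])
  have pid: "pres id" by (simp add: pres_def)
  have "triangular p D rk (id ^^ (p ^ k)) h"
    unfolding h_def by (rule triangular_funpow [OF g pid])
  then have th: "triangular p D rk id h" by (simp add: id_funpow)
  have hj: "(h ^^ j) F \<in> V" for j using funpow_vectors [OF h] Suc.prems by blast
  have low: "(h ^^ j) F d' = F d'" if "d' \<in> D" "rk d' < k" for j d'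
  proof (induction j)
    case (Suc j)
    have "h ((h ^^ j) F) d' = (h ^^ j) F d'"
      using IH [OF hj that] by (simp add: h_def)
    then show ?case using Suc by simp
  qed simp
  have "int p dvd (h ^^ j) F d - (F d + int j * (h F d - F d))" for j
  proof (induction j)
    case (Suc j)
    have "\<forall>d' \<in> D. rk d' < rk d \<longrightarrow> (h ^^ j) F d' = F d'" using low prems(3) by simp
    then have "int p dvd (h ((h ^^ j) F) d - (h ^^ j) F (id d)) - (h F d - F (id d))"
      using th prems(2) hj [of j] prems(1) unfolding triangular_def by blast
    from dvd_add [OF this Suc] show ?case by (simp add: algebra_simps)
  qed simp
  from dvd_add [OF this [of p] dvd_triv_left [of "int p" "h F d - F d"]]
  have "int p dvd (h ^^ p) F d - F d"
    by (simp add: algebra_simps)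
  then have "(h ^^ p) F d = F d"
    using hj Suc.prems by (intro mod_eq_vectors [of _ p D]) auto
  then show ?case by (simp add: h_def funpow_mult mult.commute)
qed simp

lemma pres_Pi: "\<pi> \<in> \<Theta> \<Longrightarrow> pres \<pi>"
  using perm by (simp add: pres_def)

text \<open>The power \<open>p ^ m\<close> removes the permutation; then each further factor
  \<open>p\<close> fixes one more rank.\<close>

lemma funpow_eq_one:
  assumes g: "g \<in> V \<rightarrow> V" "triangular p D rk \<pi> g" "\<pi> \<in> \<Theta>" and F: "F \<in> V"
  shows "(g ^^ (p ^ (m + B))) F = F"
proof -
  define h where "h = g ^^ (p ^ m)"
  have h: "h \<in> V \<rightarrow> V" unfolding h_def by (rule funpow_vectors [OF g(1)])
  have "triangular p D rk (\<pi> ^^ (p ^ m)) h"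
    unfolding h_def by (rule triangular_funpow [OF g(1,2) pres_Pi [OF g(3)]])
  then have "triangular p D rk id h"
    by (subst (asm) triangular_cong [where \<pi>' = id]) (simp_all add: perm_pow g)
  then have "(h ^^ (p ^ B)) F d = F d" if "d \<in> D" for d
    using triangular_pow_fixes [OF h _ F that] D that by blast
  moreover have "(h ^^ (p ^ B)) F \<in> V" using funpow_vectors [OF h] F by blast
  ultimately have "(h ^^ (p ^ B)) F = F" using F by (intro vectors_eqI) auto
  then show ?thesis by (simp add: h_def funpow_mult power_add mult.commute)
qed

lemma carrierD:
  assumes "g \<in> carrier U"
  obtains \<pi> where "g \<in> V \<rightarrow>\<^sub>E V" "\<pi> \<in> \<Theta>" "triangular p D rk \<pi> g"
  using assms by (auto simp: triangular_group_def)

lemma compose_closed: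
  assumes "g \<in> carrier U" "h \<in> carrier U"
  shows "compose V g h \<in> carrier U"
proof -
  from assms(1) obtain \<pi> where g: "g \<in> V \<rightarrow>\<^sub>E V" "\<pi> \<in> \<Theta>" "triangular p D rk \<pi> g" by (rule carrierD)
  from assms(2) obtain \<pi>' where h: "h \<in> V \<rightarrow>\<^sub>E V" "\<pi>' \<in> \<Theta>" "triangular p D rk \<pi>' h" by (rule carrierD)
  obtain \<pi>'' where \<pi>'': "\<pi>'' \<in> \<Theta>" "\<forall>d \<in> D. \<pi>'' d = \<pi>' (\<pi> d)" using perm_comp g h by blast
  have "triangular p D rk (\<pi>' \<circ> \<pi>) (\<lambda>F. g (h F))"
    using g h by (intro triangular_compose pres_Pi) auto
  then have "triangular p D rk \<pi>'' (\<lambda>F. g (h F))"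
    by (subst triangular_cong [where \<pi>' = "\<pi>' \<circ> \<pi>"]) (use \<pi>'' in auto)
  then have "triangular p D rk \<pi>'' (compose V g h)"
    by (simp add: triangular_def compose_eq)
  then show ?thesis using g h \<pi>''(1)
    by (auto simp: triangular_group_def compose_def)
qed

lemma one_closed: "(\<lambda>F \<in> V. F) \<in> carrier U"
proof -
  obtain \<pi> where "\<pi> \<in> \<Theta>" "\<forall>d \<in> D. \<pi> d = d" using perm_one by blast
  then show ?thesis by (auto simp: triangular_group_def triangular_def intro!: bexI [of _ \<pi>])
qed

lemma restrict_funpow_closed:
  assumes "g \<in> carrier U"
  shows "(\<lambda>F \<in> V. (g ^^ k) F) \<in> carrier U"
proof (induction k)
  case 0
  then show ?case using one_closed by (simp add: restrict_def)
next
  case (Suc k)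
  have "(\<lambda>F \<in> V. (g ^^ Suc k) F) = compose V g (\<lambda>F \<in> V. (g ^^ k) F)"
    by (auto simp: compose_def fun_eq_iff)
  then show ?case using compose_closed [OF assms Suc] by (simp only:)
qed

lemma group_triangular: "group U"
proof (rule groupI)
  have mult: "(\<otimes>\<^bsub>U\<^esub>) = compose V" and one: "\<one>\<^bsub>U\<^esub> = (\<lambda>F \<in> V. F)"
    by (simp_all add: triangular_group_def)
  have fn: "g \<in> V \<rightarrow>\<^sub>E V" if "g \<in> carrier U" for g using that by (rule carrierD)
  show "g \<otimes>\<^bsub>U\<^esub> h \<in> carrier U" if "g \<in> carrier U" "h \<in> carrier U" for g h
    using compose_closed that mult by simp
  show "\<one>\<^bsub>U\<^esub> \<in> carrier U" using one_closed one by simp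
  show "g \<otimes>\<^bsub>U\<^esub> h \<otimes>\<^bsub>U\<^esub> k = g \<otimes>\<^bsub>U\<^esub> (h \<otimes>\<^bsub>U\<^esub> k)"
    if "g \<in> carrier U" "h \<in> carrier U" "k \<in> carrier U" for g h k
    using compose_assoc [of k V V g h] fn [OF that(3)] by (simp add: mult PiE_def)
  show "\<one>\<^bsub>U\<^esub> \<otimes>\<^bsub>U\<^esub> g = g" if "g \<in> carrier U" for g
    using fn [OF that] by (auto simp: mult one compose_def fun_eq_iff PiE_def extensional_def)
  show "\<exists>h \<in> carrier U. h \<otimes>\<^bsub>U\<^esub> g = \<one>\<^bsub>U\<^esub>" if g: "g \<in> carrier U" for g
  proof -
    from g obtain \<pi> where \<pi>: "g \<in> V \<rightarrow>\<^sub>E V" "\<pi> \<in> \<Theta>" "triangular p D rk \<pi> g" by (rule carrierD)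
    \<comment> \<open>The inverse is a power of \<open>g\<close>, and powers stay in the
      carrier.\<close>
    define k where "k = p ^ (m + B) - 1"
    have k: "Suc k = p ^ (m + B)" using p by (simp add: k_def prime_gt_0_nat)
    have "(g ^^ k) (g F) = F" if "F \<in> V" for F
      using funpow_eq_one [OF _ \<pi>(3,2) that] \<pi>(1) k by (metis PiE_def IntD1 funpow_simps_right(2) o_apply)
    then have "compose V (\<lambda>F \<in> V. (g ^^ k) F) g = (\<lambda>F \<in> V. F)"
      using \<pi>(1) by (auto simp: compose_def fun_eq_iff)
    then show ?thesis using restrict_funpow_closed [OF g, of k] mult one by metis
  qed
qed

lemma finite_carrier: "finite (carrier U)"
proof -
  have "finite V" unfolding vectors_def using D by (intro finite_PiE) auto
  then have "finite (V \<rightarrow>\<^sub>E V)" by (intro finite_PiE) auto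
  then show ?thesis by (rule rev_finite_subset) (auto elim: carrierD)
qed

lemma pow_eq_one:
  assumes g: "g \<in> carrier U"
  shows "g [^]\<^bsub>U\<^esub> (p ^ (m + B)) = \<one>\<^bsub>U\<^esub>"
proof -
  interpret group U by (rule group_triangular)
  from g obtain \<pi> where \<pi>: "g \<in> V \<rightarrow>\<^sub>E V" "\<pi> \<in> \<Theta>" "triangular p D rk \<pi> g" by (rule carrierD)
  have mult: "(\<otimes>\<^bsub>U\<^esub>) = compose V" by (simp add: triangular_group_def)
  have pow: "g [^]\<^bsub>U\<^esub> k = (\<lambda>F \<in> V. (g ^^ k) F)" for k :: nat
  proof (induction k)
    case 0
    then show ?case by (simp add: triangular_group_def)
  next
    case (Suc k)
    have "g [^]\<^bsub>U\<^esub> Suc k = compose V (\<lambda>F \<in> V. (g ^^ k) F) g"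
      by (simp only: nat_pow_Suc mult Suc)
    then show ?case using \<pi>(1) by (auto simp: compose_def fun_eq_iff funpow_swap1)
  qed
  have "(g ^^ (p ^ (m + B))) F = F" if "F \<in> V" for F
    using funpow_eq_one [OF _ \<pi>(3,2) that] \<pi>(1) by auto
  then show ?thesis by (simp only: pow) (simp add: triangular_group_def fun_eq_iff)
qed

end

section \<open>Finite groups of \<open>p\<close>-power exponent\<close>

lemma prime_powerI:
  fixes n p :: nat
  assumes "n \<noteq> 0" "\<And>r. prime r \<Longrightarrow> r dvd n \<Longrightarrow> r = p"
  shows "\<exists>k. n = p ^ k"
  using assms
proof (induction n rule: less_induct)
  case (less n)
  show ?case
  proof (cases "n = 1")
    case True
    then show ?thesis by (intro exI [of _ 0]) simp
  next
    case False
    then obtain r where r: "prime r" "r dvd n" by (metis prime_factor_nat)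
    have "r = p" using less.prems(2) r by blast
    then obtain m where m: "n = p * m" and p: "prime p" using r by (auto simp: dvd_def)
    have "m < n" using m less.prems(1) prime_gt_1_nat [OF p] by simp
    moreover have "\<And>r. prime r \<Longrightarrow> r dvd m \<Longrightarrow> r = p" using less.prems(2) m dvd_mult by blast
    moreover have "m \<noteq> 0" using less.prems(1) m by simp
    ultimately obtain k where "m = p ^ k" using less.IH [of m] by blast
    then show ?thesis using m by (intro exI [of _ "Suc k"]) simp
  qed
qed

text \<open>Cauchy's theorem, drawn from Sylow's: a prime \<open>r\<close> dividing the order yields
  \<open>x \<noteq> \<one>\<close> with \<open>r\<close>-th power \<open>\<one>\<close>. The order
  of \<open>x\<close> divides both \<open>r\<close> and \<open>p ^ M\<close>, so
  \<open>r = p\<close>.\<close>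

lemma finite_p_groupI:
  assumes p: "prime p" and G: "group G" "finite (carrier G)"
    and pow: "\<And>g. g \<in> carrier G \<Longrightarrow> g [^]\<^bsub>G\<^esub> (p ^ M) = \<one>\<^bsub>G\<^esub>"
  shows "finite_p_group p G"
proof -
  interpret group G by fact
  have "r = p" if r: "prime r" "r dvd order G" for r :: nat
  proof -
    obtain m where m: "order G = r ^ 1 * m" using r(2) by (auto simp: dvd_def)
    obtain H where H: "subgroup H G" "card H = r ^ 1" using sylow_thm [OF r(1) G(1) m G(2)] by blast
    then have "H \<noteq> {\<one>\<^bsub>G\<^esub>}" using prime_gt_1_nat [OF r(1)] by auto
    then obtain x where x: "x \<in> H" "x \<noteq> \<one>\<^bsub>G\<^esub>" using subgroup.one_closed [OF H(1)] by blast
    interpret H: group "G\<lparr>carrier := H\<rparr>" by (rule subgroup.subgroup_is_group [OF H(1) G(1)])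
    have "x [^]\<^bsub>G\<lparr>carrier := H\<rparr>\<^esub> order (G\<lparr>carrier := H\<rparr>) = \<one>\<^bsub>G\<lparr>carrier := H\<rparr>\<^esub>"
      by (rule H.pow_order_eq_1) (simp add: x)
    then have 1: "x [^]\<^bsub>G\<^esub> r = \<one>\<^bsub>G\<^esub>" using H(2) by (simp add: order_def nat_pow_consistent [symmetric])
    have xG: "x \<in> carrier G" using x H(1) by (auto dest: subgroup.subset)
    have "ord x dvd r" "ord x dvd p ^ M" using 1 pow [OF xG] xG by (simp_all add: pow_eq_id)
    moreover have "ord x \<noteq> 1" using x(2) xG ord_eq_1 by blast
    ultimately have "r dvd p ^ M" using r(1) by (metis prime_nat_iff)
    then show "r = p" using p r(1) by (metis prime_dvd_power primes_dvd_imp_eq)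
  qed
  moreover have "order G \<noteq> 0" using G order_gt_0_iff_finite by simp
  ultimately have "\<exists>k. order G = p ^ k" by (intro prime_powerI) auto
  then show ?thesis using G by (simp add: finite_p_group_def)
qed

lemma (in triangular_setup) finite_p_group_triangular: "finite_p_group p U"
  using finite_p_groupI [OF p group_triangular finite_carrier pow_eq_one] .

section \<open>Stable letters commuting with subgroups\<close>

type_synonym 'e site = "'e \<times> (nat \<times> 'e) list"

text \<open>Each letter carries the group element after it; an element before the first letter stays
  outside the word. \<open>True\<close> marks an inverse letter.\<close>

fun stable_val :: "('u, 'z) monoid_scheme \<Rightarrow> ('e \<Rightarrow> 'u) \<Rightarrow> (nat \<Rightarrow> 'u) \<Rightarrow> (nat \<times> bool \<times> 'e) list \<Rightarrow> 'u" where
  "stable_val U \<rho> u [] = \<one>\<^bsub>U\<^esub>"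
| "stable_val U \<rho> u ((i, b, x) # w) =
     (if b then inv\<^bsub>U\<^esub> u i else u i) \<otimes>\<^bsub>U\<^esub> (\<rho> x \<otimes>\<^bsub>U\<^esub> stable_val U \<rho> u w)"

definition letters :: "(nat \<times> bool \<times> 'e) list \<Rightarrow> (nat \<times> 'e) list" where
  "letters w = map (\<lambda>(i, b, x). (i, x)) w"

lemma letters_simps [simp]:
  "letters [] = []" "letters ((i, b, x) # w) = (i, x) # letters w"
  "letters (v @ w) = letters v @ letters w" "length (letters w) = length w"
  by (simp_all add: letters_def)

text \<open>Signs are dropped, so this is stricter than Britton's condition: \<open>t x t\<close>
  with \<open>x\<close> in \<open>K i\<close> is excluded as well. On such lists the same operator
  cannot act twice in succession, see \<open>signed_stab_apply\<close>.\<close>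

definition reduced_letters :: "(nat \<Rightarrow> 'e set) \<Rightarrow> (nat \<times> 'e) list \<Rightarrow> bool" where
  "reduced_letters K = successively (\<lambda>(i, x) (j, y). i = j \<longrightarrow> x \<notin> K i)"

definition admissible_word :: "'e monoid \<Rightarrow> nat \<Rightarrow> (nat \<times> bool \<times> 'e) list \<Rightarrow> bool" where
  "admissible_word E N w \<longleftrightarrow> (\<forall>(i, b, x) \<in> set w. i < N \<and> x \<in> carrier E)"

locale stable_letters =
  fixes p :: nat and E :: "'e monoid" (structure) and K :: "nat \<Rightarrow> 'e set" and N :: nat
  assumes p: "prime p" and E: "finite_p_group p E" and K: "\<And>i. subgroup (K i) E"
begin

sublocale E: group E using E by (simp add: finite_p_group_def)

definition dom :: "nat \<Rightarrow> 'e site set" where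
  "dom L = carrier E \<times> {r. set r \<subseteq> {..<N} \<times> carrier E \<and> length r \<le> L}"

definition rk :: "'e site \<Rightarrow> nat" where
  "rk d = length (snd d)"

definition perms :: "('e site \<Rightarrow> 'e site) set" where
  "perms = (\<lambda>e d. (inv e \<otimes> fst d, snd d)) ` carrier E"

abbreviation translate :: "'e \<Rightarrow> 'e site \<Rightarrow> 'e site" where
  "translate e \<equiv> (\<lambda>d. (inv e \<otimes> fst d, snd d))"

abbreviation "V L \<equiv> vectors p (dom L)"
abbreviation "T L \<equiv> triangular_group p (dom L) rk perms"

text \<open>Vectors are indexed by sites: \<open>(x\<^sub>0, [(i\<^sub>1, x\<^sub>1), \<dots>, (i\<^sub>k, x\<^sub>k)])\<close> is the basis element
  \<open>x\<^sub>0 t\<^bsub>i\<^sub>1\<^esub> x\<^sub>1 \<cdots> t\<^bsub>i\<^sub>k\<^esub> x\<^sub>k\<close>. The operator \<open>t\<^sub>i\<close> maps \<open>y\<cdot>r\<close> to the sum of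
  \<open>c t\<^sub>i (c\<inverse> y)\<cdot>r\<close> over \<open>c \<in> K i\<close>, which makes it commute with \<open>K i\<close>; \<open>shift i\<close> is \<open>t\<^sub>i\<close> in
  coordinates.\<close>

definition shift :: "nat \<Rightarrow> ('e site \<Rightarrow> int) \<Rightarrow> 'e site \<Rightarrow> int" where
  "shift i F d = (case snd d of [] \<Rightarrow> 0
     | (j, y) # r \<Rightarrow> if j = i \<and> fst d \<in> K i then F (fst d \<otimes> y, r) else 0)"

definition rho :: "nat \<Rightarrow> 'e \<Rightarrow> ('e site \<Rightarrow> int) \<Rightarrow> 'e site \<Rightarrow> int" where
  "rho L e = (\<lambda>F \<in> V L. \<lambda>d \<in> dom L. F (inv e \<otimes> fst d, snd d))"

definition stab :: "nat \<Rightarrow> nat \<Rightarrow> ('e site \<Rightarrow> int) \<Rightarrow> 'e site \<Rightarrow> int" where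
  "stab L i = (\<lambda>F \<in> V L. \<lambda>d \<in> dom L. (F d + shift i F d) mod int p)"

lemma K_subset: "K i \<subseteq> carrier E"
  using K by (rule subgroup.subset)

text \<open>Translations have order dividing the order of \<open>E\<close>, a power of
  \<open>p\<close>. Lengths run from 0 to \<open>L\<close>, which gives the rank bound
  \<open>Suc L\<close>.\<close>

lemma triangular_setup_dom: "\<exists>m. triangular_setup p (dom L) rk perms (Suc L) m"
proof -
  obtain m where m: "order E = p ^ m" using E by (auto simp: finite_p_group_def)
  have funpow: "((translate e) ^^ k) d = (inv e [^] k \<otimes> fst d, snd d)"
    if "e \<in> carrier E" "fst d \<in> carrier E" for e k and d :: "'e site"
  proof (induction k)
    case (Suc k)
    have "inv e \<otimes> (inv e [^] k \<otimes> fst d) = inv e [^] Suc k \<otimes> fst d"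
      using that E.nat_pow_Suc2 [of "inv e" k] by (simp add: E.m_assoc [symmetric])
    with Suc show ?case by simp
  qed (use that in simp)
  have "triangular_setup p (dom L) rk perms (Suc L) m"
  proof
    have "finite {r. set r \<subseteq> {..<N} \<times> carrier E \<and> length r \<le> L}"
      using E by (intro finite_lists_length_le) (auto simp: finite_p_group_def)
    then show "finite (dom L)" using E by (auto simp: dom_def finite_p_group_def)
    show "\<exists>\<pi> \<in> perms. \<forall>d \<in> dom L. \<pi> d = d"
      unfolding perms_def by (rule bexI [OF _ imageI [OF E.one_closed]]) (auto simp: dom_def)
    show "\<exists>\<pi>'' \<in> perms. \<forall>d \<in> dom L. \<pi>'' d = \<pi>' (\<pi> d)" if "\<pi> \<in> perms" "\<pi>' \<in> perms" for \<pi> \<pi>'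
    proof -
      from that obtain a b where ab: "a \<in> carrier E" "b \<in> carrier E"
        and "\<pi> = translate a" "\<pi>' = translate b"
        by (auto simp: perms_def)
      then show ?thesis unfolding perms_def
        by (intro bexI [OF _ imageI [of "a \<otimes> b"]])
          (auto simp: dom_def E.inv_mult_group E.m_assoc)
    qed
    show "(\<pi> ^^ (p ^ m)) d = d" if "\<pi> \<in> perms" "d \<in> dom L" for \<pi> d
      using that m E.pow_order_eq_1 by (force simp: perms_def dom_def funpow)
  qed (use p in \<open>auto simp: dom_def rk_def perms_def\<close>)
  then show ?thesis ..
qed

lemma finite_p_group_T: "finite_p_group p (T L)"
  using triangular_setup_dom triangular_setup.finite_p_group_triangular by blast

lemma group_T: "group (T L)"
  using finite_p_group_T by (simp add: finite_p_group_def)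

sublocale T: group "T L" for L
  by (rule group_T)

lemma mult_apply: "F \<in> V L \<Longrightarrow> (g \<otimes>\<^bsub>T L\<^esub> h) F = g (h F)"
  by (simp add: triangular_group_def compose_eq)

lemma carrier_apply: "g \<in> carrier (T L) \<Longrightarrow> F \<in> V L \<Longrightarrow> g F \<in> V L"
  by (auto simp: triangular_group_def)

lemma one_apply: "F \<in> V L \<Longrightarrow> \<one>\<^bsub>T L\<^esub> F = F"
  by (simp add: triangular_group_def)

lemma T_eqI:
  assumes "g \<in> carrier (T L)" "h \<in> carrier (T L)"
    and "\<And>F d. F \<in> V L \<Longrightarrow> d \<in> dom L \<Longrightarrow> g F d = h F d"
  shows "g = h"
proof (rule extensionalityI)
  show "g \<in> extensional (V L)" "h \<in> extensional (V L)"
    using assms(1,2) by (auto simp: triangular_group_def PiE_def)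
  show "g F = h F" if "F \<in> V L" for F
    using carrier_apply [OF assms(1) that] carrier_apply [OF assms(2) that] assms(3) [OF that]
    by (intro vectors_eqI) auto
qed

lemma rho_closed: assumes e: "e \<in> carrier E" shows "rho L e \<in> carrier (T L)"
proof -
  have "rho L e \<in> V L \<rightarrow>\<^sub>E V L"
    using e by (auto simp: rho_def vectors_def dom_def PiE_def Pi_iff)
  moreover have "triangular p (dom L) rk (translate e) (rho L e)"
    by (simp add: triangular_def rho_def)
  ultimately show ?thesis using e by (auto simp: triangular_group_def perms_def)
qed

lemma shift_dom:
  assumes "(x, (j, y) # r) \<in> dom L"
  shows "(x \<otimes> y, r) \<in> dom L"
  using assms by (auto simp: dom_def)

text \<open>\<open>shift i F d\<close> reads \<open>F\<close> at a site whose list is shorter by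
  one, so the increment depends on lower ranks only.\<close>

lemma stab_closed: "stab L i \<in> carrier (T L)"
proof -
  have "stab L i \<in> V L \<rightarrow>\<^sub>E V L"
    using prime_gt_0_nat [OF p] by (auto simp: stab_def vectors_def)
  moreover have "triangular p (dom L) rk (translate \<one>) (stab L i)"
    unfolding triangular_def
  proof (intro ballI impI)
    fix d F F' assume d: "d \<in> dom L" and F: "F \<in> V L" "F' \<in> V L"
      and eq: "\<forall>d' \<in> dom L. rk d' < rk d \<longrightarrow> F d' = F' d'"
    have s: "shift i F d = shift i F' d"
    proof (cases "snd d")
      case (Cons a r)
      obtain j y where a: "a = (j, y)" by force
      have "(fst d, (j, y) # r) \<in> dom L" using d Cons a by (metis prod.collapse)
      then have "(fst d \<otimes> y, r) \<in> dom L" by (rule shift_dom)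
      then show ?thesis using eq Cons a by (simp add: shift_def rk_def)
    qed (simp add: shift_def)
    have "int p dvd (F'' d + shift i F d) mod int p - (F'' d + shift i F d)" for F''
      by (simp add: mod_eq_dvd_iff [symmetric])
    from dvd_diff [OF this [of F] this [of F']] d F s
    show "int p dvd (stab L i F d - F (inv \<one> \<otimes> fst d, snd d)) - (stab L i F' d - F' (inv \<one> \<otimes> fst d, snd d))"
      by (auto simp: stab_def dom_def algebra_simps)
  qed
  ultimately show ?thesis
    unfolding triangular_group_def perms_def
    by (simp only: partial_object.simps mem_Collect_eq) (blast intro: E.one_closed)
qed

lemma rho_hom: "rho L \<in> hom E (T L)"
proof (rule homI)
  fix a b assume ab: "a \<in> carrier E" "b \<in> carrier E"
  show "rho L (a \<otimes> b) = rho L a \<otimes>\<^bsub>T L\<^esub> rho L b"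
  proof (rule T_eqI)
    fix F d assume F: "F \<in> V L" and d: "d \<in> dom L"
    have "(inv a \<otimes> fst d, snd d) \<in> dom L" using ab d by (auto simp: dom_def)
    moreover have "rho L b F \<in> V L" using carrier_apply rho_closed ab F by blast
    ultimately show "rho L (a \<otimes> b) F d = (rho L a \<otimes>\<^bsub>T L\<^esub> rho L b) F d"
      using F d ab by (simp add: mult_apply rho_def) (auto simp: dom_def E.inv_mult_group E.m_assoc)
  qed (use ab rho_closed in auto)
qed (rule rho_closed)

text \<open>Left translation by \<open>k\<close> preserves membership in \<open>K i\<close> and
  carries the product \<open>fst d \<otimes> y\<close> along. This is the effect of summing over all
  of \<open>K i\<close> in the operator.\<close>

lemma stab_commute:
  assumes k: "k \<in> K i"
  shows "stab L i \<otimes>\<^bsub>T L\<^esub> rho L k = rho L k \<otimes>\<^bsub>T L\<^esub> stab L i"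
proof (rule T_eqI)
  have kE: "k \<in> carrier E" using k K_subset by blast
  show "stab L i \<otimes>\<^bsub>T L\<^esub> rho L k \<in> carrier (T L)" "rho L k \<otimes>\<^bsub>T L\<^esub> stab L i \<in> carrier (T L)"
    using stab_closed rho_closed [OF kE] by auto
  fix F d assume F: "F \<in> V L" and d: "d \<in> dom L"
  have rF: "rho L k F \<in> V L" "stab L i F \<in> V L"
    using carrier_apply rho_closed kE stab_closed F by blast+
  have d': "(inv k \<otimes> fst d, snd d) \<in> dom L" using kE d by (auto simp: dom_def)
  have "inv k \<otimes> fst d \<in> K i \<longleftrightarrow> fst d \<in> K i"
  proof
    assume "inv k \<otimes> fst d \<in> K i"
    then have "k \<otimes> (inv k \<otimes> fst d) \<in> K i" by (rule subgroup.m_closed [OF K k])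
    then show "fst d \<in> K i" using kE d by (auto simp: dom_def E.m_assoc [symmetric])
  qed (use k K in \<open>auto intro: subgroup.m_closed subgroup.m_inv_closed\<close>)
  then have "shift i (rho L k F) d = shift i F (inv k \<otimes> fst d, snd d)"
    using d kE shift_dom F
    by (auto simp: shift_def rho_def split: list.splits) (auto simp: dom_def E.m_assoc)
  then show "(stab L i \<otimes>\<^bsub>T L\<^esub> rho L k) F d = (rho L k \<otimes>\<^bsub>T L\<^esub> stab L i) F d"
    using F rF d d' by (simp add: mult_apply) (simp add: rho_def stab_def)
qed

text \<open>Along a reduced list the operator \<open>t\<close> of index \<open>i\<close> cannot act
  twice in succession, so the inverse of \<open>1 + t\<close> agrees with \<open>1 - t\<close> at
  these coordinates.\<close>

lemma signed_stab_apply: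
  assumes F: "F \<in> V L" and d: "(y, (j, x) # r) \<in> dom L" and r: "reduced_letters K ((j, x) # r)"
  shows "int p dvd (if b then inv\<^bsub>T L\<^esub> stab L i else stab L i) F (y, (j, x) # r) -
    (F (y, (j, x) # r) + (if b then - 1 else 1) * (if j = i \<and> y \<in> K i then F (y \<otimes> x, r) else 0))"
proof -
  have st: "int p dvd stab L i F d - (F d + shift i F d)" if "F \<in> V L" "d \<in> dom L" for F d
    using that by (simp add: stab_def mod_eq_dvd_iff [symmetric])
  show ?thesis
  proof (cases b)
    case False
    have "shift i F (y, (j, x) # r) = (if j = i \<and> y \<in> K i then F (y \<otimes> x, r) else 0)"
      by (simp add: shift_def)
    from st [OF F d, unfolded this] have "int p dvd stab L i F (y, (j, x) # r) -
        (F (y, (j, x) # r) + 1 * (if j = i \<and> y \<in> K i then F (y \<otimes> x, r) else 0))"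
      unfolding mult_1 .
    then show ?thesis unfolding if_not_P [OF False] .
  next
    case True
    define G where "G = (inv\<^bsub>T L\<^esub> stab L i) F"
    have G: "G \<in> V L" unfolding G_def by (rule carrier_apply [OF T.inv_closed [OF stab_closed] F])
    have "stab L i G = (stab L i \<otimes>\<^bsub>T L\<^esub> inv\<^bsub>T L\<^esub> stab L i) F"
      using F by (simp add: mult_apply G_def)
    then have sG: "stab L i G = F" using F by (simp add: T.r_inv stab_closed one_apply)
    have "int p dvd F (y \<otimes> x, r) - G (y \<otimes> x, r)" if ji: "j = i" "y \<in> K i"
    proof -
      \<comment> \<open>A second action needs \<open>y \<otimes> x\<close> in \<open>K i\<close>; as
        \<open>y\<close> is there, so would be \<open>x\<close>, which reducedness of the list
        excludes.\<close>
      have "shift i G (y \<otimes> x, r) = 0"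
      proof (cases r)
        case (Cons a r')
        obtain j' x' where a: "a = (j', x')" by force
        have "\<not> (j' = i \<and> y \<otimes> x \<in> K i)"
        proof
          assume *: "j' = i \<and> y \<otimes> x \<in> K i"
          then have "inv y \<otimes> (y \<otimes> x) \<in> K i"
            using subgroup.m_closed [OF K subgroup.m_inv_closed [OF K ji(2)]] by blast
          moreover have "inv y \<otimes> (y \<otimes> x) = x"
            using d by (auto simp: dom_def E.m_assoc [symmetric])
          ultimately show False using r Cons a * ji by (simp add: reduced_letters_def)
        qed
        note not = this
        show ?thesis
          unfolding shift_def snd_conv fst_conv Cons a list.case prod.case by (rule if_not_P [OF not])
      qed (simp add: shift_def)
      then show ?thesis using st [OF G shift_dom [OF d]] by (simp add: sG)
    qed
    then have 1: "int p dvd (if j = i \<and> y \<in> K i then F (y \<otimes> x, r) else 0) -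
        (if j = i \<and> y \<in> K i then G (y \<otimes> x, r) else 0)" by simp
    have "int p dvd F (y, (j, x) # r) - (G (y, (j, x) # r) + shift i G (y, (j, x) # r))"
      using st [OF G d] by (simp only: sG)
    then have "int p dvd F (y, (j, x) # r) -
        (G (y, (j, x) # r) + (if j = i \<and> y \<in> K i then G (y \<otimes> x, r) else 0))"
      by (simp only: shift_def snd_conv fst_conv list.case prod.case)
    note 2 = dvd_diff [OF 1 this]
    have "c - c' - (f - (g + c')) = g - (f + (- 1) * c)" for c c' f g :: int by simp
    from 2 [unfolded this] show ?thesis unfolding if_P [OF True] G_def .
  qed
qed

text \<open>The unit of the tensor algebra, on which the words act.\<close>

definition base_vector :: "nat \<Rightarrow> 'e site \<Rightarrow> int" where
  "base_vector L = (\<lambda>d \<in> dom L. if d = (\<one>, []) then 1 else 0)"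

lemma base_vector: "base_vector L \<in> V L"
  using prime_gt_1_nat [OF p] by (auto simp: base_vector_def vectors_def)

abbreviation "admissible \<equiv> admissible_word E N"

abbreviation "sval L \<equiv> stable_val (T L) (rho L) (stab L)"

lemma stable_val_closed:
  "admissible w \<Longrightarrow> sval L w \<in> carrier (T L)"
proof (induction w)
  case (Cons a w)
  then show ?case by (cases a) (auto simp: admissible_word_def intro!: T.m_closed T.inv_closed stab_closed rho_closed)
qed (auto simp: group.is_monoid [OF group_T] monoid.one_closed)

lemma rho_apply:
  "F \<in> V L \<Longrightarrow> (y, r) \<in> dom L \<Longrightarrow> rho L e F (y, r) = F (inv e \<otimes> y, r)"
  by (simp add: rho_def)

text \<open>Each letter lengthens a site by at most one; for inverse letters this holds along
  reduced lists, by \<open>signed_stab_apply\<close>. A shorter word therefore does not reach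
  \<open>r\<close>. The translation by \<open>x\<close> is there for the induction, since every
  letter is followed by a group element.\<close>

lemma stable_val_vanishes:
  assumes "admissible w" "x \<in> carrier E" "(y, r) \<in> dom L" "length w < length r" "reduced_letters K r"
  shows "int p dvd rho L x (sval L w (base_vector L)) (y, r)"
  using assms
proof (induction w arbitrary: x y r)
  case Nil
  then have d: "(inv x \<otimes> y, r) \<in> dom L" by (auto simp: dom_def)
  have "rho L x (sval L [] (base_vector L)) (y, r) = base_vector L (inv x \<otimes> y, r)"
    using Nil.prems(3) by (simp add: one_apply base_vector rho_apply)
  also have "\<dots> = 0" using d Nil.prems(4) by (simp add: base_vector_def)
  finally show ?case by simp
next
  case (Cons a w)
  obtain i b x' where a: "a = (i, b, x')" by (cases a)
  obtain j y' r' where r: "r = (j, y') # r'" using Cons.prems by (cases r) auto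
  define g where "g = (if b then inv\<^bsub>T L\<^esub> stab L i else stab L i)"
  define W where "W = sval L w (base_vector L)"
  define F where "F = rho L x' W"
  have w: "admissible w" "x' \<in> carrier E" using Cons.prems(1) a by (auto simp: admissible_word_def)
  have W: "W \<in> V L" unfolding W_def using stable_val_closed [OF w(1)] base_vector carrier_apply by blast
  have F: "F \<in> V L" unfolding F_def using rho_closed [OF w(2)] W carrier_apply by blast
  have g: "g \<in> carrier (T L)" by (simp add: g_def stab_closed)
  have red: "reduced_letters K r'" using Cons.prems(5) r by (cases r') (auto simp: reduced_letters_def)
  define z where "z = inv x \<otimes> y"
  have z: "(z, (j, y') # r') \<in> dom L" using Cons.prems(2,3) r by (auto simp: dom_def z_def)
  have "sval L (a # w) (base_vector L) = g F"
    by (simp add: a g_def F_def W_def mult_apply base_vector)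
  then have eq: "rho L x (sval L (a # w) (base_vector L)) (y, r) = g F (z, (j, y') # r')"
    using Cons.prems(3) carrier_apply [OF g F] by (simp add: rho_apply r z_def)
  have F1: "int p dvd F (z, (j, y') # r')"
    unfolding F_def W_def using Cons.prems(4,5) r z by (intro Cons.IH w) auto
  have F2: "int p dvd F (z \<otimes> y', r')"
    unfolding F_def W_def using Cons.prems(4) r z red by (intro Cons.IH w shift_dom) auto
  have "int p dvd (if j = i \<and> z \<in> K i then F (z \<otimes> y', r') else 0)"
    using F2 by (rule if_split [THEN iffD2, OF conjI, OF impI impI]) simp
  note F3 = dvd_add [OF F1 dvd_mult [OF this, of "if b then - 1 else 1"]]
  have "int p dvd g F (z, (j, y') # r') -
      (F (z, (j, y') # r') + (if b then - 1 else 1) * (if j = i \<and> z \<in> K i then F (z \<otimes> y', r') else 0))"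
    unfolding g_def using Cons.prems(5) r by (intro signed_stab_apply F z) simp
  from dvd_add [OF this F3] have "int p dvd g F (z, (j, y') # r')" by (simp only: diff_add_cancel)
  then show ?case using eq by simp
qed

text \<open>At the site spelled by the word itself every letter has to contribute its
  \<open>t\<close>-part, with coefficient 1 or -1 according to its sign. The product of these signs
  is the entry.\<close>

lemma stable_val_detects:
  assumes "admissible w" "x \<in> carrier E" "length w \<le> L" "reduced_letters K (letters w)"
  shows "\<exists>s \<in> {1, - 1}. int p dvd
    rho L x (sval L w (base_vector L)) (x, letters w) - s"
  using assms
proof (induction w arbitrary: x)
  case Nil
  then have "(x, []) \<in> dom L" "(\<one>, []) \<in> dom L" by (auto simp: dom_def)
  note d = this
  have "rho L x (sval L [] (base_vector L)) (x, letters []) = base_vector L (\<one>, [])"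
    using Nil.prems(2) d by (simp add: one_apply base_vector rho_apply)
  also have "\<dots> = 1" using d by (simp add: base_vector_def)
  finally show ?case by (intro bexI [of _ 1]) simp_all
next
  case (Cons a w)
  obtain i b x' where a: "a = (i, b, x')" by (cases a)
  define g where "g = (if b then inv\<^bsub>T L\<^esub> stab L i else stab L i)"
  define W where "W = sval L w (base_vector L)"
  define F where "F = rho L x' W"
  have w: "admissible w" "x' \<in> carrier E" "i < N" using Cons.prems(1) a by (auto simp: admissible_word_def)
  have lw: "set (letters w) \<subseteq> {..<N} \<times> carrier E"
    using w(1) by (auto simp: admissible_word_def letters_def)
  have W: "W \<in> V L" unfolding W_def using stable_val_closed [OF w(1)] base_vector carrier_apply by blast
  have F: "F \<in> V L" unfolding F_def using rho_closed [OF w(2)] W carrier_apply by blast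
  have g: "g \<in> carrier (T L)" by (simp add: g_def stab_closed)
  have red: "reduced_letters K ((i, x') # letters w)" using Cons.prems(4) a by simp
  then have red': "reduced_letters K (letters w)" by (cases "letters w") (auto simp: reduced_letters_def)
  have d: "(\<one>, (i, x') # letters w) \<in> dom L" "(x, (i, x') # letters w) \<in> dom L"
    using lw w Cons.prems(2,3) by (auto simp: dom_def)
  have "sval L (a # w) (base_vector L) = g F"
    by (simp add: a g_def F_def W_def mult_apply base_vector)
  then have 1: "rho L x (sval L (a # w) (base_vector L)) (x, letters (a # w)) =
      g F (\<one>, (i, x') # letters w)"
    using d(2) carrier_apply [OF g F] Cons.prems(2) by (simp add: rho_apply a)
  \<comment> \<open>The identity part of the first letter contributes nothing: the remaining word is
    too short for this site.\<close>
  have 2: "int p dvd F (\<one>, (i, x') # letters w)"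
    unfolding F_def W_def by (rule stable_val_vanishes [OF w(1,2) d(1) _ red]) simp
  have "length w \<le> L" using Cons.prems(3) by simp
  from Cons.IH [OF w(1,2) this red'] obtain s where s: "s \<in> {1, - 1}" "int p dvd F (x', letters w) - s"
    unfolding F_def W_def by blast
  define t :: int where "t = (if b then - 1 else 1)"
  have "\<one> \<in> K i" using K by (rule subgroup.one_closed)
  then have "int p dvd g F (\<one>, (i, x') # letters w) - (F (\<one>, (i, x') # letters w) + t * F (x', letters w))"
    using signed_stab_apply [OF F d(1) red, of b i] w(2) by (simp add: g_def t_def)
  from dvd_add [OF dvd_add [OF this 2] dvd_mult [OF s(2), of t]]
  have "int p dvd g F (\<one>, (i, x') # letters w) - t * s" by (simp add: algebra_simps)
  moreover have "t * s \<in> {1, - 1}" using s(1) by (auto simp: t_def)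
  ultimately show ?case using 1 by auto
qed

lemma stable_val_product:
  assumes "admissible w"
  shows "stable_val (product_group UNIV T) (\<lambda>e L. rho L e) (\<lambda>i L. stab L i) w =
    (\<lambda>L. sval L w)"
  using assms
proof (induction w)
  case (Cons a w)
  have "(\<lambda>L. stab L i) \<in> (\<Pi>\<^sub>E L \<in> UNIV. carrier (T L))" for i by (auto intro: stab_closed)
  from inv_product_group [OF this group_T]
  have inv: "inv\<^bsub>product_group UNIV T\<^esub> (\<lambda>L. stab L i) = (\<lambda>L. inv\<^bsub>T L\<^esub> stab L i)" for i
    by (simp only: restrict_UNIV)
  obtain i b x where a: "a = (i, b, x)" by (cases a)
  have "admissible w" using Cons.prems by (simp add: admissible_word_def)
  note IH = Cons.IH [OF this]
  show ?case
    by (cases b) (simp_all only: a stable_val.simps IH mult_product_group restrict_UNIV inv if_True if_False)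
qed (simp add: fun_eq_iff)

text \<open>A word of length \<open>L\<close> is detected in the truncation \<open>T L\<close>, so
  the product over all \<open>L\<close> detects every word. The existential statement hides the
  vectors from what follows.\<close>

lemma stable_group_exists:
  "\<exists>(U :: (nat \<Rightarrow> ('e site \<Rightarrow> int) \<Rightarrow> ('e site \<Rightarrow> int)) monoid) \<rho> u.
     group U \<and> residually_p_finite p U \<and> \<rho> \<in> hom E U \<and> (\<forall>i. u i \<in> carrier U) \<and>
     (\<forall>i. \<forall>k \<in> K i. u i \<otimes>\<^bsub>U\<^esub> \<rho> k = \<rho> k \<otimes>\<^bsub>U\<^esub> u i) \<and>
     (\<forall>x \<in> carrier E. \<forall>w. admissible w \<longrightarrow> w \<noteq> [] \<longrightarrow> reduced_letters K (letters w) \<longrightarrow>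
        \<rho> x \<otimes>\<^bsub>U\<^esub> stable_val U \<rho> u w \<noteq> \<one>\<^bsub>U\<^esub>)"
proof (intro exI conjI)
  let ?U = "product_group UNIV T" and ?\<rho> = "\<lambda>e L. rho L e" and ?u = "\<lambda>i L. stab L i"
  show "group ?U" by (simp add: group_T)
  show "residually_p_finite p ?U" by (intro residually_p_finite_product_group finite_p_group_T)
  show "?\<rho> \<in> hom E ?U" using rho_hom by (auto simp: hom_def fun_eq_iff)
  show "\<forall>i. ?u i \<in> carrier ?U" by (auto intro: stab_closed)
  show "\<forall>i. \<forall>k \<in> K i. ?u i \<otimes>\<^bsub>?U\<^esub> ?\<rho> k = ?\<rho> k \<otimes>\<^bsub>?U\<^esub> ?u i"
    by (simp add: stab_commute)
  show "\<forall>x \<in> carrier E. \<forall>w. admissible w \<longrightarrow> w \<noteq> [] \<longrightarrow> reduced_letters K (letters w) \<longrightarrow>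
      ?\<rho> x \<otimes>\<^bsub>?U\<^esub> stable_val ?U ?\<rho> ?u w \<noteq> \<one>\<^bsub>?U\<^esub>"
  proof (intro ballI allI impI notI)
    fix x w assume x: "x \<in> carrier E" and w: "admissible w" "w \<noteq> []" "reduced_letters K (letters w)"
      and eq: "?\<rho> x \<otimes>\<^bsub>?U\<^esub> stable_val ?U ?\<rho> ?u w = \<one>\<^bsub>?U\<^esub>"
    define L where "L = length w"
    have "rho L x \<otimes>\<^bsub>T L\<^esub> sval L w = \<one>\<^bsub>T L\<^esub>"
      using fun_cong [OF eq, of L] by (simp add: stable_val_product [OF w(1)])
    then have "rho L x (sval L w (base_vector L)) = base_vector L"
      by (metis mult_apply one_apply base_vector)
    \<comment> \<open>The identity has entry 0 at a nonempty site, whereas the word has 1 or -1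
      there.\<close>
    moreover have "base_vector L (x, letters w) = 0"
    proof -
      have "set (letters w) \<subseteq> {..<N} \<times> carrier E" using w(1) by (auto simp: admissible_word_def letters_def)
      then have "(x, letters w) \<in> dom L" using x by (auto simp: dom_def L_def)
      then show ?thesis using w(2) by (cases w) (auto simp: base_vector_def)
    qed
    ultimately have "int p dvd 1"
      using stable_val_detects [OF w(1) x _ w(3), of L] by (auto simp: L_def)
    then show False using prime_gt_1_nat [OF p] by auto
  qed
qed

end

section \<open>Alternating products\<close>

fun alt_prod :: "('a, 'z) monoid_scheme \<Rightarrow> ('a \<times> 'a) list \<Rightarrow> 'a" where
  "alt_prod G [] = \<one>\<^bsub>G\<^esub>"
| "alt_prod G ((r, y) # rs) = r \<otimes>\<^bsub>G\<^esub> (y \<otimes>\<^bsub>G\<^esub> alt_prod G rs)"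

text \<open>The last \<open>B\<close>-letter may lie in \<open>C\<close>, and even be
  \<open>\<one>\<close>, so that a product ending in a letter from \<open>A\<close> has this form as
  well.\<close>

fun alternating :: "'a set \<Rightarrow> 'a set \<Rightarrow> 'a set \<Rightarrow> ('a \<times> 'a) list \<Rightarrow> bool" where
  "alternating A B C [] \<longleftrightarrow> True"
| "alternating A B C ((r, y) # rs) \<longleftrightarrow>
     r \<in> A - C \<and> y \<in> B \<and> (rs \<noteq> [] \<longrightarrow> y \<notin> C) \<and> alternating A B C rs"

lemma (in group) alt_prod_closed:
  "alternating A B C rs \<Longrightarrow> A \<subseteq> carrier G \<Longrightarrow> B \<subseteq> carrier G \<Longrightarrow> alt_prod G rs \<in> carrier G"
proof (induction rs)
  case (Cons a rs)
  then show ?case by (cases a) auto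
qed simp

text \<open>The set \<open>X\<close> of such products contains \<open>\<one>\<close> and is closed
  under left multiplication by \<open>A\<close> and by \<open>B\<close>. That a given product is
  nontrivial is seen later, in an image.\<close>

lemma (in group) alternating_form:
  assumes A: "subgroup A G" and B: "subgroup B G" and C: "C \<subseteq> A" "C \<subseteq> B"
    and x: "x \<in> generate G (A \<union> B)"
  shows "\<exists>y \<in> B. \<exists>rs. alternating A B C rs \<and> x = y \<otimes> alt_prod G rs"
proof -
  define X where "X = {y \<otimes> alt_prod G rs | y rs. y \<in> B \<and> alternating A B C rs}"
  have sub: "A \<subseteq> carrier G" "B \<subseteq> carrier G" using A B by (auto dest: subgroup.subset)
  have X: "y \<otimes> alt_prod G rs \<in> X" if "y \<in> B" "alternating A B C rs" for y rs
    using that by (auto simp: X_def)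
  have cl: "alt_prod G rs \<in> carrier G" if "alternating A B C rs" for rs
    using alt_prod_closed [OF that sub] .
  have X_sub: "X \<subseteq> carrier G" using cl sub by (auto simp: X_def)
  have one: "\<one> \<in> B" by (rule subgroup.one_closed [OF B])
  have b: "b \<otimes> w \<in> X" if "b \<in> B" "w \<in> X" for b w
  proof -
    from that(2) obtain y rs where w: "w = y \<otimes> alt_prod G rs" "y \<in> B" "alternating A B C rs"
      by (auto simp: X_def)
    have "b \<otimes> w = (b \<otimes> y) \<otimes> alt_prod G rs"
      using that(1) w cl [OF w(3)] sub by (simp add: m_assoc subset_iff)
    then show ?thesis using X [OF subgroup.m_closed [OF B that(1) w(2)] w(3)] by simp
  qed
  have a: "a \<otimes> w \<in> X" if a: "a \<in> A" and w: "w \<in> X" for a w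
  proof -
    from w obtain y rs where w: "w = y \<otimes> alt_prod G rs" "y \<in> B" "alternating A B C rs"
      by (auto simp: X_def)
    have aG: "a \<in> carrier G" and yG: "y \<in> carrier G" using a w sub by auto
    have p: "alt_prod G rs \<in> carrier G" by (rule cl [OF w(3)])
    show ?thesis
    proof (cases "y \<in> C")
      case True
      have ay: "a \<otimes> y \<in> A" using True C a by (intro subgroup.m_closed [OF A]) auto
      show ?thesis
      proof (cases rs)
        case Nil
        then have aw: "a \<otimes> w = a \<otimes> y" using w aG yG by simp
        show ?thesis
        proof (cases "a \<otimes> y \<in> C")
          case True
          then have "a \<otimes> y \<in> B" using C by blast
          from X [OF this, of "[]"] show ?thesis using aw aG yG by simp
        next
          case False
          \<comment> \<open>With no \<open>A\<close>-letter to merge with, the new pair is padded by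
            \<open>\<one>\<close>, which is allowed as the last \<open>B\<close>-letter.\<close>
          have "a \<otimes> w = \<one> \<otimes> alt_prod G [(a \<otimes> y, \<one>)]" using aw aG yG by simp
          then show ?thesis using X [OF one, of "[(a \<otimes> y, \<one>)]"] ay False one by simp
        qed
      next
        case (Cons ry rs')
        obtain r y' where ry: "ry = (r, y')" by force
        have r: "r \<in> A" "y' \<in> B" "alternating A B C rs'" "rs' \<noteq> [] \<Longrightarrow> y' \<notin> C"
          using w(3) Cons ry by auto
        have G: "r \<in> carrier G" "y' \<in> carrier G" "alt_prod G rs' \<in> carrier G" using r sub cl by auto
        have a': "a \<otimes> y \<otimes> r \<in> A" by (rule subgroup.m_closed [OF A ay r(1)])
        have eq: "a \<otimes> w = (a \<otimes> y \<otimes> r) \<otimes> (y' \<otimes> alt_prod G rs')"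
          using w Cons ry G aG yG by (simp add: m_assoc)
        show ?thesis
        proof (cases "a \<otimes> y \<otimes> r \<in> C")
          \<comment> \<open>The merged letter drops into \<open>C\<close>, hence into
            \<open>B\<close>, and joins the next \<open>B\<close>-letter; the list gets
            shorter.\<close>
          case True
          then have "a \<otimes> y \<otimes> r \<in> B" using C by blast
          then have "(a \<otimes> y \<otimes> r) \<otimes> y' \<in> B" using r(2) by (rule subgroup.m_closed [OF B])
          moreover have "a \<otimes> w = ((a \<otimes> y \<otimes> r) \<otimes> y') \<otimes> alt_prod G rs'"
            using eq G aG yG by (simp add: m_assoc)
          ultimately show ?thesis using X r by metis
        next
          case False
          have "a \<otimes> w = \<one> \<otimes> alt_prod G ((a \<otimes> y \<otimes> r, y') # rs')"
            using eq G aG yG by simp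
          moreover have "alternating A B C ((a \<otimes> y \<otimes> r, y') # rs')" using False a' r by auto
          ultimately show ?thesis using X [OF one] by metis
        qed
      qed
    next
      case False
      show ?thesis
      proof (cases "a \<in> C")
        case True
        then have "a \<in> B" using C by blast
        then show ?thesis using b that(2) by blast
      next
        case aC: False
        have "a \<otimes> w = \<one> \<otimes> alt_prod G ((a, y) # rs)" using w aG yG p by simp
        moreover have "alternating A B C ((a, y) # rs)" using aC False a w by auto
        ultimately show ?thesis using X [OF one] by metis
      qed
    qed
  qed
  have "x \<otimes> w \<in> X" if "w \<in> X" for w
    using x that
  proof (induction arbitrary: w)
    case one
    then show ?case using X_sub by auto
  next
    case (incl h)
    then show ?case using a b by blast
  next
    case (inv h)
    then show ?case using a b subgroup.m_inv_closed [OF A] subgroup.m_inv_closed [OF B] by blast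
  next
    case (eng h1 h2)
    have "h1 \<in> carrier G" "h2 \<in> carrier G"
      using eng.hyps generate_in_carrier sub by (metis Un_least)+
    then have "h1 \<otimes> h2 \<otimes> w = h1 \<otimes> (h2 \<otimes> w)" using eng.prems X_sub by (auto simp: m_assoc)
    then show ?case using eng by simp
  qed
  moreover have "\<one> \<in> X" using X [OF one, of "[]"] by simp
  moreover have "x \<in> carrier G" using x generate_in_carrier sub by (metis Un_least)
  ultimately have "x \<in> X" by force
  then show ?thesis by (auto simp: X_def)
qed

section \<open>Reduced words\<close>

locale reduced_words =
  fixes U :: "'u monoid" (structure) and E :: "'e monoid" and \<rho> :: "'e \<Rightarrow> 'u" and u :: "nat \<Rightarrow> 'u"
    and K :: "nat \<Rightarrow> 'e set" and N :: nat
  assumes U: "group U" and E: "group E" and \<rho>: "\<rho> \<in> hom E U" and u: "\<And>i. u i \<in> carrier U"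
begin

sublocale U: group U by (rule U)
sublocale E: group E by (rule E)
sublocale \<rho>: group_hom E U \<rho>
  using \<rho> by (simp add: group_hom_def group_hom_axioms_def U E)

abbreviation "val \<equiv> stable_val U \<rho> u"

definition reduced :: "(nat \<times> bool \<times> 'e) list \<Rightarrow> bool" where
  "reduced w \<longleftrightarrow> admissible_word E N w \<and> reduced_letters K (letters w)"

lemma val_closed: "admissible_word E N w \<Longrightarrow> val w \<in> carrier U"
proof (induction w)
  case (Cons a w)
  then show ?case by (cases a) (auto simp: admissible_word_def u)
qed simp

lemma admissible_word_append [simp]:
  "admissible_word E N (v @ w) \<longleftrightarrow> admissible_word E N v \<and> admissible_word E N w"
  "admissible_word E N ((i, b, x) # w) \<longleftrightarrow> i < N \<and> x \<in> carrier E \<and> admissible_word E N w"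
  "admissible_word E N []"
  by (simp_all add: admissible_word_def ball_Un)

lemma val_append:
  "admissible_word E N v \<Longrightarrow> admissible_word E N w \<Longrightarrow> val (v @ w) = val v \<otimes> val w"
proof (induction v)
  case (Cons a v)
  then show ?case by (cases a) (auto simp: U.m_assoc u val_closed)
qed (simp add: val_closed)

lemma val_last:
  assumes "admissible_word E N v" "x \<in> carrier E" "y \<in> carrier E" "e < N"
  shows "val (v @ [(e, b, x)]) \<otimes> \<rho> y = val (v @ [(e, b, x \<otimes>\<^bsub>E\<^esub> y)])"
  using assms by (simp add: val_append U.m_assoc u val_closed)

lemma reduced_last: "reduced (v @ [(e, b, x)]) \<Longrightarrow> y \<in> carrier E \<Longrightarrow> reduced (v @ [(e, b, y)])"
  by (auto simp: reduced_def reduced_letters_def successively_append_iff)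

lemma reduced_append:
  assumes "reduced (v @ [(e, b, x)])" "reduced w" "w \<noteq> []" "fst (hd w) = e \<Longrightarrow> x \<notin> K e"
  shows "reduced ((v @ [(e, b, x)]) @ w)"
proof -
  obtain j c z w' where w: "w = (j, c, z) # w'" using assms(3) by (cases w) auto
  show ?thesis using assms
    by (auto simp: w reduced_def reduced_letters_def successively_append_iff)
qed

text \<open>The trailing group element is normalised to \<open>1\<close> so that it can absorb the next factor of an
  alternating product.\<close>

definition red :: "nat \<Rightarrow> 'u set" where
  "red e = {val (v @ [(e, b, \<one>\<^bsub>E\<^esub>)]) | v b.
     reduced (v @ [(e, b, \<one>\<^bsub>E\<^esub>)]) \<and> fst (hd (v @ [(e, b, \<one>\<^bsub>E\<^esub>)])) = e}"

text \<open>Where the word meets the new letter the indices differ, so reducedness holds there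
  whatever \<open>x\<close> and \<open>y\<close> are.\<close>

lemma red_up:
  assumes "reduced (v @ [(e, b, y)])" "e' < N" "x \<in> carrier E"
    and "e' \<noteq> e" "fst (hd (v @ [(e, b, y)])) = e"
  shows "u e' \<otimes> (\<rho> x \<otimes> val (v @ [(e, b, y)])) \<otimes> inv u e' \<in> red e'"
proof -
  let ?w = "v @ [(e, b, y)]"
  have adm: "admissible_word E N ?w" using assms(1) by (simp add: reduced_def)
  have "reduced ([(e', True, \<one>\<^bsub>E\<^esub>)])" "reduced ([] @ [(e', False, x)])"
    using assms by (simp_all add: reduced_def reduced_letters_def)
  then have "reduced ((([] @ [(e', False, x)]) @ ?w) @ [(e', True, \<one>\<^bsub>E\<^esub>)])"
    using reduced_append [of "[]" e' False x ?w] reduced_append [of "(e', False, x) # v" e b y "[(e', True, \<one>\<^bsub>E\<^esub>)]"] assms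
    by simp
  moreover have "u e' \<otimes> (\<rho> x \<otimes> val ?w) \<otimes> inv u e' = val ((e', False, x) # ?w @ [(e', True, \<one>\<^bsub>E\<^esub>)])"
    using adm assms val_closed [OF adm] val_append [of ?w "[(e', True, \<one>\<^bsub>E\<^esub>)]"]
    by (simp add: U.m_assoc u del: append_assoc)
  ultimately show ?thesis
    unfolding red_def by (intro CollectI exI [of _ "(e', False, x) # ?w"] exI [of _ True]) simp
qed

lemma red_base:
  assumes "e < N" "x \<in> carrier E" "x \<notin> K e"
  shows "u e \<otimes> \<rho> x \<otimes> inv u e \<in> red e"
proof -
  have "reduced ([(e, False, x)] @ [(e, True, \<one>\<^bsub>E\<^esub>)])"
    using assms by (simp add: reduced_def reduced_letters_def)
  moreover have "u e \<otimes> \<rho> x \<otimes> inv u e = val ([(e, False, x)] @ [(e, True, \<one>\<^bsub>E\<^esub>)])"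
    using assms by (simp add: U.m_assoc u)
  ultimately show ?thesis unfolding red_def by fastforce
qed

lemma red_red_up:
  assumes "a \<in> red e" "e' < N" "e' \<noteq> e"
  shows "u e' \<otimes> a \<otimes> inv u e' \<in> red e'"
proof -
  from assms(1) obtain v b where v: "a = val (v @ [(e, b, \<one>\<^bsub>E\<^esub>)])" "reduced (v @ [(e, b, \<one>\<^bsub>E\<^esub>)])"
    "fst (hd (v @ [(e, b, \<one>\<^bsub>E\<^esub>)])) = e"
    by (auto simp: red_def)
  have "a \<in> carrier U" using v val_closed by (simp add: reduced_def del: admissible_word_append)
  then show ?thesis using red_up [OF v(2) assms(2) E.one_closed assms(3) v(3)] v(1) by simp
qed

text \<open>At each junction the index \<open>e\<close> meets itself with some \<open>x\<close>
  outside \<open>K e\<close> in between, which is what reducedness asks. The last group element is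
  followed by no letter, hence the \<open>butlast\<close>.\<close>

lemma red_alternating:
  assumes "rs \<noteq> []" "\<And>a x. (a, x) \<in> set rs \<Longrightarrow> a \<in> red e \<and> x \<in> carrier E"
    and "\<And>a x. (a, x) \<in> set (butlast rs) \<Longrightarrow> x \<notin> K e"
  shows "\<exists>v b y. alt_prod U (map (\<lambda>(a, x). (a, \<rho> x)) rs) = val (v @ [(e, b, y)]) \<and>
    reduced (v @ [(e, b, y)]) \<and> fst (hd (v @ [(e, b, y)])) = e"
  using assms
proof (induction rs)
  case (Cons ax rs)
  obtain a x where ax: "ax = (a, x)" by force
  have a: "a \<in> red e" "x \<in> carrier E" using Cons.prems(2) ax by auto
  then obtain v b where v: "a = val (v @ [(e, b, \<one>\<^bsub>E\<^esub>)])" "reduced (v @ [(e, b, \<one>\<^bsub>E\<^esub>)])"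
    "fst (hd (v @ [(e, b, \<one>\<^bsub>E\<^esub>)])) = e"
    by (auto simp: red_def)
  have adm: "admissible_word E N v" "e < N" using v(2) by (auto simp: reduced_def)
  have ax_val: "a \<otimes> \<rho> x = val (v @ [(e, b, x)])"
    unfolding v(1) using val_last [OF adm(1) E.one_closed a(2) adm(2)] a(2) by simp
  have rx: "reduced (v @ [(e, b, x)])" by (rule reduced_last [OF v(2) a(2)])
  have hd: "fst (hd (v @ [(e, b, x)])) = e" using v(3) by (cases v) auto
  have aU: "a \<in> carrier U" using v val_closed by (simp add: reduced_def del: admissible_word_append)
  show ?case
  proof (cases "rs = []")
    case True
    then show ?thesis using ax ax_val rx hd aU a(2) by (auto intro!: exI)
  next
    case False
    then obtain w c y where w: "alt_prod U (map (\<lambda>(a, x). (a, \<rho> x)) rs) = val (w @ [(e, c, y)])"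
      "reduced (w @ [(e, c, y)])" "fst (hd (w @ [(e, c, y)])) = e"
    proof -
      have "a \<in> red e \<and> x \<in> carrier E" if "(a, x) \<in> set rs" for a x
        by (rule Cons.prems(2)) (simp add: that)
      moreover have "x \<notin> K e" if "(a, x) \<in> set (butlast rs)" for a x
        using Cons.prems(3) [of a x] that False by simp
      ultimately show thesis using Cons.IH [OF False] that by blast
    qed
    have "x \<notin> K e" using Cons.prems(3) [of a x] False ax by simp
    then have "reduced ((v @ [(e, b, x)]) @ w @ [(e, c, y)])"
      using reduced_append [OF rx w(2)] by simp
    moreover have "alt_prod U (map (\<lambda>(a, x). (a, \<rho> x)) (ax # rs)) = val ((v @ [(e, b, x)]) @ w @ [(e, c, y)])"
    proof -
      have adm_w: "admissible_word E N (w @ [(e, c, y)])" using w(2) by (simp only: reduced_def)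
      have adm_v: "admissible_word E N (v @ [(e, b, x)])" using rx by (simp only: reduced_def)
      have "alt_prod U (map (\<lambda>(a, x). (a, \<rho> x)) (ax # rs)) = a \<otimes> \<rho> x \<otimes> val (w @ [(e, c, y)])"
        using val_closed [OF adm_w] aU a(2) by (simp add: ax w(1) U.m_assoc)
      then show ?thesis using val_append [OF adm_v adm_w] by (simp only: ax_val)
    qed
    moreover have "fst (hd ((v @ [(e, b, x)]) @ w @ [(e, c, y)])) = e" using hd by (cases v) auto
    ultimately show ?thesis
      by (intro exI [of _ "(v @ [(e, b, x)]) @ w"] exI [of _ c] exI [of _ y]) simp
  qed
qed simp

end

section \<open>Residual finiteness of the tree product\<close>

text \<open>\<open>H_L\<close> and \<open>L_L\<close> say that \<open>L i\<close> meets
  \<open>H\<close>, and also the next edge group, only in a part already glued to \<open>H\<close>.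
  In \<open>Phi_reduced\<close> this keeps factors outside the last edge group.\<close>

locale residual_datum = tree_datum E H P L D SH SP
  for E :: "'e monoid" and H P L D SH SP +
  fixes p :: nat
  assumes p: "prime p" and residual: "residually_p_finite p E"
    and finite_P: "\<And>i. finite (P i)"
    and H_L: "\<And>i. H \<inter> L i \<subseteq> D i"
    and L_L: "\<And>i. L i \<inter> L (Suc i) \<subseteq> D (Suc i)"
begin

section \<open>Alternating forms over the chain and \<open>H\<close>\<close>

definition chain :: "nat \<Rightarrow> nat set" where
  "chain n = generate tree_group (\<Union>i \<in> {..n}. inc (Suc i) ` P i)"

lemma chain_gens: "(\<Union>i \<in> {..n}. inc (Suc i) ` P i) \<subseteq> carrier tree_group"
  using inc_closed [of _ "Suc _"] by auto

lemma subgroup_chain: "subgroup (chain n) tree_group"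
  unfolding chain_def by (rule G.generate_is_subgroup [OF chain_gens])

lemma chain_mono: "m \<le> n \<Longrightarrow> chain m \<subseteq> chain n"
  unfolding chain_def by (intro G.mono_generate UN_mono) auto

lemma inc_chain: "x \<in> P n \<Longrightarrow> inc (Suc n) x \<in> chain n"
  unfolding chain_def by (auto intro: generate.incl)

lemma chain_0: "chain 0 = inc 1 ` P 0"
proof -
  have s: "subgroup (inc 1 ` P 0) tree_group" using inc_subgroup [OF subgroups(2), of 0 1] by simp
  have "chain 0 = generate tree_group (inc 1 ` P 0)" by (simp add: chain_def)
  also have "\<dots> = inc 1 ` P 0"
    using G.generate_subset_subgroup [OF s order_refl] by (auto intro: generate.incl)
  finally show ?thesis .
qed

lemma subgroup_inc_P: "subgroup (inc (Suc n) ` P n) tree_group"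
  using inc_subgroup [OF subgroups(2), of n "Suc n"] by simp

lemma chain_Suc: "chain (Suc n) \<subseteq> generate tree_group (chain n \<union> inc (Suc (Suc n)) ` P (Suc n))"
proof -
  have "inc (Suc i) x \<in> chain n \<union> inc (Suc (Suc n)) ` P (Suc n)" if "i \<le> Suc n" "x \<in> P i" for i x
    using that inc_chain [of x i] chain_mono [of i n] by (cases "i = Suc n") auto
  then have "(\<Union>i \<in> {..Suc n}. inc (Suc i) ` P i) \<subseteq> chain n \<union> inc (Suc (Suc n)) ` P (Suc n)"
    by blast
  then show ?thesis unfolding chain_def [of "Suc n"] by (rule G.mono_generate)
qed

definition Q :: "'e set" where
  "Q = (\<Union>i. D i)"

lemma Q_H: "Q \<subseteq> H"
  using D_H by (auto simp: Q_def)

lemma inc_Q_chain: "inc 0 ` Q \<subseteq> (\<Union>n. chain n)"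
proof
  fix g assume "g \<in> inc 0 ` Q"
  then obtain i x where x: "x \<in> D i" "g = inc 0 x" by (auto simp: Q_def)
  then have "g = inc (Suc i) x" "x \<in> P i" using inc_D [OF x(1)] D_L [of i] L_P(1) [of i] by auto
  then show "g \<in> (\<Union>n. chain n)" using inc_chain by blast
qed

lemma subgroup_Union_chain: "subgroup (\<Union>n. chain n) tree_group"
proof (rule G.subgroupI)
  show "(\<Union>n. chain n) \<subseteq> carrier tree_group" using subgroup.subset [OF subgroup_chain] by blast
  show "(\<Union>n. chain n) \<noteq> {}" using subgroup.one_closed [OF subgroup_chain] by blast
  show "inv\<^bsub>tree_group\<^esub> a \<in> (\<Union>n. chain n)" if "a \<in> (\<Union>n. chain n)" for a
    using that subgroup.m_inv_closed [OF subgroup_chain] by blast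
  fix a b assume "a \<in> (\<Union>n. chain n)" "b \<in> (\<Union>n. chain n)"
  then obtain m n where "a \<in> chain m" "b \<in> chain n" by blast
  then have "a \<in> chain (max m n)" "b \<in> chain (max m n)" using chain_mono by (meson max.cobounded1 max.cobounded2 subsetD)+
  then show "a \<otimes>\<^bsub>tree_group\<^esub> b \<in> (\<Union>n. chain n)" using subgroup.m_closed [OF subgroup_chain] by blast
qed

text \<open>The tree product is generated by the union of the chain and by \<open>H\<close>, which
  share the image of \<open>Q\<close>.\<close>

lemma carrier_alternating:
  assumes "g \<in> carrier tree_group"
  shows "\<exists>h \<in> H. \<exists>rs. alternating (\<Union>n. chain n) (inc 0 ` H) (inc 0 ` Q) rs \<and>
    g = inc 0 h \<otimes>\<^bsub>tree_group\<^esub> alt_prod tree_group rs"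
proof -
  have sH: "subgroup (inc 0 ` H) tree_group" using inc_subgroup [OF subgroups(1), of 0] by simp
  let ?A = "(\<Union>n. chain n) \<union> inc 0 ` H"
  have "inc v x \<in> ?A" if "x \<in> vg v" for v x
    using that inc_chain by (cases v) auto
  then have "(\<Union>v. inc v ` vg v) \<subseteq> ?A" by blast
  then have "carrier tree_group \<subseteq> generate tree_group ?A"
    using G.mono_generate generate_tree_group by metis
  then have "g \<in> generate tree_group ?A" using assms by blast
  from G.alternating_form [OF subgroup_Union_chain sH inc_Q_chain image_mono [OF Q_H] this]
  show ?thesis by blast
qed

lemma alternating_mono: "alternating A B C rs \<Longrightarrow> A \<subseteq> A' \<Longrightarrow> alternating A' B C rs"
proof (induction rs)
  case (Cons a rs)
  then show ?case by (cases a) auto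
qed simp

lemma finite_alternating_chain:
  "alternating (\<Union>n. chain n) B C rs \<Longrightarrow> \<exists>n. alternating (chain n) B C rs"
proof (induction rs)
  case (Cons ry rs)
  obtain r y where ry: "ry = (r, y)" by force
  from Cons obtain n where n: "alternating (chain n) B C rs" using ry by auto
  from Cons.prems ry obtain m where m: "r \<in> chain m" by auto
  have "alternating (chain (max m n)) B C rs"
    by (rule alternating_mono [OF n chain_mono]) simp
  then show ?case using Cons.prems ry m chain_mono [of m "max m n"] by (intro exI [of _ "max m n"]) auto
qed simp

end

text \<open>\<open>\<pi>\<close> reduces \<open>E\<close> to a group \<open>Eb\<close>, later a
  finite \<open>p\<close>-group, and is injective on \<open>F\<close>. Since \<open>F\<close>
  contains \<open>P i\<close> for \<open>i \<le> N\<close>, membership of its elements in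
  \<open>L i\<close> can be tested after reduction, see \<open>pi_L\<close>.\<close>

locale residual_context = residual_datum E H P L D SH SP p
  for E :: "'e monoid" and H P L D SH SP p +
  fixes Eb :: "'f monoid" and \<pi> :: "'e \<Rightarrow> 'f" and N :: nat and F :: "'e set"
    and U :: "'u monoid" (structure) and \<rho> :: "'f \<Rightarrow> 'u" and u :: "nat \<Rightarrow> 'u"
  assumes Eb: "group Eb" and \<pi>: "\<pi> \<in> hom E Eb"
    and inj: "inj_on \<pi> F" and P_F: "\<And>i. i \<le> N \<Longrightarrow> P i \<subseteq> F"
    and U: "group U" and \<rho>: "\<rho> \<in> hom Eb U" and u: "\<And>i. u i \<in> carrier U"
    and commute: "\<And>i k. k \<in> \<pi> ` L i \<Longrightarrow> u i \<otimes> \<rho> k = \<rho> k \<otimes> u i"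
begin

sublocale W: reduced_words U Eb \<rho> u "\<lambda>i. \<pi> ` L i" N
  by (rule reduced_words.intro [OF U Eb \<rho> u])

sublocale Eb: group Eb by (rule Eb)
sublocale \<pi>: group_hom E Eb \<pi>
  using \<pi> by (simp add: group_hom_def group_hom_axioms_def E Eb)

section \<open>Conjugated reductions of the pieces\<close>

primrec tail_prod :: "nat \<Rightarrow> 'u" where
  "tail_prod 0 = \<one>"
| "tail_prod (Suc k) = tail_prod k \<otimes> u (N - Suc k)"

text \<open>Below \<open>N\<close> this is the product of \<open>u (N - 1)\<close> down to
  \<open>u i\<close>, which \<open>tail_prod\<close> builds from the left. By truncated subtraction
  it is \<open>\<one>\<close> for \<open>i \<ge> N\<close>.\<close>

definition conj_elem :: "nat \<Rightarrow> 'u" where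
  "conj_elem i = tail_prod (N - i)"

lemma conj_elem_closed: "conj_elem i \<in> carrier U"
proof -
  have "tail_prod k \<in> carrier U" for k by (induction k) (simp_all add: u)
  then show ?thesis by (simp add: conj_elem_def)
qed

lemma conj_elem_Suc: "i < N \<Longrightarrow> conj_elem i = conj_elem (Suc i) \<otimes> u i"
proof -
  assume "i < N"
  then have "N - i = Suc (N - Suc i)" "N - Suc (N - Suc i) = i" by auto
  then show ?thesis by (simp add: conj_elem_def)
qed

lemma conj_elem_N: "N \<le> i \<Longrightarrow> conj_elem i = \<one>"
  by (simp add: conj_elem_def)

lemma rho_pi_closed: "x \<in> carrier E \<Longrightarrow> \<rho> (\<pi> x) \<in> carrier U"
  by simp

lemma D_subset_le: "i \<le> j \<Longrightarrow> D i \<subseteq> D j"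
  using lift_Suc_mono_le [of D i j] D_Suc by blast

text \<open>\<open>D i\<close> lies in \<open>L j\<close> for every \<open>j \<ge> i\<close>, and
  the conjugator of index \<open>i\<close> only involves letters \<open>u j\<close> with such
  \<open>j\<close>.\<close>

lemma conj_elem_D:
  assumes "x \<in> D i"
  shows "conj_elem i \<otimes> \<rho> (\<pi> x) = \<rho> (\<pi> x) \<otimes> conj_elem i"
proof -
  have x: "x \<in> carrier E" using assms subgroup.subset [OF subgroups(4)] by blast
  have cl: "tail_prod k \<in> carrier U" for k by (induction k) (simp_all add: u)
  have "tail_prod k \<otimes> \<rho> (\<pi> x) = \<rho> (\<pi> x) \<otimes> tail_prod k" if "k \<le> N - i" for k
    using that
  proof (induction k)
    case (Suc k)
    have "x \<in> L (N - Suc k)"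
      using assms D_subset_le [of i "N - Suc k"] D_L Suc.prems by (cases "i \<le> N - Suc k") auto
    then have "u (N - Suc k) \<otimes> \<rho> (\<pi> x) = \<rho> (\<pi> x) \<otimes> u (N - Suc k)" by (intro commute) simp
    then have "tail_prod (Suc k) \<otimes> \<rho> (\<pi> x) = tail_prod k \<otimes> \<rho> (\<pi> x) \<otimes> u (N - Suc k)"
      using x cl u by (simp add: W.U.m_assoc)
    then show ?case using Suc x cl u by (simp add: W.U.m_assoc)
  qed (use x in simp)
  then show ?thesis by (simp add: conj_elem_def)
qed

definition family :: "nat \<Rightarrow> 'e \<Rightarrow> 'u" where
  "family v x = (case v of 0 \<Rightarrow> \<rho> (\<pi> x)
     | Suc i \<Rightarrow> conj_elem i \<otimes> \<rho> (\<pi> x) \<otimes> inv conj_elem i)"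

lemma conj_commute:
  "a \<in> carrier U \<Longrightarrow> b \<in> carrier U \<Longrightarrow> a \<otimes> b = b \<otimes> a \<Longrightarrow> a \<otimes> b \<otimes> inv a = b"
  by (simp add: W.U.m_assoc)

lemma conj_mult:
  "a \<in> carrier U \<Longrightarrow> b \<in> carrier U \<Longrightarrow> c \<in> carrier U \<Longrightarrow>
    a \<otimes> (b \<otimes> c) \<otimes> inv a = (a \<otimes> b \<otimes> inv a) \<otimes> (a \<otimes> c \<otimes> inv a)"
  by (simp add: W.U.m_assoc W.U.inv_solve_left)

text \<open>For \<open>i < N\<close> the conjugators of \<open>P i\<close> and
  \<open>P (Suc i)\<close> differ by \<open>u i\<close>, which commutes with the image of
  \<open>L i\<close>; from \<open>N\<close> on both are \<open>\<one>\<close>. On \<open>D i\<close>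
  the whole conjugator cancels.\<close>

lemma compatible_family: "compatible U family"
  unfolding compatible_def
proof (intro conjI allI ballI)
  fix v
  show "family v \<in> hom (E\<lparr>carrier := vg v\<rparr>) U"
    using vg_subset [of v] conj_elem_closed
    by (cases v) (auto simp: family_def hom_def subset_iff conj_mult)
next
  fix i x assume x: "x \<in> L i"
  then have xE: "x \<in> carrier E" using subgroup.subset [OF subgroups(3)] by blast
  show "family (Suc i) x = family (Suc (Suc i)) x"
  proof (cases "i < N")
    case True
    have "u i \<otimes> \<rho> (\<pi> x) = \<rho> (\<pi> x) \<otimes> u i" using x by (intro commute) simp
    then have "u i \<otimes> \<rho> (\<pi> x) \<otimes> inv u i = \<rho> (\<pi> x)"
      using xE u by (intro conj_commute) auto
    moreover have "conj_elem i \<otimes> \<rho> (\<pi> x) \<otimes> inv conj_elem i =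
        conj_elem (Suc i) \<otimes> (u i \<otimes> \<rho> (\<pi> x) \<otimes> inv u i) \<otimes> inv conj_elem (Suc i)"
      using xE u conj_elem_closed by (simp add: conj_elem_Suc [OF True] W.U.m_assoc W.U.inv_mult_group)
    ultimately show ?thesis by (simp add: family_def)
  qed (simp add: family_def conj_elem_N)
next
  fix i x assume x: "x \<in> D i"
  then have xE: "x \<in> carrier E" using subgroup.subset [OF subgroups(4)] by blast
  show "family (Suc i) x = family 0 x"
    using conj_commute [OF conj_elem_closed rho_pi_closed [OF xE] conj_elem_D [OF x]]
    by (simp add: family_def)
qed

definition Phi :: "nat \<Rightarrow> 'u" where
  "Phi = (SOME h. h \<in> hom tree_group U \<and> (\<forall>v. \<forall>x \<in> vg v. h (inc v x) = family v x))"

lemma Phi: "Phi \<in> hom tree_group U" "x \<in> vg v \<Longrightarrow> Phi (inc v x) = family v x"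
proof -
  have "\<exists>h. h \<in> hom tree_group U \<and> (\<forall>v. \<forall>x \<in> vg v. h (inc v x) = family v x)"
    using tree_group_universal [OF U compatible_family] by (simp only: Bex_def)
  from someI_ex [OF this]
  show "Phi \<in> hom tree_group U" "x \<in> vg v \<Longrightarrow> Phi (inc v x) = family v x"
    unfolding Phi_def by simp_all
qed

sublocale Phi: group_hom tree_group U Phi
  using Phi(1) by (simp add: group_hom_def group_hom_axioms_def group_tree_group U)

text \<open>\<open>Phi\<close> viewed from \<open>P i\<close>: undoing the conjugator makes it the
  plain reduction there, and moving from \<open>i\<close> to \<open>Suc i\<close> conjugates by
  \<open>u i\<close>. At \<open>N\<close> it is \<open>Phi\<close> itself.\<close>

definition Th :: "nat \<Rightarrow> nat \<Rightarrow> 'u" where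
  "Th i g = inv conj_elem i \<otimes> Phi g \<otimes> conj_elem i"

lemma Th_hom: "Th i \<in> hom tree_group U"
proof (rule homI)
  fix a b assume "a \<in> carrier tree_group" "b \<in> carrier tree_group"
  then show "Th i (a \<otimes>\<^bsub>tree_group\<^esub> b) = Th i a \<otimes> Th i b"
    using conj_mult [of "inv conj_elem i" "Phi a" "Phi b"] conj_elem_closed [of i]
    by (simp add: Th_def)
qed (simp add: Th_def conj_elem_closed)

lemma Th_inc: "x \<in> P i \<Longrightarrow> Th i (inc (Suc i) x) = \<rho> (\<pi> x)"
proof -
  assume x: "x \<in> P i"
  then have xE: "x \<in> carrier E" using subgroup.subset [OF subgroups(2)] by blast
  have "Th i (inc (Suc i) x) =
      inv conj_elem i \<otimes> (conj_elem i \<otimes> \<rho> (\<pi> x) \<otimes> inv conj_elem i) \<otimes> conj_elem i"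
    using Phi(2) [of x "Suc i"] x by (simp add: Th_def family_def)
  also have "\<dots> = \<rho> (\<pi> x)"
    using conj_elem_closed [of i] xE by (simp add: W.U.m_assoc W.U.inv_solve_left')
  finally show ?thesis .
qed

lemma Th_Suc:
  assumes "i < N" "g \<in> carrier tree_group"
  shows "Th (Suc i) g = u i \<otimes> Th i g \<otimes> inv u i"
proof -
  have "u i \<otimes> (inv u i \<otimes> z) = z" if "z \<in> carrier U" for z
    using that u by (simp add: W.U.m_assoc [symmetric])
  then show ?thesis using conj_elem_closed u assms
    by (simp add: Th_def conj_elem_Suc [OF assms(1)] W.U.m_assoc W.U.inv_mult_group)
qed

lemma Th_N: "g \<in> carrier tree_group \<Longrightarrow> Th N g = Phi g"
  by (simp add: Th_def conj_elem_N)

section \<open>Images of alternating products as reduced words\<close>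

lemma pi_L: "x \<in> F \<Longrightarrow> i \<le> N \<Longrightarrow> \<pi> x \<in> \<pi> ` L i \<Longrightarrow> x \<in> L i"
proof -
  assume x: "x \<in> F" "i \<le> N" "\<pi> x \<in> \<pi> ` L i"
  then obtain y where y: "y \<in> L i" "\<pi> x = \<pi> y" by blast
  then have "y \<in> F" using x L_P P_F by blast
  then show "x \<in> L i" using inj y x by (auto dest: inj_onD)
qed

lemma red_vertex:
  assumes "e < N" "x \<in> P e" "x \<notin> L e"
  shows "Th (Suc e) (inc (Suc e) x) \<in> W.red e"
proof -
  have xE: "x \<in> carrier E" using assms subgroup.subset [OF subgroups(2)] by blast
  have "x \<in> F" using assms P_F [of e] by auto
  then have "\<pi> x \<notin> \<pi> ` L e" using pi_L [of x e] assms by auto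
  then have "u e \<otimes> \<rho> (\<pi> x) \<otimes> inv u e \<in> W.red e"
    using assms xE by (intro W.red_base) auto
  moreover have "inc (Suc e) x \<in> carrier tree_group" using assms inc_closed [of x "Suc e"] by simp
  ultimately show ?thesis using assms by (simp add: Th_Suc Th_inc)
qed

lemma alternating_butlast:
  "alternating A B C rs \<Longrightarrow> (r, y) \<in> set (butlast rs) \<Longrightarrow> y \<notin> C"
proof (induction rs)
  case (Cons a rs)
  then show ?case by (cases a) (auto split: if_splits)
qed simp

lemma alternating_set:
  "alternating A B C rs \<Longrightarrow> (r, y) \<in> set rs \<Longrightarrow> r \<in> A - C \<and> y \<in> B"
proof (induction rs)
  case (Cons a rs)
  then show ?case by (cases a) auto
qed simp

lemma hom_alt_prod:
  assumes "f \<in> hom tree_group U" "alternating A B C rs" "A \<subseteq> carrier tree_group" "B \<subseteq> carrier tree_group"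
  shows "f (alt_prod tree_group rs) = alt_prod U (map (\<lambda>(r, y). (f r, f y)) rs)"
  using assms(2)
proof (induction rs)
  case Nil
  interpret f: group_hom tree_group U f
    using assms(1) by (simp add: group_hom_def group_hom_axioms_def group_tree_group U)
  show ?case by simp
next
  case (Cons ry rs)
  obtain r y where ry: "ry = (r, y)" by force
  have "r \<in> carrier tree_group" "y \<in> carrier tree_group" "alternating A B C rs"
    using Cons.prems ry assms by auto
  moreover have "alt_prod tree_group rs \<in> carrier tree_group"
    using G.alt_prod_closed [OF \<open>alternating A B C rs\<close> assms(3,4)] .
  ultimately show ?case using Cons.IH assms(1) by (simp add: ry hom_mult)
qed

text \<open>Shared by \<open>red_chain\<close>, where \<open>f\<close> is \<open>Th (Suc e)\<close>
  and the \<open>B\<close>-factors come from \<open>P (Suc e)\<close>, and by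
  \<open>Phi_reduced\<close>, where \<open>f\<close> is \<open>Phi\<close> and they come from
  \<open>H\<close>. The \<open>A\<close>-factors contribute words and the \<open>B\<close>-factors
  only group elements.\<close>

lemma alternating_red:
  assumes f: "f \<in> hom tree_group U" and rs: "alternating A B C rs" "rs \<noteq> []"
    and AB: "A \<subseteq> carrier tree_group" "B \<subseteq> carrier tree_group"
    and r: "\<And>r y. (r, y) \<in> set rs \<Longrightarrow> f r \<in> W.red e"
    and y: "\<And>r y. (r, y) \<in> set rs \<Longrightarrow> \<exists>x \<in> carrier Eb. f y = \<rho> x \<and> (y \<notin> C \<longrightarrow> x \<notin> \<pi> ` L e)"
  shows "\<exists>v b x. f (alt_prod tree_group rs) = W.val (v @ [(e, b, x)]) \<and>
    W.reduced (v @ [(e, b, x)]) \<and> fst (hd (v @ [(e, b, x)])) = e"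
proof -
  define X where "X y = (SOME x. x \<in> carrier Eb \<and> f y = \<rho> x \<and> (y \<notin> C \<longrightarrow> x \<notin> \<pi> ` L e))" for y
  have X: "X y \<in> carrier Eb \<and> f y = \<rho> (X y) \<and> (y \<notin> C \<longrightarrow> X y \<notin> \<pi> ` L e)"
    if "(r, y) \<in> set rs" for r y
    unfolding X_def by (rule someI_ex) (use y [OF that] in blast)
  let ?rs = "map (\<lambda>(r, y). (f r, X y)) rs"
  have "map (\<lambda>(r, y). (f r, f y)) rs = map (\<lambda>(a, x). (a, \<rho> x)) ?rs"
    using X by (auto simp: case_prod_beta)
  then have "f (alt_prod tree_group rs) = alt_prod U (map (\<lambda>(a, x). (a, \<rho> x)) ?rs)"
    using hom_alt_prod [OF f rs(1) AB] by (simp only:)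
  moreover have "\<exists>v b x. alt_prod U (map (\<lambda>(a, x). (a, \<rho> x)) ?rs) = W.val (v @ [(e, b, x)]) \<and>
      W.reduced (v @ [(e, b, x)]) \<and> fst (hd (v @ [(e, b, x)])) = e"
  proof (rule W.red_alternating)
    show "a \<in> W.red e \<and> x \<in> carrier Eb" if "(a, x) \<in> set ?rs" for a x
      using that r X by auto
    show "x \<notin> \<pi> ` L e" if ax: "(a, x) \<in> set (butlast ?rs)" for a x
    proof -
      from ax obtain r y where "(r, y) \<in> set (butlast rs)" "x = X y"
        by (auto simp: map_butlast [symmetric])
      then show ?thesis using alternating_butlast [OF rs(1)] X in_set_butlastD by metis
    qed
  qed (use rs in simp)
  ultimately show ?thesis by simp
qed

text \<open>Write an element of \<open>chain (Suc e)\<close> as an alternating product over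
  \<open>L e\<close>. Seen from \<open>P (Suc e)\<close>, the factors from \<open>chain e\<close>
  are words beginning and ending with index \<open>e\<close> by induction, and the inner factors
  from \<open>P (Suc e)\<close> lie outside \<open>L e\<close>. So the product is reduced with index
  \<open>e\<close> at both ends, and the next view conjugates it by \<open>u (Suc e)\<close>.
  Without factors from \<open>chain e\<close> the element comes from \<open>P (Suc e)\<close>
  alone.\<close>

lemma red_chain:
  assumes "e < N" "g \<in> chain e" "g \<notin> inc (Suc e) ` L e"
  shows "Th (Suc e) g \<in> W.red e"
  using assms
proof (induction e arbitrary: g)
  case 0
  then obtain x where "x \<in> P 0" "g = inc (Suc 0) x" by (auto simp: chain_0)
  then show ?case using red_vertex [of 0 x] 0 by auto
next
  case (Suc e)
  let ?B = "inc (Suc (Suc e)) ` P (Suc e)" and ?C = "inc (Suc e) ` L e"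
  have C: "?C \<subseteq> chain e" "?C \<subseteq> ?B"
    using inc_chain L_P(1) [of e] L_P(2) [of e] inc_L by (auto simp: image_iff) (metis inc_L subsetD)+
  have sub: "chain e \<subseteq> carrier tree_group" "?B \<subseteq> carrier tree_group"
    using subgroup.subset [OF subgroup_chain] subgroup.subset [OF subgroup_inc_P] by auto
  have "g \<in> generate tree_group (chain e \<union> ?B)" using Suc.prems(2) chain_Suc by blast
  from G.alternating_form [OF subgroup_chain subgroup_inc_P C this]
  obtain y0 rs where y0: "y0 \<in> P (Suc e)" and rs: "alternating (chain e) ?B ?C rs"
    and g: "g = inc (Suc (Suc e)) y0 \<otimes>\<^bsub>tree_group\<^esub> alt_prod tree_group rs" by blast
  have y0E: "y0 \<in> carrier E" "inc (Suc (Suc e)) y0 \<in> carrier tree_group"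
    using y0 subgroup.subset [OF subgroups(2)] sub by blast+
  show ?case
  proof (cases "rs = []")
    case True
    then have "g = inc (Suc (Suc e)) y0" using g y0E by simp
    then show ?thesis using red_vertex [of "Suc e" y0] Suc.prems y0 by auto
  next
    case False
    have "\<exists>v b x. Th (Suc e) (alt_prod tree_group rs) = W.val (v @ [(e, b, x)]) \<and>
      W.reduced (v @ [(e, b, x)]) \<and> fst (hd (v @ [(e, b, x)])) = e"
    proof (rule alternating_red [OF Th_hom rs False sub])
      fix r y assume ry: "(r, y) \<in> set rs"
      note ryAB = alternating_set [OF rs ry]
      show "Th (Suc e) r \<in> W.red e" using Suc.IH [of r] Suc.prems(1) ryAB by auto
      from ryAB obtain x where x: "x \<in> P (Suc e)" "y = inc (Suc (Suc e)) x" by blast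
      have xE: "x \<in> carrier E" using x subgroup.subset [OF subgroups(2)] by blast
      have "\<pi> x \<notin> \<pi> ` L e" if "y \<notin> ?C"
      proof
        assume "\<pi> x \<in> \<pi> ` L e"
        moreover have "x \<in> F" using x P_F [of "Suc e"] Suc.prems(1) by auto
        ultimately have "x \<in> L e" using pi_L [of x e] Suc.prems(1) by auto
        then show False using that x inc_L by (metis imageI)
      qed
      then show "\<exists>x \<in> carrier Eb. Th (Suc e) y = \<rho> x \<and> (y \<notin> ?C \<longrightarrow> x \<notin> \<pi> ` L e)"
        using x Th_inc xE by (intro bexI [of _ "\<pi> x"]) auto
    qed
    then obtain v b x where v: "Th (Suc e) (alt_prod tree_group rs) = W.val (v @ [(e, b, x)])"
      "W.reduced (v @ [(e, b, x)])" "fst (hd (v @ [(e, b, x)])) = e" by blast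
    have "u (Suc e) \<otimes> (\<rho> (\<pi> y0) \<otimes> W.val (v @ [(e, b, x)])) \<otimes> inv u (Suc e) \<in> W.red (Suc e)"
      using Suc.prems(1) y0E by (intro W.red_up v) auto
    moreover have "Th (Suc e) g = \<rho> (\<pi> y0) \<otimes> W.val (v @ [(e, b, x)])"
      unfolding g using hom_mult [OF Th_hom y0E(2) G.alt_prod_closed [OF rs sub]] Th_inc [OF y0] v(1) by simp
    moreover have "g \<in> carrier tree_group" using Suc.prems(2) subgroup.subset [OF subgroup_chain] by blast
    ultimately show ?thesis using Suc.prems(1) by (simp add: Th_Suc)
  qed
qed

text \<open>\<open>N\<close> exceeds the chain index by two so that every chain factor is surrounded
  by the extra letter \<open>u (Suc n)\<close>. Factors outside \<open>L n\<close> already are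
  reduced words of index \<open>n\<close>. A factor from \<open>L n\<close> commutes with
  \<open>u n\<close>, but as an element of \<open>P (Suc n)\<close> it lies outside
  \<open>L (Suc n)\<close> by \<open>L_L\<close>.\<close>

lemma Phi_reduced:
  assumes N: "N = Suc (Suc n)" and rs: "alternating (chain n) (inc 0 ` H) (inc 0 ` Q) rs" "rs \<noteq> []"
    and h: "h \<in> H" and F: "\<And>r x. (r, inc 0 x) \<in> set rs \<Longrightarrow> x \<in> H \<Longrightarrow> x \<in> F"
  shows "\<exists>w. Phi (inc 0 h \<otimes>\<^bsub>tree_group\<^esub> alt_prod tree_group rs) = \<rho> (\<pi> h) \<otimes> W.val w \<and>
    W.reduced w \<and> w \<noteq> []"
proof -
  have sub: "chain n \<subseteq> carrier tree_group" "inc 0 ` H \<subseteq> carrier tree_group"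
    using subgroup.subset [OF subgroup_chain] inc_closed [of _ 0] by auto
  have HE: "x \<in> carrier E" if "x \<in> H" for x using that subgroup.subset [OF subgroups(1)] by blast
  have Phi_H: "Phi (inc 0 x) = \<rho> (\<pi> x)" if "x \<in> H" for x
    using Phi(2) [of x 0] that by (simp add: family_def)
  have "\<exists>v b x. Phi (alt_prod tree_group rs) = W.val (v @ [(Suc n, b, x)]) \<and>
      W.reduced (v @ [(Suc n, b, x)]) \<and> fst (hd (v @ [(Suc n, b, x)])) = Suc n"
  proof (rule alternating_red [OF Phi(1) rs sub])
    fix r y assume ry: "(r, y) \<in> set rs"
    note ryAB = alternating_set [OF rs(1) ry]
    have rG: "r \<in> carrier tree_group" using ryAB sub by blast
    show "Phi r \<in> W.red (Suc n)"
    proof (cases "r \<in> inc (Suc n) ` L n")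
      case True
      then obtain x where x: "x \<in> L n" "r = inc (Suc n) x" by blast
      then have r: "r = inc (Suc (Suc n)) x" using inc_L by simp
      have "x \<notin> L (Suc n)"
      proof
        assume "x \<in> L (Suc n)"
        then have "x \<in> D (Suc n)" using x L_L by blast
        then have "r \<in> inc 0 ` Q" using r inc_D by (auto simp: Q_def)
        then show False using ryAB by simp
      qed
      then have "Th N r \<in> W.red (Suc n)" using red_vertex [of "Suc n" x] x L_P(2) [of n] r N by auto
      then show ?thesis using Th_N [OF rG] by simp
    next
      case False
      have less: "n < N" "Suc n < N" using N by auto
      have "Th (Suc n) r \<in> W.red n" using red_chain [OF less(1)] ryAB False by blast
      from W.red_red_up [OF this less(2)] have "Th (Suc (Suc n)) r \<in> W.red (Suc n)"
        using Th_Suc [OF less(2) rG] by simp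
      moreover have "Th (Suc (Suc n)) r = Phi r" using Th_N [OF rG] N by metis
      ultimately show ?thesis by simp
    qed
    from ryAB obtain x where x: "x \<in> H" "y = inc 0 x" by blast
    have "\<pi> x \<notin> \<pi> ` L (Suc n)" if "y \<notin> inc 0 ` Q"
    proof
      assume "\<pi> x \<in> \<pi> ` L (Suc n)"
      then have "x \<in> L (Suc n)" using pi_L [of x "Suc n"] F [of r x] x ry N by simp
      then have "x \<in> Q" using H_L x by (auto simp: Q_def)
      then show False using that x by blast
    qed
    then show "\<exists>x \<in> carrier Eb. Phi y = \<rho> x \<and> (y \<notin> inc 0 ` Q \<longrightarrow> x \<notin> \<pi> ` L (Suc n))"
      using x Phi_H HE by (intro bexI [of _ "\<pi> x"]) auto
  qed
  then obtain v b x where v: "Phi (alt_prod tree_group rs) = W.val (v @ [(Suc n, b, x)])"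
      "W.reduced (v @ [(Suc n, b, x)])" by blast
  have "Phi (inc 0 h \<otimes>\<^bsub>tree_group\<^esub> alt_prod tree_group rs) = \<rho> (\<pi> h) \<otimes> W.val (v @ [(Suc n, b, x)])"
    using hom_mult [OF Phi(1) _ G.alt_prod_closed [OF rs(1) sub]] Phi_H [OF h] v(1) sub h by auto
  then show ?thesis using v(2) by blast
qed

end

text \<open>If no chain factor occurs, then \<open>g\<close> comes from \<open>H\<close> and the
  projection to \<open>E\<close> detects it. Otherwise its image is a nonempty reduced word, and the
  group with stable letters is itself residually \<open>p\<close>-finite.\<close>

lemma (in residual_datum) residually_p_finite_tree_group: "residually_p_finite p tree_group"
proof (rule residually_p_finiteI [where 'c = nat])
  fix g assume g: "g \<in> carrier tree_group" "g \<noteq> \<one>\<^bsub>tree_group\<^esub>"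
  obtain h rs where h: "h \<in> H"
    and rs: "alternating (\<Union>n. chain n) (inc 0 ` H) (inc 0 ` Q) rs"
    and gh: "g = inc 0 h \<otimes>\<^bsub>tree_group\<^esub> alt_prod tree_group rs"
    using carrier_alternating [OF g(1)] by blast
  have hE: "h \<in> carrier E" using h subgroup.subset [OF subgroups(1)] by blast
  show "\<exists>(P :: nat monoid) f. finite_p_group p P \<and> f \<in> hom tree_group P \<and> f g \<noteq> \<one>\<^bsub>P\<^esub>"
  proof (cases "rs = []")
    case True
    then have gh: "g = inc 0 h" using gh h inc_closed [of h 0] by simp
    interpret V: group "E\<lparr>carrier := H\<rparr>" by (rule E.subgroup_imp_group [OF subgroups(1)])
    interpret i: group_hom "E\<lparr>carrier := H\<rparr>" tree_group "inc 0"
      using inc_hom [of 0] by (simp add: group_hom_def group_hom_axioms_def V.group_axioms G.group_axioms)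
    have "h \<noteq> \<one>\<^bsub>E\<^esub>" using g(2) gh i.hom_one by auto
    then obtain Pb :: "nat monoid" and f where f: "finite_p_group p Pb" "f \<in> hom E Pb" "f h \<noteq> \<one>\<^bsub>Pb\<^esub>"
      using residual hE unfolding residually_p_finite_def by blast
    obtain \<epsilon> where \<epsilon>: "\<epsilon> \<in> hom tree_group E" "\<forall>v. \<forall>x \<in> vg v. \<epsilon> (inc v x) = x"
      using projection_exists by blast
    have "\<epsilon> (inc 0 h) = h" using \<epsilon>(2) h vg_simps(1) by blast
    then show ?thesis using f gh hom_compose [OF \<epsilon>(1) f(2)] by (intro exI [of _ Pb] exI [of _ "f \<circ> \<epsilon>"]) simp
  next
    case False
    obtain n where n: "alternating (chain n) (inc 0 ` H) (inc 0 ` Q) rs"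
      using finite_alternating_chain [OF rs] by blast
    define N where "N = Suc (Suc n)"
    \<comment> \<open>Membership in edge groups is to be tested after reduction, for elements of the
      \<open>P i\<close> and for the \<open>H\<close>-letters of the word. The latter are finitely
      many because \<open>inc 0\<close> is injective.\<close>
    define F where "F = (\<Union>i \<in> {..N}. P i) \<union> {x \<in> H. inc 0 x \<in> snd ` set rs}"
    have "finite {x \<in> H. inc 0 x \<in> snd ` set rs}"
      using finite_vimage_IntI [of "snd ` set rs" "inc 0" H] inj_inc [of 0] by (simp add: vimage_def Collect_conj_eq Int_commute)
    then have finF: "finite F" by (simp add: F_def finite_P)
    have FE: "F \<subseteq> carrier E" using subgroups by (auto simp: F_def dest: subgroup.subset)
    \<comment> \<open>Separating these quotients from \<open>\<one>\<close> amounts to injectivity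
      on \<open>F\<close>.\<close>
    let ?X = "{x \<otimes>\<^bsub>E\<^esub> inv\<^bsub>E\<^esub> y | x y. x \<in> F \<and> y \<in> F \<and> x \<noteq> y}"
    have "?X \<subseteq> (\<lambda>(x, y). x \<otimes>\<^bsub>E\<^esub> inv\<^bsub>E\<^esub> y) ` (F \<times> F)" by auto
    moreover have "finite ((\<lambda>(x, y). x \<otimes>\<^bsub>E\<^esub> inv\<^bsub>E\<^esub> y) ` (F \<times> F))" using finF by simp
    ultimately have finX: "finite ?X" by (rule finite_subset)
    have X1: "?X \<subseteq> carrier E - {\<one>\<^bsub>E\<^esub>}"
    proof
      fix z assume "z \<in> ?X"
      then obtain x y where xy: "x \<in> F" "y \<in> F" "x \<noteq> y" "z = x \<otimes>\<^bsub>E\<^esub> inv\<^bsub>E\<^esub> y" by blast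
      then have "x \<in> carrier E" "y \<in> carrier E" using FE by auto
      then show "z \<in> carrier E - {\<one>\<^bsub>E\<^esub>}" using xy E.inv_equality [of x "inv\<^bsub>E\<^esub> y"] by auto
    qed
    obtain Eb :: "nat monoid" and \<pi> where Eb: "finite_p_group p Eb" and \<pi>: "\<pi> \<in> hom E Eb"
      and \<pi>X: "\<forall>x \<in> ?X. \<pi> x \<noteq> \<one>\<^bsub>Eb\<^esub>"
      using residually_p_finite_set [OF E residual finX X1] by blast
    have gEb: "group Eb" using Eb by (simp add: finite_p_group_def)
    interpret \<pi>: group_hom E Eb \<pi>
      using \<pi> gEb by (simp add: group_hom_def group_hom_axioms_def E)
    have inj: "inj_on \<pi> F"
    proof (rule inj_onI, rule ccontr)
      fix x y assume xy: "x \<in> F" "y \<in> F" "\<pi> x = \<pi> y" "x \<noteq> y"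
      then have "\<pi> (x \<otimes>\<^bsub>E\<^esub> inv\<^bsub>E\<^esub> y) \<noteq> \<one>\<^bsub>Eb\<^esub>" using \<pi>X by blast
      moreover have "x \<in> carrier E" "y \<in> carrier E" using xy FE by auto
      ultimately show False using xy(3) by simp
    qed
    interpret S: stable_letters p Eb "\<lambda>i. \<pi> ` L i" N
      by (rule stable_letters.intro [OF p Eb]) (rule \<pi>.subgroup_img_is_subgroup [OF subgroups(3)])
    obtain U :: "(nat \<Rightarrow> (nat site \<Rightarrow> int) \<Rightarrow> nat site \<Rightarrow> int) monoid"
      and \<rho> u where U: "group U" "residually_p_finite p U" and \<rho>: "\<rho> \<in> hom Eb U"
      and u: "\<forall>i. u i \<in> carrier U"
      and commute: "\<forall>i. \<forall>k \<in> \<pi> ` L i. u i \<otimes>\<^bsub>U\<^esub> \<rho> k = \<rho> k \<otimes>\<^bsub>U\<^esub> u i"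
      and val: "\<forall>x \<in> carrier Eb. \<forall>w. admissible_word Eb N w \<longrightarrow> w \<noteq> [] \<longrightarrow>
        reduced_letters (\<lambda>i. \<pi> ` L i) (letters w) \<longrightarrow> \<rho> x \<otimes>\<^bsub>U\<^esub> stable_val U \<rho> u w \<noteq> \<one>\<^bsub>U\<^esub>"
      using S.stable_group_exists by blast
    interpret R: residual_context E H P L D SH SP p Eb \<pi> N F U \<rho> u
      by (intro residual_context.intro residual_context_axioms.intro residual_datum_axioms gEb \<pi> inj U(1) \<rho>)
        (use u commute in \<open>auto simp: F_def\<close>)
    have "x \<in> F" if "(r, inc 0 x) \<in> set rs" "x \<in> H" for r x
      using that by (force simp: F_def)
    then have "\<exists>w. R.Phi g = \<rho> (\<pi> h) \<otimes>\<^bsub>U\<^esub> stable_val U \<rho> u w \<and> R.W.reduced w \<and> w \<noteq> []"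
      unfolding gh by (rule R.Phi_reduced [OF N_def n False h])
    then obtain w where w: "R.Phi g = \<rho> (\<pi> h) \<otimes>\<^bsub>U\<^esub> stable_val U \<rho> u w" "R.W.reduced w" "w \<noteq> []"
      by blast
    have "R.Phi g \<noteq> \<one>\<^bsub>U\<^esub>"
      using val w hE unfolding R.W.reduced_def by simp
    moreover have "R.Phi g \<in> carrier U" using g(1) by (rule R.Phi.hom_closed)
    ultimately obtain Pb :: "nat monoid" and f where f: "finite_p_group p Pb" "f \<in> hom U Pb" "f (R.Phi g) \<noteq> \<one>\<^bsub>Pb\<^esub>"
      using U(2) unfolding residually_p_finite_def by blast
    then show ?thesis using hom_compose [OF R.Phi(1) f(2)]
      by (intro exI [of _ Pb] exI [of _ "f \<circ> R.Phi"]) simp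
  qed
qed (rule group_tree_group)

section \<open>The amalgamated finite groups\<close>

text \<open>Conjugation by \<open>y\<close> is multiplicative, so generators suffice. The condition
  is phrased without inverses, as \<open>finite_generate_extend\<close> takes it.\<close>

lemma (in group) normalizes_generate:
  assumes A: "A \<subseteq> carrier G" and y: "y \<in> carrier G"
    and gen: "\<And>a. a \<in> A \<Longrightarrow> \<exists>a' \<in> generate G A. a \<otimes> y = y \<otimes> a'"
    and x: "x \<in> generate G A"
  shows "\<exists>a' \<in> generate G A. x \<otimes> y = y \<otimes> a'"
  using x
proof induction
  case one
  then show ?case using y by (intro bexI [of _ \<one>]) (auto intro: generate.one)
next
  case (incl h)
  then show ?case by (rule gen)
next
  case (inv h)
  then obtain a where a: "a \<in> generate G A" "h \<otimes> y = y \<otimes> a" using gen by blast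
  have G: "h \<in> carrier G" "a \<in> carrier G" using inv A a generate_in_carrier by auto
  have "inv h \<otimes> y = inv h \<otimes> (y \<otimes> a) \<otimes> inv a" using G y by (simp add: m_assoc)
  also have "\<dots> = y \<otimes> inv a" using G y by (simp add: a(2) [symmetric] m_assoc [symmetric])
  finally show ?case using generate_m_inv_closed [OF A a(1)] by blast
next
  case (eng g h)
  then obtain a b where ab: "a \<in> generate G A" "g \<otimes> y = y \<otimes> a" "b \<in> generate G A" "h \<otimes> y = y \<otimes> b" by blast
  have G: "g \<in> carrier G" "h \<in> carrier G" "a \<in> carrier G" "b \<in> carrier G"
    using eng.hyps ab generate_in_carrier [OF A] by auto
  have "g \<otimes> h \<otimes> y = g \<otimes> y \<otimes> b" using G y by (simp add: m_assoc ab(4))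
  also have "\<dots> = y \<otimes> (a \<otimes> b)" unfolding ab(2) using G y by (simp add: m_assoc)
  finally show ?case using generate.eng [OF ab(1,3)] by blast
qed

text \<open>Powers of \<open>y\<close> can be moved to the left of elements of \<open>A\<close>, so
  these products are closed under multiplication, and the inverse of \<open>y\<close> is a power of
  \<open>y\<close>. The form bounds the size of the group and also yields
  \<open>L_form\<close>.\<close>

lemma (in group) generate_extend:
  assumes A: "subgroup A G" and y: "y \<in> carrier G" "y [^] n = \<one>" "(n::nat) > 0"
    and norm: "\<And>a. a \<in> A \<Longrightarrow> \<exists>a' \<in> A. a \<otimes> y = y \<otimes> a'"
    and x: "x \<in> generate G (A \<union> {y})"
  shows "\<exists>k < n. \<exists>a \<in> A. x = y [^] k \<otimes> a"
proof -
  have AG: "A \<subseteq> carrier G" by (rule subgroup.subset [OF A])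
  define X where "X = {y [^] k \<otimes> a | (k::nat) a. a \<in> A}"
  have red: "y [^] k = y [^] (k mod n)" for k :: nat
  proof -
    have "y [^] k = y [^] (n * (k div n) + k mod n)" by simp
    also have "\<dots> = y [^] (n * (k div n)) \<otimes> y [^] (k mod n)" using y by (simp only: nat_pow_mult)
    also have "y [^] (n * (k div n)) = \<one>" using y by (simp only: nat_pow_pow [symmetric] nat_pow_one)
    finally show ?thesis using y by simp
  qed
  have push: "\<exists>a' \<in> A. a \<otimes> y [^] k = y [^] k \<otimes> a'" if "a \<in> A" for a and k :: nat
    using that
  proof (induction k arbitrary: a)
    case 0
    then show ?case using AG by (intro bexI [of _ a]) auto
  next
    case (Suc k)
    then obtain b where b: "b \<in> A" "a \<otimes> y [^] k = y [^] k \<otimes> b" by blast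
    then obtain c where c: "c \<in> A" "b \<otimes> y = y \<otimes> c" using norm by blast
    have G: "a \<in> carrier G" "b \<in> carrier G" "c \<in> carrier G" using Suc.prems b c AG by auto
    have "a \<otimes> y [^] Suc k = (a \<otimes> y [^] k) \<otimes> y" using G y by (simp add: m_assoc)
    also have "\<dots> = y [^] Suc k \<otimes> c" using G y by (simp add: b(2) m_assoc c(2))
    finally show ?case using c(1) by blast
  qed
  have mult: "v \<otimes> w \<in> X" if "v \<in> X" "w \<in> X" for v w
  proof -
    from that obtain j k a b where v: "v = y [^] (j::nat) \<otimes> a" "a \<in> A" and w: "w = y [^] (k::nat) \<otimes> b" "b \<in> A"
      by (auto simp: X_def)
    obtain a' where a': "a' \<in> A" "a \<otimes> y [^] k = y [^] k \<otimes> a'" using push v by blast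
    have G: "a \<in> carrier G" "b \<in> carrier G" "a' \<in> carrier G" using v w a' AG by auto
    have "v \<otimes> w = y [^] j \<otimes> (a \<otimes> y [^] k) \<otimes> b" using G y v w by (simp add: m_assoc)
    also have "\<dots> = y [^] (j + k) \<otimes> (a' \<otimes> b)" using G y by (simp add: a'(2) m_assoc nat_pow_mult [symmetric])
    finally show ?thesis using subgroup.m_closed [OF A a'(1) w(2)] by (auto simp: X_def)
  qed
  have AX: "a \<in> X" if "a \<in> A" for a
    using that AG unfolding X_def by (intro CollectI exI [of _ 0] exI [of _ a]) auto
  have yX: "y [^] k \<in> X" for k :: nat
    using y subgroup.one_closed [OF A] unfolding X_def by (intro CollectI exI [of _ k] exI [of _ \<one>]) auto
  have "x \<in> X" using x
  proof induction
    case one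
    then show ?case using yX [of 0] by simp
  next
    case (incl h)
    then show ?case using AX yX [of 1] y by auto
  next
    case (inv h)
    have "inv y = y [^] (n - 1)"
    proof (rule inv_equality)
      show "y [^] (n - 1) \<otimes> y = \<one>" using y nat_pow_Suc [of y "n - 1"] by simp
    qed (use y in auto)
    then show ?case using inv AX yX [of "n - 1"] subgroup.m_inv_closed [OF A] by auto
  qed (rule mult)
  then obtain k a where "x = y [^] (k::nat) \<otimes> a" "a \<in> A" by (auto simp: X_def)
  then show ?thesis using red [of k] y(3) by (intro exI [of _ "k mod n"]) auto
qed

lemma (in group) finite_generate_extend:
  assumes "subgroup A G" "y \<in> carrier G" "y [^] n = \<one>" "(n::nat) > 0"
    and "\<And>a. a \<in> A \<Longrightarrow> \<exists>a' \<in> A. a \<otimes> y = y \<otimes> a'" and "finite A"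
  shows "finite (generate G (A \<union> {y}))"
proof -
  have "generate G (A \<union> {y}) \<subseteq> (\<lambda>(k, a). y [^] k \<otimes> a) ` ({..<n} \<times> A)"
    using generate_extend [OF assms(1-5)] by fastforce
  then show ?thesis using assms(6) by (meson finite_SigmaI finite_imageI finite_lessThan finite_subset)
qed

lemma (in group) generate_eqI:
  assumes "A \<subseteq> generate G B" "B \<subseteq> generate G A" "A \<subseteq> carrier G" "B \<subseteq> carrier G"
  shows "generate G A = generate G B"
  using assms generate_subset_subgroup generate_is_subgroup by (metis subset_antisym)

lemma (in group) commute_pow:
  "x \<in> carrier G \<Longrightarrow> y \<in> carrier G \<Longrightarrow> x \<otimes> y = y \<otimes> x \<Longrightarrow> x \<otimes> y [^] (n::nat) = y [^] n \<otimes> x"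
proof (induction n)
  case (Suc n)
  have "x \<otimes> y [^] Suc n = x \<otimes> y [^] n \<otimes> y" using Suc.prems by (simp add: m_assoc)
  also have "\<dots> = y [^] n \<otimes> (x \<otimes> y)" using Suc by (simp add: m_assoc)
  also have "\<dots> = y [^] Suc n \<otimes> x" unfolding Suc.prems(3) using Suc.prems by (simp add: m_assoc)
  finally show ?case .
qed simp

text \<open>The relations avoid inverses: \<open>zq_eq\<close> makes \<open>z (Suc i)\<close> the
  commutator of \<open>z i\<close> and \<open>q i\<close>, and \<open>sq\<close> says that
  conjugation by \<open>s\<close> sends \<open>q i\<close> to
  \<open>q i \<otimes> q (Suc i)\<close>. \<open>z_indep\<close> treats two consecutive
  \<open>z\<close> at once because consecutive edge groups have to be compared.\<close>

locale seed = group E for E :: "'e monoid" (structure) +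
  fixes p :: nat and q z :: "nat \<Rightarrow> 'e" and s :: 'e
  assumes p: "prime p" and residual: "residually_p_finite p E"
    and q [simp]: "q i \<in> carrier E" and z [simp]: "z i \<in> carrier E" and s [simp]: "s \<in> carrier E"
    and qq: "q i \<otimes> q j = q j \<otimes> q i"
    and q_pow: "q i [^] p = \<one>" and z_pow: "z i [^] p = \<one>"
    and zz: "z i \<otimes> z (Suc i) = z (Suc i) \<otimes> z i"
    and zq: "j < i \<Longrightarrow> z i \<otimes> q j = q j \<otimes> z i"
    and zq_eq: "z i \<otimes> q i = q i \<otimes> (z i \<otimes> z (Suc i))"
    and sq: "s \<otimes> q i = q i \<otimes> (q (Suc i) \<otimes> s)"
    and z_indep: "z i [^] (a::nat) \<otimes> z (Suc i) [^] (b::nat) \<in> generate E {q 0, s} \<Longrightarrow> p dvd a \<and> p dvd b"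
    and q_indep: "q i \<notin> generate E (q ` {..<i})"
begin

section \<open>Subgroups generated by a seed and their intersections\<close>

definition H :: "'e set" where "H = generate E {q 0, s}"
definition C :: "nat \<Rightarrow> 'e set" where "C i = generate E (q ` {..<i})"
definition L :: "nat \<Rightarrow> 'e set" where "L i = generate E (C (Suc i) \<union> {z (Suc i)})"
definition P :: "nat \<Rightarrow> 'e set" where "P i = generate E (C (Suc i) \<union> {z i})"

lemma p_pos: "p > 0"
  using p by (rule prime_gt_0_nat)

lemma sub_C: "subgroup (C i) E"
  unfolding C_def by (rule generate_is_subgroup) auto

lemma C_carrier: "C i \<subseteq> carrier E"
  by (rule subgroup.subset [OF sub_C])

lemma sub_H: "subgroup H E" and sub_L: "subgroup (L i) E" and sub_P: "subgroup (P i) E"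
  unfolding H_def L_def P_def using C_carrier by (auto intro!: generate_is_subgroup)

lemma q_C: "j < i \<Longrightarrow> q j \<in> C i"
  unfolding C_def by (auto intro: generate.incl)

lemma C_mono: "i \<le> j \<Longrightarrow> C i \<subseteq> C j"
  unfolding C_def by (intro mono_generate) auto

lemma C_L: "C (Suc i) \<subseteq> L i" and z_L: "z (Suc i) \<in> L i"
  and C_P: "C (Suc i) \<subseteq> P i" and z_P: "z i \<in> P i"
  unfolding L_def P_def by (auto intro: generate.incl)

lemma z_Suc_P: "z (Suc i) \<in> P i"
proof -
  have "q i \<otimes> z i \<otimes> z (Suc i) = z i \<otimes> q i" by (simp add: zq_eq m_assoc)
  then have "z (Suc i) = inv (q i \<otimes> z i) \<otimes> (z i \<otimes> q i)" by (simp add: inv_solve_left)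
  moreover have "q i \<in> P i" using q_C [of i "Suc i"] C_P by blast
  ultimately show ?thesis
    using z_P [of i] subgroup.m_closed [OF sub_P] subgroup.m_inv_closed [OF sub_P] by metis
qed

lemma q_H: "q i \<in> H"
proof (induction i)
  case 0
  then show ?case unfolding H_def by (auto intro: generate.incl)
next
  case (Suc i)
  have "q i \<otimes> q (Suc i) \<otimes> s = s \<otimes> q i" by (simp add: sq m_assoc)
  then have "q i \<otimes> q (Suc i) = s \<otimes> q i \<otimes> inv s" by (simp add: inv_solve_right)
  then have "q (Suc i) = inv (q i) \<otimes> (s \<otimes> q i \<otimes> inv s)" by (simp add: inv_solve_left)
  moreover have "s \<in> H" unfolding H_def by (auto intro: generate.incl)
  ultimately show ?case
    using Suc subgroup.m_closed [OF sub_H] subgroup.m_inv_closed [OF sub_H] by metis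
qed

lemma C_H: "C i \<subseteq> H"
  unfolding C_def using q_H by (intro generate_subset_subgroup [OF sub_H]) auto

lemma commute_C: 
  assumes "y \<in> carrier E" "\<And>j. j < i \<Longrightarrow> y \<otimes> q j = q j \<otimes> y" "a \<in> C i"
  shows "a \<otimes> y = y \<otimes> a"
  using assms(3) unfolding C_def
proof induction
  case (inv h)
  then have h: "h \<in> carrier E" and comm: "y \<otimes> h = h \<otimes> y" using assms by auto
  have "inv h \<otimes> y = inv h \<otimes> (y \<otimes> h) \<otimes> inv h" using assms(1) h by (simp add: m_assoc)
  also have "\<dots> = y \<otimes> inv h" unfolding comm using h assms(1) by (simp add: m_assoc [symmetric])
  finally show ?case .
next
  case (eng g h)
  have "q ` {..<i} \<subseteq> carrier E" by auto
  then have G: "g \<in> carrier E" "h \<in> carrier E"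
    using eng.hyps generate_in_carrier by blast+
  have "g \<otimes> h \<otimes> y = g \<otimes> (h \<otimes> y)" using G assms(1) by (simp add: m_assoc)
  also have "\<dots> = g \<otimes> y \<otimes> h" unfolding eng.IH(2) using G assms(1) by (simp add: m_assoc)
  also have "\<dots> = y \<otimes> (g \<otimes> h)" unfolding eng.IH(1) using G assms(1) by (simp add: m_assoc)
  finally show ?case .
qed (use assms in auto)

lemma z_C: "a \<in> C i \<Longrightarrow> a \<otimes> z i = z i \<otimes> a"
  by (rule commute_C [of "z i" i]) (auto simp: zq)

lemma z_Suc_C: "a \<in> C i \<Longrightarrow> a \<otimes> z (Suc i) = z (Suc i) \<otimes> a"
  by (rule commute_C [of "z (Suc i)" i]) (auto simp: zq)

lemma finite_C: "finite (C i)"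
proof (induction i)
  case 0
  then show ?case by (simp add: C_def generate_empty)
next
  case (Suc i)
  have "C (Suc i) \<subseteq> generate E (C i \<union> {q i})"
  proof -
    have "q ` {..<Suc i} \<subseteq> C i \<union> {q i}" using q_C by (auto simp: less_Suc_eq)
    then show ?thesis unfolding C_def [of "Suc i"] by (rule mono_generate)
  qed
  moreover have "finite (generate E (C i \<union> {q i}))"
  proof (rule finite_generate_extend [OF sub_C _ q_pow p_pos _ Suc])
    show "\<exists>a' \<in> C i. a \<otimes> q i = q i \<otimes> a'" if "a \<in> C i" for a
      using commute_C [of "q i" i a] that qq by auto
  qed simp
  ultimately show ?case by (rule finite_subset)
qed

lemma L_form: "x \<in> L i \<Longrightarrow> \<exists>k < p. \<exists>a \<in> C (Suc i). x = z (Suc i) [^] k \<otimes> a"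
  unfolding L_def by (rule generate_extend [OF sub_C z z_pow p_pos]) (use z_C in auto)

lemma finite_L: "finite (L i)"
  unfolding L_def by (rule finite_generate_extend [OF sub_C z z_pow p_pos _ finite_C]) (use z_C in auto)

text \<open>Starting from \<open>C i\<close>, adjoin \<open>z (Suc i)\<close>, \<open>z i\<close>
  and \<open>q i\<close>, each normalising the group built before. The order matters: conjugation by
  \<open>q i\<close> sends \<open>z i\<close> to \<open>z i \<otimes> z (Suc i)\<close>, so
  \<open>z (Suc i)\<close> has to be present already.\<close>

lemma finite_P: "finite (P i)"
proof -
  define A where "A = generate E (C i \<union> {z (Suc i)})"
  define B where "B = generate E (A \<union> {z i})"
  define D where "D = generate E (B \<union> {q i})"
  have gA: "C i \<union> {z (Suc i)} \<subseteq> carrier E" using C_carrier by auto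
  have A: "subgroup A E" unfolding A_def by (rule generate_is_subgroup [OF gA])
  have gB: "A \<union> {z i} \<subseteq> carrier E" using subgroup.subset [OF A] by auto
  have B: "subgroup B E" unfolding B_def by (rule generate_is_subgroup [OF gB])
  have gD: "B \<union> {q i} \<subseteq> carrier E" using subgroup.subset [OF B] by auto
  have D: "subgroup D E" unfolding D_def by (rule generate_is_subgroup [OF gD])
  have CA: "C i \<subseteq> A" "z (Suc i) \<in> A" unfolding A_def by (auto intro: generate.incl)
  have AB: "A \<subseteq> B" "z i \<in> B" unfolding B_def by (auto intro: generate.incl)
  have BD: "B \<subseteq> D" "q i \<in> D" unfolding D_def by (auto intro: generate.incl)
  have "finite A"
    unfolding A_def by (rule finite_generate_extend [OF sub_C z z_pow p_pos _ finite_C]) (use z_Suc_C in auto)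
  moreover have "\<exists>a' \<in> A. a \<otimes> z i = z i \<otimes> a'" if "a \<in> A" for a
    unfolding A_def
  proof (rule normalizes_generate [OF gA z])
    fix b assume "b \<in> C i \<union> {z (Suc i)}"
    then have "b \<otimes> z i = z i \<otimes> b" "b \<in> A" using z_C zz CA by auto
    then show "\<exists>a' \<in> generate E (C i \<union> {z (Suc i)}). b \<otimes> z i = z i \<otimes> a'"
      unfolding A_def by (rule bexI)
  qed (use that in \<open>simp add: A_def\<close>)
  ultimately have "finite B"
    unfolding B_def by (intro finite_generate_extend [OF A z z_pow p_pos])
  moreover have "\<exists>a' \<in> B. a \<otimes> q i = q i \<otimes> a'" if "a \<in> B" for a
    unfolding B_def
  proof (rule normalizes_generate [OF gB q])
    fix b assume b: "b \<in> A \<union> {z i}"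
    have "\<exists>a' \<in> B. b \<otimes> q i = q i \<otimes> a'"
    proof (cases "b = z i")
      case True
      have "z i \<otimes> z (Suc i) \<in> B"
        using AB CA(2) by (intro subgroup.m_closed [OF B]) auto
      then show ?thesis using True zq_eq by blast
    next
      case False
      have "\<exists>a' \<in> generate E (C i \<union> {z (Suc i)}). b \<otimes> q i = q i \<otimes> a'"
      proof (rule normalizes_generate [OF gA q])
        fix c assume c: "c \<in> C i \<union> {z (Suc i)}"
        then have "c \<otimes> q i = q i \<otimes> c"
          using commute_C [of "q i" i c] qq zq [of i "Suc i"] by auto
        moreover have "c \<in> generate E (C i \<union> {z (Suc i)})" using c by (rule generate.incl)
        ultimately show "\<exists>a' \<in> generate E (C i \<union> {z (Suc i)}). c \<otimes> q i = q i \<otimes> a'" by (rule bexI)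
      qed (use b False in \<open>simp add: A_def\<close>)
      then show ?thesis using AB(1) by (auto simp: A_def)
    qed
    then show "\<exists>a' \<in> generate E (A \<union> {z i}). b \<otimes> q i = q i \<otimes> a'" by (simp only: B_def)
  qed (use that in \<open>simp add: B_def\<close>)
  ultimately have "finite D"
    unfolding D_def by (intro finite_generate_extend [OF B q q_pow p_pos])
  moreover have "P i \<subseteq> D"
    unfolding P_def
  proof (rule generate_subset_subgroup [OF D])
    have "q j \<in> D" if "j < Suc i" for j
      using that q_C [of j i] CA(1) AB(1) BD by (cases "j = i") auto
    then have "C (Suc i) \<subseteq> D" unfolding C_def by (intro generate_subset_subgroup [OF D]) auto
    then show "C (Suc i) \<union> {z i} \<subseteq> D" using AB(2) BD(1) by blast
  qed
  ultimately show ?thesis by (rule finite_subset [rotated])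
qed

lemma z_pow_H: "z i [^] (k::nat) \<in> H \<Longrightarrow> k < p \<Longrightarrow> k = 0"
  using z_indep [of i k 0] by (cases "k = 0") (auto simp: H_def dest: dvd_imp_le)

text \<open>Inverses become natural powers, the kind of exponent that \<open>z_indep\<close>
  accepts.\<close>

lemma z_pow_inv: "inv (z i [^] k) = z i [^] ((p - 1) * k)" for k :: nat
proof (rule inv_equality)
  have "z i [^] ((p - 1) * k) \<otimes> z i [^] k = z i [^] (p * k)"
    using p_pos by (simp add: nat_pow_mult add.commute flip: mult_Suc)
  also have "\<dots> = \<one>" by (simp add: nat_pow_pow [symmetric] z_pow)
  finally show "z i [^] ((p - 1) * k) \<otimes> z i [^] k = \<one>" .
qed auto

text \<open>In the form \<open>z (Suc i) [^] k \<otimes> a\<close> the factor \<open>a\<close> lies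
  in \<open>H\<close>, so the power of \<open>z (Suc i)\<close> does too and is trivial.\<close>

lemma H_L: "H \<inter> L i \<subseteq> C (Suc i)"
proof
  fix x assume x: "x \<in> H \<inter> L i"
  then obtain k a where k: "k < p" "a \<in> C (Suc i)" "x = z (Suc i) [^] k \<otimes> a" using L_form by blast
  have a: "a \<in> H" "a \<in> carrier E" using k C_H C_carrier by auto
  have "z (Suc i) [^] k = x \<otimes> inv a" using k a by (simp add: m_assoc)
  also have "\<dots> \<in> H" using x a by (intro subgroup.m_closed [OF sub_H] subgroup.m_inv_closed [OF sub_H]) auto
  finally have "k = 0" using k z_pow_H by blast
  then show "x \<in> C (Suc i)" using k a by simp
qed

text \<open>Otherwise \<open>z i\<close> times a power of \<open>z (Suc i)\<close> would lie in
  \<open>C (Suc i)\<close>, hence in \<open>H\<close>, although the exponent 1 of \<open>z i\<close>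
  is not divisible by \<open>p\<close>.\<close>

lemma z_not_L: "z i \<notin> L i"
proof
  assume "z i \<in> L i"
  then obtain k a where k: "k < p" "a \<in> C (Suc i)" "z i = z (Suc i) [^] k \<otimes> a" using L_form by blast
  have a: "a \<in> H" "a \<in> carrier E" using k C_H C_carrier by auto
  have "z i [^] (1::nat) \<otimes> z (Suc i) [^] ((p - 1) * k) = z (Suc i) [^] ((p - 1) * k) \<otimes> z i"
    using commute_pow [OF z z zz, of i "(p - 1) * k"] by simp
  also have "\<dots> = inv (z (Suc i) [^] k) \<otimes> (z (Suc i) [^] k \<otimes> a)"
    by (simp only: z_pow_inv k(3) [symmetric])
  also have "\<dots> = a" using a by (simp add: m_assoc [symmetric])
  finally have eq: "z i [^] (1::nat) \<otimes> z (Suc i) [^] ((p - 1) * k) = a" .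
  have "z i [^] (1::nat) \<otimes> z (Suc i) [^] ((p - 1) * k) \<in> generate E {q 0, s}"
    unfolding eq using a by (simp add: H_def)
  then have "p dvd 1" using z_indep by blast
  then show False using p by simp
qed

lemma q_not_L: "q (Suc i) \<notin> L i"
  using H_L [of i] q_H q_indep [of "Suc i"] by (auto simp: C_def)

text \<open>The two forms of \<open>x\<close> put a power of \<open>z (Suc i)\<close> times a power
  of \<open>z (Suc (Suc i))\<close> into \<open>H\<close>. Independence kills the second power,
  which leaves \<open>x\<close> in \<open>C (Suc (Suc i))\<close>.\<close>

lemma L_L: "L i \<inter> L (Suc i) \<subseteq> C (Suc (Suc i))"
proof
  fix x assume x: "x \<in> L i \<inter> L (Suc i)"
  obtain j :: nat and a where j: "a \<in> C (Suc i)" "x = z (Suc i) [^] j \<otimes> a" using x L_form [of x i] by blast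
  obtain k b where k: "k < p" "b \<in> C (Suc (Suc i))" "x = z (Suc (Suc i)) [^] k \<otimes> b"
    using x L_form [of x "Suc i"] by blast
  let ?z = "z (Suc i)" and ?w = "z (Suc (Suc i))"
  have a: "a \<in> H" "a \<in> carrier E" and b: "b \<in> H" "b \<in> carrier E" using j k C_H C_carrier by auto
  have comm: "?z [^] m \<otimes> ?w [^] n = ?w [^] n \<otimes> ?z [^] m" for m n :: nat
    using commute_pow [OF nat_pow_closed [OF z] z commute_pow [OF z z zz [symmetric], symmetric]] by simp
  have "?z [^] j \<otimes> ?w [^] ((p - 1) * k) = inv (?w [^] k) \<otimes> ?z [^] j"
    by (simp add: comm z_pow_inv)
  also have "\<dots> = inv (?w [^] k) \<otimes> (x \<otimes> inv a)" using j a by (simp add: m_assoc)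
  also have "\<dots> = b \<otimes> inv a" using k b a by (simp add: m_assoc inv_solve_left')
  also have "\<dots> \<in> H" using a b by (intro subgroup.m_closed [OF sub_H] subgroup.m_inv_closed [OF sub_H])
  finally have "p dvd (p - 1) * k" using z_indep by (simp add: H_def)
  moreover have "coprime p (p - 1)" using p_pos coprime_diff_one_right_nat by simp
  ultimately have "p dvd k" using coprime_dvd_mult_right_iff by blast
  then have "k = 0" using k(1) by (cases "k = 0") (auto dest: dvd_imp_le)
  then show "x \<in> C (Suc (Suc i))" using k b by simp
qed

lemma L_P: "L i \<subseteq> P i" "L i \<subseteq> P (Suc i)"
proof -
  show "L i \<subseteq> P i" unfolding L_def
    using C_P z_Suc_P by (intro generate_subset_subgroup [OF sub_P]) auto
  show "L i \<subseteq> P (Suc i)" unfolding L_def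
    using C_P [of "Suc i"] C_mono [of "Suc i" "Suc (Suc i)"] z_P by (intro generate_subset_subgroup [OF sub_P]) auto
qed

lemma P_Suc: "P (Suc i) = generate E (L i \<union> C (Suc (Suc i)))"
proof
  have "L i \<union> C (Suc (Suc i)) \<subseteq> carrier E" using subgroup.subset [OF sub_L] C_carrier by blast
  then show "P (Suc i) \<subseteq> generate E (L i \<union> C (Suc (Suc i)))"
    unfolding P_def using z_L by (intro generate_subset_subgroup generate_is_subgroup) (auto intro: generate.incl)
  show "generate E (L i \<union> C (Suc (Suc i))) \<subseteq> P (Suc i)"
    using L_P C_P by (intro generate_subset_subgroup [OF sub_P]) auto
qed

lemma P_0: "generate E {q 0, z 0} = P 0"
proof -
  have "C 1 \<subseteq> generate E {q 0, z 0}" unfolding C_def by (rule mono_generate) auto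
  then show ?thesis unfolding P_def
    using q_C [of 0 1] C_carrier by (intro generate_eqI) (auto intro: generate.incl)
qed

lemma residual_datum: "residual_datum E H P L (\<lambda>i. C (Suc i)) {q 0, s} {q 0, z 0} p"
proof (intro residual_datum.intro tree_datum.intro residual_datum_axioms.intro)
  show "L i \<noteq> P i" "L i \<noteq> P (Suc i)" for i
    using z_not_L z_P q_not_L q_C [of "Suc i" "Suc (Suc i)"] C_P by blast+
  show "generate E {q 0, s} = H" by (simp add: H_def)
  show "{q 0, s} \<subseteq> H" unfolding H_def by (auto intro: generate.incl)
  show "{q 0, z 0} \<subseteq> P 0" using P_0 by (metis generate.incl subsetI)
  show "C (Suc i) \<subseteq> C (Suc (Suc i))" for i by (rule C_mono) simp
  show "finite {q 0, s}" "finite {q 0, z 0}" by simp_all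
  show "group E" by (rule group_axioms)
  show "subgroup H E" by (rule sub_H)
  show "subgroup (P i) E" "subgroup (L i) E" "subgroup (C (Suc i)) E" for i
    by (rule sub_P, rule sub_L, rule sub_C)
  show "L i \<subseteq> P i" "L i \<subseteq> P (Suc i)" "C (Suc i) \<subseteq> L i" "C (Suc i) \<subseteq> H" for i
    by (rule L_P, rule L_P, rule C_L, rule C_H)
  show "P (Suc i) = generate E (L i \<union> C (Suc (Suc i)))" for i by (rule P_Suc)
  show "generate E {q 0, z 0} = P 0" by (rule P_0)
  show "finite (L i)" "finite (P i)" for i by (rule finite_L, rule finite_P)
  show "prime p" "residually_p_finite p E" by (rule p, rule residual)
  show "H \<inter> L i \<subseteq> C (Suc i)" "L i \<inter> L (Suc i) \<subseteq> C (Suc (Suc i))" for i by (rule H_L, rule L_L)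
qed

end

section \<open>A concrete seed\<close>

text \<open>\<open>tower p l\<close> acts on vectors \<open>(c\<^sub>0, \<dots>, c\<^sub>l, x)\<close> modulo \<open>p\<close>; the coordinate \<open>x\<close> has index
  \<open>l + 1\<close>. Read \<open>c\<close> as the polynomial \<open>\<Sum>c\<^sub>j X\<^sup>j\<close>: then \<open>q\<^sub>n\<close> adds \<open>X\<^sup>n\<close> and \<open>s\<close> multiplies by
  \<open>1 + X\<close>, whence \<open>s q\<^sub>n s\<inverse> = q\<^sub>n q\<^sub>n\<^sub>+\<^sub>1\<close>, while \<open>z\<^sub>n\<close> adds \<open>c\<^sub>n c\<^sub>n\<^sub>+\<^sub>1 \<cdots> c\<^sub>l\<close> to \<open>x\<close>. For
  \<open>n = l + 1\<close> this is the empty product \<open>1\<close>, and it must be \<open>0\<close> for \<open>n > l + 1\<close>.\<close>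

definition tower :: "nat \<Rightarrow> nat \<Rightarrow> ((nat \<Rightarrow> int) \<Rightarrow> (nat \<Rightarrow> int)) monoid" where
  "tower p l = triangular_group p {..Suc l} (\<lambda>d. d) {\<lambda>d. d}"

definition add_map :: "nat \<Rightarrow> nat \<Rightarrow> (nat \<Rightarrow> (nat \<Rightarrow> int) \<Rightarrow> int) \<Rightarrow> (nat \<Rightarrow> int) \<Rightarrow> (nat \<Rightarrow> int)" where
  "add_map p l \<phi> = (\<lambda>F \<in> vectors p {..Suc l}. \<lambda>d \<in> {..Suc l}. (F d + \<phi> d F) mod int p)"

definition tail_monomial :: "nat \<Rightarrow> nat \<Rightarrow> (nat \<Rightarrow> int) \<Rightarrow> int" where
  "tail_monomial l n F = (if n \<le> Suc l then \<Prod>j\<in>{n..l}. F j else 0)"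

text \<open>The bound \<open>n \<le> l\<close>, like \<open>d \<le> l\<close> in
  \<open>s_shift\<close>, keeps the last coordinate fixed. That is what separates the
  \<open>z\<close> from the group generated by \<open>q 0\<close> and \<open>s\<close>.\<close>

definition q_shift :: "nat \<Rightarrow> nat \<Rightarrow> nat \<Rightarrow> (nat \<Rightarrow> int) \<Rightarrow> int" where
  "q_shift l n d F = (if d = n \<and> n \<le> l then 1 else 0)"

definition z_shift :: "nat \<Rightarrow> nat \<Rightarrow> nat \<Rightarrow> (nat \<Rightarrow> int) \<Rightarrow> int" where
  "z_shift l n d F = (if d = Suc l then tail_monomial l n F else 0)"

definition s_shift :: "nat \<Rightarrow> nat \<Rightarrow> (nat \<Rightarrow> int) \<Rightarrow> int" where
  "s_shift l d F = (if 1 \<le> d \<and> d \<le> l then F (d - 1) else 0)"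

definition q_elem :: "nat \<Rightarrow> nat \<Rightarrow> nat \<Rightarrow> (nat \<Rightarrow> int) \<Rightarrow> (nat \<Rightarrow> int)" where
  "q_elem p n = (\<lambda>l. add_map p l (q_shift l n))"

definition z_elem :: "nat \<Rightarrow> nat \<Rightarrow> nat \<Rightarrow> (nat \<Rightarrow> int) \<Rightarrow> (nat \<Rightarrow> int)" where
  "z_elem p n = (\<lambda>l. add_map p l (z_shift l n))"

definition s_elem :: "nat \<Rightarrow> nat \<Rightarrow> (nat \<Rightarrow> int) \<Rightarrow> (nat \<Rightarrow> int)" where
  "s_elem p = (\<lambda>l. add_map p l (s_shift l))"

locale tower_prime =
  fixes p :: nat
  assumes p: "prime p"
begin

abbreviation "V l \<equiv> vectors p {..Suc l}"
abbreviation "T \<equiv> tower p"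
abbreviation "Tow \<equiv> product_group UNIV T"
abbreviation "q \<equiv> q_elem p"
abbreviation "z \<equiv> z_elem p"
abbreviation "s \<equiv> s_elem p"

lemma finite_p_group_tower: "finite_p_group p (T l)"
proof -
  have "triangular_setup p {..Suc l} (\<lambda>d. d) {\<lambda>d. d} (Suc (Suc l)) 0"
    by unfold_locales (auto simp: p)
  then show ?thesis unfolding tower_def by (rule triangular_setup.finite_p_group_triangular)
qed

lemma group_tower: "group (T l)"
  using finite_p_group_tower by (simp add: finite_p_group_def)

sublocale T: group "T l" for l
  by (rule group_tower)

sublocale Tow: group Tow
  by (simp add: group_tower)

lemma mult_apply: "F \<in> V l \<Longrightarrow> (g \<otimes>\<^bsub>T l\<^esub> h) F = g (h F)"
  by (simp add: tower_def triangular_group_def compose_eq)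

lemma one_apply: "F \<in> V l \<Longrightarrow> \<one>\<^bsub>T l\<^esub> F = F"
  by (simp add: tower_def triangular_group_def)

lemma carrier_apply: "g \<in> carrier (T l) \<Longrightarrow> F \<in> V l \<Longrightarrow> g F \<in> V l"
  by (auto simp: tower_def triangular_group_def)

lemma V_mod: "F \<in> V l \<Longrightarrow> d \<le> Suc l \<Longrightarrow> F d mod int p = F d"
  by (auto simp: vectors_def PiE_def Pi_iff)

lemma T_eqI:
  assumes "g \<in> carrier (T l)" "h \<in> carrier (T l)"
    and "\<And>F d. F \<in> V l \<Longrightarrow> d \<le> Suc l \<Longrightarrow> g F d = h F d"
  shows "g = h"
proof (rule extensionalityI)
  show "g \<in> extensional (V l)" "h \<in> extensional (V l)"
    using assms(1,2) by (auto simp: tower_def triangular_group_def PiE_def)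
  show "g F = h F" if "F \<in> V l" for F
    by (rule vectors_eqI [OF carrier_apply [OF assms(1) that] carrier_apply [OF assms(2) that]])
      (use assms(3) [OF that] in simp)
qed

lemma add_map_apply:
  "F \<in> V l \<Longrightarrow> d \<le> Suc l \<Longrightarrow> add_map p l \<phi> F d = (F d + \<phi> d F) mod int p"
  by (simp add: add_map_def)

lemma add_map_V: "F \<in> V l \<Longrightarrow> add_map p l \<phi> F \<in> V l"
  using prime_gt_0_nat [OF p] by (auto simp: add_map_def vectors_def)

lemma add_map_closed:
  assumes "\<And>d F F'. d \<le> Suc l \<Longrightarrow> (\<And>d'. d' < d \<Longrightarrow> F d' = F' d') \<Longrightarrow> \<phi> d F = \<phi> d F'"
  shows "add_map p l \<phi> \<in> carrier (T l)"
proof -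
  have "add_map p l \<phi> \<in> V l \<rightarrow>\<^sub>E V l" using add_map_V by (auto simp: add_map_def)
  moreover have "triangular p {..Suc l} (\<lambda>d. d) (\<lambda>d. d) (add_map p l \<phi>)"
    unfolding triangular_def
  proof (intro ballI impI)
    fix d F F' assume d: "d \<in> {..Suc l}" and F: "F \<in> V l" "F' \<in> V l"
      and eq: "\<forall>d' \<in> {..Suc l}. d' < d \<longrightarrow> F d' = F' d'"
    have "\<phi> d F = \<phi> d F'" using d eq by (intro assms) auto
    moreover have "int p dvd (F'' d + \<phi> d F) mod int p - (F'' d + \<phi> d F)" for F''
      by (simp add: mod_eq_dvd_iff [symmetric])
    ultimately show "int p dvd add_map p l \<phi> F d - F d - (add_map p l \<phi> F' d - F' d)"
      using dvd_diff [of "int p" "(F d + \<phi> d F) mod int p - (F d + \<phi> d F)" "(F' d + \<phi> d F) mod int p - (F' d + \<phi> d F)"] d F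
      by (simp add: add_map_apply algebra_simps)
  qed
  ultimately show ?thesis by (simp add: tower_def triangular_group_def)
qed

section \<open>Relations among the maps \<open>q\<close>, \<open>z\<close> and \<open>s\<close> of a
  tower\<close>

lemma q_closed: "q n l \<in> carrier (T l)"
  unfolding q_elem_def by (rule add_map_closed) (simp add: q_shift_def)

lemma tail_monomial_cong:
  "(\<And>d. n \<le> d \<Longrightarrow> d \<le> l \<Longrightarrow> F d = F' d) \<Longrightarrow> tail_monomial l n F = tail_monomial l n F'"
  unfolding tail_monomial_def by (auto intro!: prod.cong)

lemma z_closed: "z n l \<in> carrier (T l)"
  unfolding z_elem_def by (rule add_map_closed) (auto simp: z_shift_def intro!: tail_monomial_cong)

lemma s_closed: "s l \<in> carrier (T l)"
  unfolding s_elem_def by (rule add_map_closed) (simp add: s_shift_def)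

lemma q_apply: "F \<in> V l \<Longrightarrow> d \<le> Suc l \<Longrightarrow> q n l F d = (F d + q_shift l n d F) mod int p"
  and z_apply: "F \<in> V l \<Longrightarrow> d \<le> Suc l \<Longrightarrow> z n l F d = (F d + z_shift l n d F) mod int p"
  and s_apply: "F \<in> V l \<Longrightarrow> d \<le> Suc l \<Longrightarrow> s l F d = (F d + s_shift l d F) mod int p"
  by (simp_all add: q_elem_def z_elem_def s_elem_def add_map_apply)

lemma q_V: "F \<in> V l \<Longrightarrow> q n l F \<in> V l"
  and z_V: "F \<in> V l \<Longrightarrow> z n l F \<in> V l"
  and s_V: "F \<in> V l \<Longrightarrow> s l F \<in> V l"
  by (simp_all add: q_elem_def z_elem_def s_elem_def add_map_V)

lemma z_coord: "F \<in> V l \<Longrightarrow> d \<le> l \<Longrightarrow> z n l F d = F d"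
  by (simp add: z_apply z_shift_def V_mod)

lemma tail_monomial_z: "F \<in> V l \<Longrightarrow> tail_monomial l i (z n l F) = tail_monomial l i F"
  by (rule tail_monomial_cong) (simp add: z_coord)

lemma tail_monomial_q_less:
  assumes "F \<in> V l" "j < i" shows "tail_monomial l i (q j l F) = tail_monomial l i F"
  by (rule tail_monomial_cong) (use assms in \<open>simp add: q_apply q_shift_def V_mod\<close>)

text \<open>With \<open>m\<close> the product of the later coordinates,
  \<open>(c + 1) * m = c * m + m\<close>: the finite difference of a monomial in its first variable
  is the next monomial. At \<open>i = Suc l\<close> nothing is shifted, which forces the value 0
  after the empty product.\<close>

lemma tail_monomial_q:
  assumes F: "F \<in> V l"
  shows "tail_monomial l i (q i l F) mod int p = (tail_monomial l i F + tail_monomial l (Suc i) F) mod int p"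
proof (cases "i \<le> l")
  case True
  have split: "tail_monomial l i G = G i * tail_monomial l (Suc i) G" for G
    using True by (simp add: tail_monomial_def prod.atLeast_Suc_atMost)
  have "tail_monomial l i (q i l F) = (F i + 1) mod int p * tail_monomial l (Suc i) F"
    using True F tail_monomial_cong [of "Suc i" l "q i l F" F]
    by (simp add: split q_apply q_shift_def V_mod)
  then have "tail_monomial l i (q i l F) mod int p = (F i + 1) * tail_monomial l (Suc i) F mod int p"
    by (simp only: mod_mult_left_eq)
  then show ?thesis by (simp only: split [of F] distrib_right mult_1_left)
next
  case False
  then show ?thesis by (simp add: tail_monomial_def)
qed

lemma q_commute: "q i l \<otimes>\<^bsub>T l\<^esub> q j l = q j l \<otimes>\<^bsub>T l\<^esub> q i l"
  by (rule T_eqI [where l = l]) (simp_all add: q_closed mult_apply q_apply q_V q_shift_def mod_simps)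

lemma z_commute: "z i l \<otimes>\<^bsub>T l\<^esub> z j l = z j l \<otimes>\<^bsub>T l\<^esub> z i l"
  by (rule T_eqI [where l = l]) (simp_all add: z_closed mult_apply z_apply z_V z_shift_def tail_monomial_z mod_simps add_ac)

lemma zq_commute:
  assumes "j < i" shows "z i l \<otimes>\<^bsub>T l\<^esub> q j l = q j l \<otimes>\<^bsub>T l\<^esub> z i l"
  by (rule T_eqI [where l = l]) (use assms in \<open>simp_all add: q_closed z_closed mult_apply q_apply z_apply q_V z_V
        z_shift_def q_shift_def tail_monomial_q_less mod_simps\<close>)

lemma zq_relation: "z i l \<otimes>\<^bsub>T l\<^esub> q i l = q i l \<otimes>\<^bsub>T l\<^esub> (z i l \<otimes>\<^bsub>T l\<^esub> z (Suc i) l)"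
proof (rule T_eqI [where l = l])
  fix F d assume F: "F \<in> V l" and d: "d \<le> Suc l"
  show "(z i l \<otimes>\<^bsub>T l\<^esub> q i l) F d = (q i l \<otimes>\<^bsub>T l\<^esub> (z i l \<otimes>\<^bsub>T l\<^esub> z (Suc i) l)) F d"
  proof (cases "d = Suc l")
    case True
    have "(F d + tail_monomial l i (q i l F)) mod int p =
        (F d + (tail_monomial l i F + tail_monomial l (Suc i) F)) mod int p"
      using tail_monomial_q [OF F, of i] by (metis mod_add_right_eq)
    then show ?thesis using F True
      by (simp add: mult_apply q_apply z_apply q_V z_V z_shift_def q_shift_def tail_monomial_z mod_simps add_ac)
  next
    case False
    then show ?thesis using F d
      by (simp add: mult_apply q_apply z_apply q_V z_V z_shift_def q_shift_def mod_simps)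
  qed
qed (simp_all add: q_closed z_closed)

text \<open>In polynomial terms, \<open>(1 + X) (c + X^i) = (1 + X) c + X^i + X^(i+1)\<close>, with
  degrees above \<open>l\<close> dropped on both sides.\<close>

lemma sq_relation: "s l \<otimes>\<^bsub>T l\<^esub> q i l = q i l \<otimes>\<^bsub>T l\<^esub> (q (Suc i) l \<otimes>\<^bsub>T l\<^esub> s l)"
proof (rule T_eqI [where l = l])
  fix F d assume F: "F \<in> V l" and d: "d \<le> Suc l"
  show "(s l \<otimes>\<^bsub>T l\<^esub> q i l) F d = (q i l \<otimes>\<^bsub>T l\<^esub> (q (Suc i) l \<otimes>\<^bsub>T l\<^esub> s l)) F d"
    using F d by (cases d)
      (auto simp: mult_apply q_apply s_apply q_V s_V s_shift_def q_shift_def V_mod mod_simps add_ac)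
qed (simp_all add: q_closed s_closed)

text \<open>The increment is constant along the orbit, so it accumulates linearly; \<open>p\<close>
  steps then add nothing modulo \<open>p\<close>.\<close>

lemma pow_apply:
  assumes g: "add_map p l \<phi> \<in> carrier (T l)"
    and inv: "\<And>F d. F \<in> V l \<Longrightarrow> d \<le> Suc l \<Longrightarrow> \<phi> d (add_map p l \<phi> F) = \<phi> d F"
    and F: "F \<in> V l" and d: "d \<le> Suc l"
  shows "(add_map p l \<phi> [^]\<^bsub>T l\<^esub> (k::nat)) F d = (F d + int k * \<phi> d F) mod int p"
proof -
  show ?thesis using F
  proof (induction k arbitrary: F)
    case 0
    then show ?case using d by (simp add: one_apply V_mod)
  next
    case (Suc k)
    have "(add_map p l \<phi> [^]\<^bsub>T l\<^esub> Suc k) F d = (add_map p l \<phi> [^]\<^bsub>T l\<^esub> k) (add_map p l \<phi> F) d"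
      using Suc.prems by (simp add: mult_apply)
    also have "\<dots> = (add_map p l \<phi> F d + int k * \<phi> d F) mod int p"
      using Suc.IH [OF add_map_V [OF Suc.prems]] inv [OF Suc.prems d] by simp
    also have "\<dots> = (F d + int (Suc k) * \<phi> d F) mod int p"
      using Suc.prems d by (simp add: add_map_apply mod_simps algebra_simps)
    finally show ?case .
  qed
qed

lemma q_pow_apply: "F \<in> V l \<Longrightarrow> d \<le> Suc l \<Longrightarrow> (q n l [^]\<^bsub>T l\<^esub> (k::nat)) F d = (F d + int k * q_shift l n d F) mod int p"
  using q_closed [of n l] unfolding q_elem_def by (intro pow_apply) (simp_all add: q_shift_def)

lemma z_pow_apply: "F \<in> V l \<Longrightarrow> d \<le> Suc l \<Longrightarrow> (z n l [^]\<^bsub>T l\<^esub> (k::nat)) F d = (F d + int k * z_shift l n d F) mod int p"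
  using z_closed [of n l] tail_monomial_z [of _ l n n]
  unfolding z_elem_def by (intro pow_apply) (simp_all add: z_shift_def)

lemma pow_p: "q n l [^]\<^bsub>T l\<^esub> p = \<one>\<^bsub>T l\<^esub>" "z n l [^]\<^bsub>T l\<^esub> p = \<one>\<^bsub>T l\<^esub>"
proof -
  show "q n l [^]\<^bsub>T l\<^esub> p = \<one>\<^bsub>T l\<^esub>"
    by (rule T_eqI [where l = l]) (simp_all add: q_closed q_pow_apply one_apply V_mod)
  show "z n l [^]\<^bsub>T l\<^esub> p = \<one>\<^bsub>T l\<^esub>"
    by (rule T_eqI [where l = l]) (simp_all add: z_closed z_pow_apply one_apply V_mod)
qed

lemma q_Tow: "q n \<in> carrier Tow" and z_Tow: "z n \<in> carrier Tow" and s_Tow: "s \<in> carrier Tow"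
  using q_closed z_closed s_closed by auto

lemma Tow_pow: "(g [^]\<^bsub>Tow\<^esub> (k::nat)) l = g l [^]\<^bsub>T l\<^esub> k"
  by (induction k) simp_all

text \<open>Serves to refute membership in a generated subgroup: a coordinate fixed by the
  generators is fixed by everything they generate.\<close>

lemma fixing_subgroup:
  assumes "d \<le> Suc l"
  shows "subgroup {g \<in> carrier Tow. \<forall>F \<in> V l. g l F d = F d} Tow"
proof -
  have cl: "g l \<in> carrier (T l)" if "g \<in> carrier Tow" for g using that by auto
  show ?thesis
  proof (rule Tow.subgroupI)
    have "\<one>\<^bsub>Tow\<^esub> \<in> {g \<in> carrier Tow. \<forall>F \<in> V l. g l F d = F d}"
      using Tow.one_closed by (auto simp: one_apply)
    then show "{g \<in> carrier Tow. \<forall>F \<in> V l. g l F d = F d} \<noteq> {}" by blast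
    fix g assume g: "g \<in> {g \<in> carrier Tow. \<forall>F \<in> V l. g l F d = F d}"
    have inv: "(inv\<^bsub>Tow\<^esub> g) l = inv\<^bsub>T l\<^esub> g l"
      using g by (simp add: inv_product_group group_tower)
    have "(inv\<^bsub>Tow\<^esub> g) l F d = F d" if F: "F \<in> V l" for F
    proof -
      have iF: "(inv\<^bsub>T l\<^esub> g l) F \<in> V l" using g F cl by (intro carrier_apply [OF T.inv_closed F]) auto
      have "g l ((inv\<^bsub>T l\<^esub> g l) F) = (g l \<otimes>\<^bsub>T l\<^esub> inv\<^bsub>T l\<^esub> g l) F" using F by (simp add: mult_apply)
      also have "\<dots> = F" using g F cl by (simp add: one_apply)
      finally have "g l ((inv\<^bsub>T l\<^esub> g l) F) d = F d" by simp
      then show ?thesis using g iF inv by simp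
    qed
    then show "inv\<^bsub>Tow\<^esub> g \<in> {g \<in> carrier Tow. \<forall>F \<in> V l. g l F d = F d}"
      using g Tow.inv_closed by blast
    fix h assume h: "h \<in> {g \<in> carrier Tow. \<forall>F \<in> V l. g l F d = F d}"
    have "(g \<otimes>\<^bsub>Tow\<^esub> h) l F d = F d" if F: "F \<in> V l" for F
    proof -
      have "h l F \<in> V l" using h F cl carrier_apply by blast
      then show ?thesis using g h F by (simp add: mult_apply)
    qed
    then show "g \<otimes>\<^bsub>Tow\<^esub> h \<in> {g \<in> carrier Tow. \<forall>F \<in> V l. g l F d = F d}"
      using g h Tow.m_closed by blast
  qed auto
qed

lemma restrict_V:
  assumes "\<And>d. f d \<in> {0, 1}"
  shows "(\<lambda>d \<in> {..Suc l}. f d) \<in> V l"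
proof -
  have "f d \<in> {0..<int p}" for d using assms [of d] prime_gt_1_nat [OF p] by auto
  then show ?thesis by (simp add: vectors_def)
qed

text \<open>At level \<open>l = i\<close> the map \<open>z i\<close> adds coordinate
  \<open>i\<close> to the last coordinate and \<open>z (Suc i)\<close> adds 1, the empty product,
  while \<open>q 0\<close> and \<open>s\<close> fix the last coordinate.\<close>

lemma z_independent:
  fixes a b :: nat
  assumes "z i [^]\<^bsub>Tow\<^esub> a \<otimes>\<^bsub>Tow\<^esub> z (Suc i) [^]\<^bsub>Tow\<^esub> b \<in> generate Tow {q 0, s}"
  shows "p dvd a \<and> p dvd b"
proof -
  let ?S = "{g \<in> carrier Tow. \<forall>F \<in> V i. g i F (Suc i) = F (Suc i)}"
  have "generate Tow {q 0, s} \<subseteq> ?S"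
    using q_Tow s_Tow
    by (intro Tow.generate_subset_subgroup fixing_subgroup)
      (auto simp: q_apply s_apply q_shift_def s_shift_def V_mod)
  then have preserved: "(z i i [^]\<^bsub>T i\<^esub> a \<otimes>\<^bsub>T i\<^esub> z (Suc i) i [^]\<^bsub>T i\<^esub> b) F (Suc i) = F (Suc i)" if "F \<in> V i" for F
    using assms that Tow_pow [of "z i" a i] Tow_pow [of "z (Suc i)" b i] by auto
  have val: "int p dvd int b + int a * F i" if F: "F \<in> V i" for F
  proof -
    have zF: "(z (Suc i) i [^]\<^bsub>T i\<^esub> b) F \<in> V i" using F z_closed by (intro carrier_apply [OF _ F]) simp
    have "(z i i [^]\<^bsub>T i\<^esub> a \<otimes>\<^bsub>T i\<^esub> z (Suc i) i [^]\<^bsub>T i\<^esub> b) F (Suc i) = (F (Suc i) + (int b + int a * F i)) mod int p"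
      using F zF by (simp add: mult_apply z_pow_apply z_shift_def tail_monomial_def V_mod mod_simps add_ac)
    then have "F (Suc i) mod int p = (F (Suc i) + (int b + int a * F i)) mod int p"
      using preserved [OF F] F by (simp add: V_mod)
    then have "int p dvd (F (Suc i) + (int b + int a * F i)) - F (Suc i)" by (metis mod_eq_dvd_iff)
    then show ?thesis by simp
  qed
  \<comment> \<open>Vectors with coordinate \<open>i\<close> equal to 0 and to 1 separate the two
    exponents.\<close>
  have 0: "int p dvd int b" using val [OF restrict_V [of "\<lambda>d. 0"]] by simp
  have "int p dvd int b + int a" using val [OF restrict_V [of "\<lambda>d. 1"]] by simp
  then have "int p dvd int a" using 0 by (simp add: dvd_add_right_iff)
  then show ?thesis using 0 by simp
qed

text \<open>At level \<open>i\<close> the maps \<open>q j\<close> with \<open>j < i\<close> fix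
  coordinate \<open>i\<close>, but \<open>q i\<close> moves it on the zero vector.\<close>

lemma q_independent: "q i \<notin> generate Tow (q ` {..<i})"
proof
  assume q: "q i \<in> generate Tow (q ` {..<i})"
  let ?S = "{g \<in> carrier Tow. \<forall>F \<in> V i. g i F i = F i}"
  have "generate Tow (q ` {..<i}) \<subseteq> ?S"
    using q_Tow by (intro Tow.generate_subset_subgroup fixing_subgroup)
      (auto simp: q_apply q_shift_def V_mod)
  then have "q i i (\<lambda>d \<in> {..Suc i}. 0) i = (\<lambda>d \<in> {..Suc i}. 0 :: int) i"
    using q restrict_V [of "\<lambda>d. 0" i] by blast
  then show False
    using prime_gt_1_nat [OF p] restrict_V [of "\<lambda>d. 0" i] by (simp add: q_apply q_shift_def)
qed

lemma seed_tower: "seed Tow p q z s"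
proof (intro seed.intro seed_axioms.intro)
  show "group Tow" by (rule Tow.group_axioms)
  show "residually_p_finite p Tow" by (rule residually_p_finite_product_group [OF finite_p_group_tower])
  show "q i [^]\<^bsub>Tow\<^esub> p = \<one>\<^bsub>Tow\<^esub>" "z i [^]\<^bsub>Tow\<^esub> p = \<one>\<^bsub>Tow\<^esub>" for i
    by (simp_all add: fun_eq_iff Tow_pow pow_p)
  show "q i \<otimes>\<^bsub>Tow\<^esub> q j = q j \<otimes>\<^bsub>Tow\<^esub> q i" for i j by (simp add: q_commute)
  show "z i \<otimes>\<^bsub>Tow\<^esub> z (Suc i) = z (Suc i) \<otimes>\<^bsub>Tow\<^esub> z i" for i by (simp add: z_commute)
  show "z i \<otimes>\<^bsub>Tow\<^esub> q j = q j \<otimes>\<^bsub>Tow\<^esub> z i" if "j < i" for i j using that by (simp add: zq_commute)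
  show "z i \<otimes>\<^bsub>Tow\<^esub> q i = q i \<otimes>\<^bsub>Tow\<^esub> (z i \<otimes>\<^bsub>Tow\<^esub> z (Suc i))" for i by (simp add: zq_relation)
  show "s \<otimes>\<^bsub>Tow\<^esub> q i = q i \<otimes>\<^bsub>Tow\<^esub> (q (Suc i) \<otimes>\<^bsub>Tow\<^esub> s)" for i by (simp add: sq_relation)
qed (fact p q_Tow z_Tow s_Tow z_independent q_independent)+

end

section \<open>Conclusion\<close>

theorem theorem5p1:
  fixes p :: nat
  assumes "prime p"
  shows "\<exists>G :: nat monoid. group G \<and> finitely_generated G \<and> inaccessible G \<and> residually_p_finite p G"
proof -
  interpret tower_prime p by unfold_locales (rule assms)
  interpret R: residual_datum Tow "seed.H Tow q s" "seed.P Tow q z" "seed.L Tow q z"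
    "\<lambda>i. seed.C Tow q (Suc i)" "{q 0, s}" "{q 0, z 0}" p
    by (rule seed.residual_datum [OF seed_tower])
  show ?thesis
    using R.group_tree_group R.finitely_generated_tree_group R.inaccessible_tree_group
      R.residually_p_finite_tree_group by blast
qed

end
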